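(* Let $n\ge 1$ and $s\ge 1$, and for $u_0\in L^2(\mathbb{R}^n)$ let $u(x,t)$ be the solution of the Cauchy problem $$i\partial_tu(x,t)=(-\Delta)^{\frac s2}u(x,t),\qquad u(x,0)=u_0(x)\in L^2(\mathbb{R}^n).$$ Then there exist some $\sigma>0$, some large but fixed number $T_0>0$, and a constant $C>0$ such that for any $r>0$, any $t_2>t_1\ge 0$ with $t_2-t_1>r^sT_0$, and any $u_0\in L^2(\mathbb{R}^n)$, $$\|u_0\|^2\le C\left(\int_{|x|\ge r}|u(x,t_1)|^2\,dx+\int_{|x|\ge \frac{\sigma(t_2-t_1)}{r^{s-1}}}|u(x,t_2)|^2\,dx\right).$$
   Context: $\|\cdot\|$ is the norm of $L^2(\mathbb{R}^n)$. $(-\Delta)^{s/2}$ is the self-adjoint operator on $L^2(\mathbb{R}^n)$ with domain the Sobolev space $H^s(\mathbb{R}^n)$ given by the Fourier multiplier $|\xi|^s$; the solution is $u(\cdot,t)=e^{-it(-\Delta)^{s/2}}u_0$. *)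

theory Defs
  imports "HOL-Analysis.Analysis"
begin

text \<open>Elements of \<open>L\<^sup>2\<close> are represented by functions; every notion below that concerns \<open>L\<^sup>2\<close>
  is invariant under changing these representatives on null sets.\<close>

definition L2 :: "('a::euclidean_space \<Rightarrow> complex) set" where
  "L2 = {f \<in> borel_measurable lebesgue. integrable lebesgue (\<lambda>x. (cmod (f x))\<^sup>2)}"

definition L2_norm :: "('a::euclidean_space \<Rightarrow> complex) \<Rightarrow> real" where
  "L2_norm f = sqrt (LINT x|lebesgue. (cmod (f x))\<^sup>2)"

definition fourier_integral :: "('a::euclidean_space \<Rightarrow> complex) \<Rightarrow> 'a \<Rightarrow> complex" where
  "fourier_integral f \<xi> =
     of_real ((2 * pi) powr (- real DIM('a) / 2)) *
     (LINT x|lebesgue. exp (- \<i> * of_real (\<xi> \<bullet> x)) * f x)"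

text \<open>\<open>L2_fourier f g\<close>: \<open>g\<close> is the Fourier--Plancherel transform of \<open>f\<close>, i.e. the limit in
  \<open>L\<^sup>2\<close> of the Fourier integrals of the truncations of \<open>f\<close> (which lie in \<open>L\<^sup>1\<close>) to the balls of
  radius \<open>R\<close>. The convergence is expressed with the nonnegative integral, since the Bochner
  integral of a non-integrable function would be \<open>0\<close>.\<close>

definition L2_fourier ::
  "('a::euclidean_space \<Rightarrow> complex) \<Rightarrow> ('a \<Rightarrow> complex) \<Rightarrow> bool" where
  "L2_fourier f g \<longleftrightarrow> f \<in> L2 \<and> g \<in> L2 \<and>
     ((\<lambda>R::real. \<integral>\<^sup>+ \<xi>. ennreal
          ((cmod (fourier_integral (\<lambda>x. indicator (cball 0 R) x * f x) \<xi> - g \<xi>))\<^sup>2) \<partial>lebesgue)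
        \<longlongrightarrow> 0) at_top"

text \<open>A (possibly unbounded) operator on \<open>L\<^sup>2\<close> is represented by its graph. The multiplier
  operator with symbol \<open>m\<close> has its maximal domain: the \<open>f\<close> in \<open>L\<^sup>2\<close> for which \<open>m\<close> times the
  Fourier transform of \<open>f\<close> is again in \<open>L\<^sup>2\<close>.\<close>

type_synonym 'a L2_operator = "('a \<Rightarrow> complex) \<Rightarrow> ('a \<Rightarrow> complex) \<Rightarrow> bool"

definition fourier_multiplier :: "('a::euclidean_space \<Rightarrow> complex) \<Rightarrow> 'a L2_operator" where
  "fourier_multiplier m f g \<longleftrightarrow>
     (\<exists>h. L2_fourier f h \<and> L2_fourier g (\<lambda>\<xi>. m \<xi> * h \<xi>))"

text \<open>\<open>(-\<Delta>)\<^bsup>s/2\<^esup>\<close>; for \<open>s \<ge> 0\<close> the maximal domain is the Sobolev space \<open>H\<^sup>s\<close>.\<close>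

definition frac_laplacian :: "real \<Rightarrow> 'a::euclidean_space L2_operator" where
  "frac_laplacian s = fourier_multiplier (\<lambda>\<xi>. of_real (norm \<xi> powr s))"

text \<open>\<open>e\<^bsup>-itA\<^esup>\<close> for a self-adjoint operator \<open>A\<close> that the Fourier transform diagonalises, by the
  functional calculus: if \<open>A\<close> is the multiplier with real symbol \<open>a\<close>, then \<open>e\<^bsup>-itA\<^esup>\<close> is the
  multiplier with symbol \<open>e\<^bsup>-ita\<^esup>\<close>. The symbol \<open>a\<close> is determined by \<open>A\<close> almost everywhere, so
  the result does not depend on its choice.\<close>

definition unitary_group :: "'a::euclidean_space L2_operator \<Rightarrow> real \<Rightarrow> 'a L2_operator" where
  "unitary_group A t f g \<longleftrightarrow>
     (\<exists>a :: 'a \<Rightarrow> real. a \<in> borel_measurable lebesgue \<and>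
        A = fourier_multiplier (\<lambda>\<xi>. of_real (a \<xi>)) \<and>
        fourier_multiplier (\<lambda>\<xi>. exp (- \<i> * of_real (t * a \<xi>))) f g)"

text \<open>The solution \<open>u(\<sqdot>,t) = e\<^bsup>-it(-\<Delta>)\<^sup>s\<^sup>/\<^sup>2\<^esup>u\<^sub>0\<close>, for \<open>t \<ge> 0\<close>, of
  \<open>i\<partial>\<^sub>tu = (-\<Delta>)\<^bsup>s/2\<^esup>u\<close>, \<open>u(\<sqdot>,0) = u\<^sub>0\<close>.\<close>

definition frac_schroedinger_solution ::
  "real \<Rightarrow> ('a::euclidean_space \<Rightarrow> complex) \<Rightarrow> ('a \<Rightarrow> real \<Rightarrow> complex) \<Rightarrow> bool" where
  "frac_schroedinger_solution s u0 u \<longleftrightarrow>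
     (\<forall>t\<ge>0. unitary_group (frac_laplacian s) t u0 (\<lambda>x. u x t))"

end

theory Submission
  imports Defs "HOL-Probability.Characteristic_Functions"
begin

text \<open>
  Put \<open>\<tau> = t\<^sub>2 - t\<^sub>1\<close> and \<open>U = e\<^bsup>-\<i>\<tau>(-\<Delta>)\<^sup>s\<^sup>/\<^sup>2\<^esup>\<close>, which is unitary, let \<open>A\<close> be the ball of radius
  \<open>r\<close> and \<open>B\<close> the ball of radius \<open>\<rho> = \<sigma>\<tau>/r\<^bsup>s-1\<^esup>\<close>. Everything follows from the bound
  \<open>\<parallel>1\<^sub>B U f\<parallel> \<le> \<parallel>f\<parallel>/2\<close> for \<open>f\<close> supported in \<open>A\<close> (\<open>localised_state_escapes\<close>): splitting \<open>u(t\<^sub>1)\<close> at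
  \<open>A\<close> and \<open>u(t\<^sub>2)\<close> at \<open>B\<close>, it bounds \<open>\<parallel>u\<^sub>0\<parallel>\<close> by \<open>\<parallel>u\<^sub>0\<parallel>/2\<close> plus the norms of \<open>u(t\<^sub>1)\<close> outside \<open>A\<close> and
  of \<open>u(t\<^sub>2)\<close> outside \<open>B\<close>.

  The bound says that a state localised in \<open>A\<close> leaves \<open>B\<close>. By the uncertainty principle, little of its
  mass sits at frequencies below a small multiple of \<open>1/r\<close> (\<open>slow_part_bound\<close>): the transform is bounded
  by a multiple of \<open>|A|\<^bsup>1/2\<^esup>\<parallel>f\<parallel>\<close>, and these frequencies fill a ball whose volume is a small
  multiple of \<open>1/|A|\<close>. The other frequencies move with group velocity
  \<open>s|\<xi>|\<^bsup>s-2\<^esup>\<xi>\<close>, whose length is at least a multiple of \<open>r\<^bsup>1-s\<^esup>\<close> because \<open>s \<ge> 1\<close>.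

  The motion is made quantitative on the Fourier side, where the coordinate \<open>x\<^sub>j\<close> acts as
  \<open>\<i>\<partial>\<^sub>j\<close> (\<open>fast_part_local_bound\<close>). With the bounded vector field \<open>m(\<xi>) = \<xi>/(D + |\<xi>|\<^sup>s)\<close>, a regularised
  multiple of the inverse velocity,
  \<open>\<Sum>\<^sub>j x\<^sub>j U m\<^sub>j f = \<tau>s U \<phi> f + U(\<Sum>\<^sub>j m\<^sub>j x\<^sub>j f) + U(\<i> div m f)\<close> with
  \<open>\<phi>(\<xi>) = |\<xi>|\<^sup>s/(D + |\<xi>|\<^sup>s)\<close>, functions of \<open>\<xi>\<close> denoting the corresponding multipliers. On \<open>B\<close> the left side
  has norm at most a multiple of \<open>\<rho>\<parallel>f\<parallel>\<close>, and the last two terms are bounded independently of \<open>\<tau>\<close>, the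
  first of them because \<open>f\<close> lives in \<open>A\<close>. Dividing by \<open>\<tau>s\<close> shows that \<open>U \<phi> f\<close> is small on \<open>B\<close> once \<open>\<sigma>\<close>
  is small and \<open>\<tau>\<close> is large compared with \<open>r\<^sup>s\<close>, and \<open>1 - \<phi>\<close> is concentrated on the slow frequencies if
  \<open>D = \<delta>r\<^bsup>-s\<^esup>\<close> with \<open>\<delta>\<close> small. Difference quotients in \<open>\<xi>\<close> replace the derivatives, so that only
  translations of the transform, that is modulations of the function, occur.

  The argument uses that the Fourier--Plancherel transform is unitary. Isometry on integrable functions comes
  from Gaussian regularisation and the density of continuous functions with compact support
  (\<open>fourier_integral_isometry\<close>), existence from completeness (\<open>L2_fourier_exists\<close>), and surjectivity from
  the multiplication formula \<open>\<integral> F g = \<integral> f G\<close> for transforms \<open>F\<close>, \<open>G\<close> of \<open>f\<close>, \<open>g\<close>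
  (\<open>L2_fourier_surj\<close>). Surjectivity also shows that the operator determines its symbol almost everywhere
  (\<open>fourier_multiplier_symbol_unique\<close>), which identifies the abstract unitary group with the
  multiplier \<open>e\<^bsup>-\<i>t|\<xi>|\<^sup>s\<^esup>\<close>.
\<close>

section \<open>The Hilbert space of square-integrable functions\<close>

lemma L2_iff:
  "f \<in> L2 \<longleftrightarrow> f \<in> borel_measurable lebesgue \<and> (\<integral>\<^sup>+ x. ennreal ((cmod (f x))\<^sup>2) \<partial>lebesgue) < \<infinity>"
  unfolding L2_def by (auto simp: integrable_iff_bounded)

lemma borel_measurable_lebesgueI:
  "f \<in> borel_measurable borel \<Longrightarrow> f \<in> borel_measurable lebesgue"
  by (rule measurable_completion) simp

lemma L2_measurable [measurable_dest]: "f \<in> L2 \<Longrightarrow> f \<in> borel_measurable lebesgue"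
  by (simp add: L2_def)

lemma L2_integrable: "f \<in> L2 \<Longrightarrow> integrable lebesgue (\<lambda>x. (cmod (f x))\<^sup>2)"
  by (simp add: L2_def)

lemma L2_norm_nonneg [simp]: "0 \<le> L2_norm f"
  by (simp add: L2_norm_def)

lemma L2_norm_square: "(L2_norm f)\<^sup>2 = (LINT x|lebesgue. (cmod (f x))\<^sup>2)"
  by (simp add: L2_norm_def)

lemma L2_norm_nn:
  assumes "f \<in> L2"
  shows "(\<integral>\<^sup>+ x. ennreal ((cmod (f x))\<^sup>2) \<partial>lebesgue) = ennreal ((L2_norm f)\<^sup>2)"
  unfolding L2_norm_square by (rule nn_integral_eq_integral[OF L2_integrable[OF assms]]) simp

lemma L2_I_le:
  assumes "f \<in> borel_measurable lebesgue" "0 \<le> c"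
    and le: "(\<integral>\<^sup>+ x. ennreal ((cmod (f x))\<^sup>2) \<partial>lebesgue) \<le> ennreal (c\<^sup>2)"
  shows "f \<in> L2" "L2_norm f \<le> c"
proof -
  show f: "f \<in> L2" unfolding L2_iff using assms(1) le by (auto intro: le_less_trans)
  have "(L2_norm f)\<^sup>2 \<le> c\<^sup>2" using le L2_norm_nn[OF f] by (simp add: ennreal_le_iff)
  then show "L2_norm f \<le> c" using \<open>0 \<le> c\<close> by (simp add: power2_le_iff_abs_le)
qed

lemma L2_bounded_by:
  assumes g: "g \<in> L2" and f: "f \<in> borel_measurable lebesgue" and M: "0 \<le> M"
    and le: "AE x in lebesgue. cmod (f x) \<le> M * cmod (g x)"
  shows "f \<in> L2" "L2_norm f \<le> M * L2_norm g"
proof -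
  have "(\<integral>\<^sup>+ x. ennreal ((cmod (f x))\<^sup>2) \<partial>lebesgue)
      \<le> (\<integral>\<^sup>+ x. ennreal (M\<^sup>2) * ennreal ((cmod (g x))\<^sup>2) \<partial>lebesgue)"
  proof (rule nn_integral_mono_AE, use le in eventually_elim)
    fix x assume "cmod (f x) \<le> M * cmod (g x)"
    then have "(cmod (f x))\<^sup>2 \<le> (M * cmod (g x))\<^sup>2" by (rule power_mono) simp
    then show "ennreal ((cmod (f x))\<^sup>2) \<le> ennreal (M\<^sup>2) * ennreal ((cmod (g x))\<^sup>2)"
      by (simp add: power_mult_distrib flip: ennreal_mult)
  qed
  also have "\<dots> = ennreal (M\<^sup>2) * ennreal ((L2_norm g)\<^sup>2)"
    using L2_measurable[OF g] by (subst nn_integral_cmult) (auto simp: L2_norm_nn[OF g])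
  also have "\<dots> = ennreal ((M * L2_norm g)\<^sup>2)"
    by (simp add: power_mult_distrib flip: ennreal_mult)
  finally have le': "(\<integral>\<^sup>+ x. ennreal ((cmod (f x))\<^sup>2) \<partial>lebesgue) \<le> ennreal ((M * L2_norm g)\<^sup>2)" .
  have "0 \<le> M * L2_norm g" using M by simp
  from L2_I_le[OF f this le'] show "f \<in> L2" "L2_norm f \<le> M * L2_norm g" .
qed

lemma L2_cong_AE:
  assumes f: "f \<in> L2" and eq: "AE x in lebesgue. f x = g x"
  shows "g \<in> L2" "L2_norm g = L2_norm f"
proof -
  have gm: "g \<in> borel_measurable lebesgue" by (rule borel_measurable_AE[OF L2_measurable[OF f] eq])
  have "AE x in lebesgue. cmod (g x) \<le> 1 * cmod (f x)" using eq by eventually_elim simp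
  from L2_bounded_by[OF f gm _ this] have g: "g \<in> L2" "L2_norm g \<le> L2_norm f" by auto
  have "AE x in lebesgue. cmod (f x) \<le> 1 * cmod (g x)" using eq by eventually_elim simp
  from L2_bounded_by(2)[OF g(1) L2_measurable[OF f] _ this] g show "g \<in> L2" "L2_norm g = L2_norm f" by auto
qed

lemma L2_0 [simp]: "(\<lambda>x. 0) \<in> L2" "L2_norm (\<lambda>x. 0) = 0"
  by (auto simp: L2_iff L2_norm_def)

lemma L2_mult_bounded:
  assumes g: "g \<in> L2" and m: "m \<in> borel_measurable lebesgue" and M: "\<And>x. cmod (m x) \<le> M"
  shows "(\<lambda>x. m x * g x) \<in> L2" "L2_norm (\<lambda>x. m x * g x) \<le> M * L2_norm g"
proof -
  have "0 \<le> M" using M[of undefined] norm_ge_zero[of "m undefined"] by linarith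
  moreover have "(\<lambda>x. m x * g x) \<in> borel_measurable lebesgue" using m g by measurable
  moreover have "AE x in lebesgue. cmod (m x * g x) \<le> M * cmod (g x)"
    using M by (auto simp: norm_mult intro!: mult_right_mono)
  ultimately show "(\<lambda>x. m x * g x) \<in> L2" "L2_norm (\<lambda>x. m x * g x) \<le> M * L2_norm g"
    using L2_bounded_by[OF g] by blast+
qed

lemma L2_mult_unimodular:
  assumes g: "g \<in> L2" and m: "m \<in> borel_measurable lebesgue" and M: "\<And>x. cmod (m x) = 1"
  shows "(\<lambda>x. m x * g x) \<in> L2" "L2_norm (\<lambda>x. m x * g x) = L2_norm g"
  using L2_mult_bounded(1)[OF g m, of 1] M by (auto simp: L2_norm_def norm_mult)

lemma L2_cmult:
  assumes g: "g \<in> L2"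
  shows "(\<lambda>x. c * g x) \<in> L2" "L2_norm (\<lambda>x. c * g x) = cmod c * L2_norm g"
  using L2_mult_bounded(1)[OF g, of "\<lambda>_. c" "cmod c"]
  by (auto simp: L2_norm_def norm_mult power_mult_distrib real_sqrt_mult)

lemma L2_norm_minus_commute: "L2_norm (\<lambda>x. f x - g x) = L2_norm (\<lambda>x. g x - f x)"
  by (simp add: L2_norm_def norm_minus_commute)

lemma L2_cnj:
  "f \<in> L2 \<Longrightarrow> (\<lambda>x. cnj (f x)) \<in> L2"
  by (auto simp: L2_iff intro: borel_measurable_continuous_on[OF continuous_on_cnj[OF continuous_on_id]])

lemma L2_norm_cnj: "L2_norm (\<lambda>x. cnj (f x)) = L2_norm f"
  by (simp add: L2_norm_def)

text \<open>Integrating the pointwise bound \<open>|f + g|\<^sup>2 \<le> (1 + b/a)|f|\<^sup>2 + (1 + a/b)|g|\<^sup>2\<close> with \<open>a\<close> and \<open>b\<close> the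
  norms of \<open>f\<close> and \<open>g\<close> gives \<open>(a + b)\<^sup>2\<close>; the additional \<open>e\<close> avoids dividing by zero.\<close>

lemma L2_add:
  assumes f: "f \<in> L2" and g: "g \<in> L2"
  shows "(\<lambda>x. f x + g x) \<in> L2" "L2_norm (\<lambda>x. f x + g x) \<le> L2_norm f + L2_norm g"
proof -
  have fm: "f \<in> borel_measurable lebesgue" and gm: "g \<in> borel_measurable lebesgue"
    using f g L2_measurable by auto
  have *: "(\<lambda>x. f x + g x) \<in> L2 \<and> L2_norm (\<lambda>x. f x + g x) \<le> L2_norm f + L2_norm g + e"
    if "e > 0" for e
  proof -
    define a where "a = L2_norm f + e / 2"
    define b where "b = L2_norm g + e / 2"
    have ab: "a > 0" "b > 0" "L2_norm f \<le> a" "L2_norm g \<le> b"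
      using that by (auto simp: a_def b_def intro: add_nonneg_pos)
    have pw: "(cmod (f x + g x))\<^sup>2 \<le> (1 + b/a) * (cmod (f x))\<^sup>2 + (1 + a/b) * (cmod (g x))\<^sup>2" for x
    proof -
      define u v where "u = cmod (f x)" and "v = cmod (g x)"
      have "(cmod (f x + g x))\<^sup>2 \<le> (u + v)\<^sup>2"
        unfolding u_def v_def by (intro power_mono norm_triangle_ineq) simp
      moreover have "(1 + b/a) * u\<^sup>2 + (1 + a/b) * v\<^sup>2 - (u + v)\<^sup>2 = (b * u - a * v)\<^sup>2 / (a * b)"
        using ab by (simp add: field_simps power2_eq_square)
      moreover have "(b * u - a * v)\<^sup>2 / (a * b) \<ge> 0" using ab by simp
      ultimately have "(cmod (f x + g x))\<^sup>2 \<le> (1 + b/a) * u\<^sup>2 + (1 + a/b) * v\<^sup>2" by linarith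
      then show ?thesis by (simp add: u_def v_def)
    qed
    have "(\<integral>\<^sup>+ x. ennreal ((cmod (f x + g x))\<^sup>2) \<partial>lebesgue) \<le>
        (\<integral>\<^sup>+ x. ennreal (1 + b/a) * ennreal ((cmod (f x))\<^sup>2)
           + ennreal (1 + a/b) * ennreal ((cmod (g x))\<^sup>2) \<partial>lebesgue)"
      using pw ab by (intro nn_integral_mono) (auto simp flip: ennreal_mult ennreal_plus intro!: ennreal_leI)
    also have "\<dots> = ennreal (1 + b/a) * ennreal ((L2_norm f)\<^sup>2) + ennreal (1 + a/b) * ennreal ((L2_norm g)\<^sup>2)"
      using fm gm
      by (subst nn_integral_add) (auto simp: nn_integral_cmult L2_norm_nn[OF f] L2_norm_nn[OF g])
    also have "\<dots> = ennreal ((1 + b/a) * (L2_norm f)\<^sup>2 + (1 + a/b) * (L2_norm g)\<^sup>2)"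
      using ab by (simp flip: ennreal_mult ennreal_plus)
    also have "\<dots> \<le> ennreal ((1 + b/a) * a\<^sup>2 + (1 + a/b) * b\<^sup>2)"
      using ab by (intro ennreal_leI add_mono mult_left_mono power_mono) auto
    also have "(1 + b/a) * a\<^sup>2 + (1 + a/b) * b\<^sup>2 = (a + b)\<^sup>2"
      using ab by (simp add: field_simps power2_eq_square)
    finally have le: "(\<integral>\<^sup>+ x. ennreal ((cmod (f x + g x))\<^sup>2) \<partial>lebesgue) \<le> ennreal ((a + b)\<^sup>2)" .
    have "(\<lambda>x. f x + g x) \<in> borel_measurable lebesgue" using fm gm by measurable
    moreover have "0 \<le> a + b" using ab by linarith
    ultimately have "(\<lambda>x. f x + g x) \<in> L2" "L2_norm (\<lambda>x. f x + g x) \<le> a + b"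
      using L2_I_le le by blast+
    moreover have "a + b = L2_norm f + L2_norm g + e" by (simp add: a_def b_def)
    ultimately show ?thesis by simp
  qed
  show "(\<lambda>x. f x + g x) \<in> L2" using *[of 1] by simp
  show "L2_norm (\<lambda>x. f x + g x) \<le> L2_norm f + L2_norm g"
    by (rule field_le_epsilon) (use * in auto)
qed

lemma L2_diff:
  assumes f: "f \<in> L2" and g: "g \<in> L2"
  shows "(\<lambda>x. f x - g x) \<in> L2" "L2_norm (\<lambda>x. f x - g x) \<le> L2_norm f + L2_norm g"
  using L2_add[OF f L2_cmult(1)[OF g, of "-1"]] L2_cmult(2)[OF g, of "-1"] by auto

lemma L2_norm_le_diff:
  assumes f: "f \<in> L2" and g: "g \<in> L2"
  shows "L2_norm f \<le> L2_norm g + L2_norm (\<lambda>x. f x - g x)"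
  using L2_add(2)[OF g L2_diff(1)[OF f g]] by simp

lemma L2_norm_diff_triangle:
  assumes "f \<in> L2" "g \<in> L2" "k \<in> L2"
  shows "L2_norm (\<lambda>x. f x - k x) \<le> L2_norm (\<lambda>x. f x - g x) + L2_norm (\<lambda>x. g x - k x)"
  using L2_add(2)[OF L2_diff(1)[OF assms(1,2)] L2_diff(1)[OF assms(2,3)]] by simp

lemma L2_sum:
  assumes "finite I" "\<And>i. i \<in> I \<Longrightarrow> f i \<in> L2"
  shows "(\<lambda>x. \<Sum>i\<in>I. f i x) \<in> L2" "L2_norm (\<lambda>x. \<Sum>i\<in>I. f i x) \<le> (\<Sum>i\<in>I. L2_norm (f i))"
proof -
  have "(\<lambda>x. \<Sum>i\<in>I. f i x) \<in> L2 \<and> L2_norm (\<lambda>x. \<Sum>i\<in>I. f i x) \<le> (\<Sum>i\<in>I. L2_norm (f i))"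
    using assms
  proof (induction I rule: finite_induct)
    case (insert i I)
    then show ?case using L2_add[of "f i" "\<lambda>x. \<Sum>i\<in>I. f i x"] by fastforce
  qed simp
  then show "(\<lambda>x. \<Sum>i\<in>I. f i x) \<in> L2" "L2_norm (\<lambda>x. \<Sum>i\<in>I. f i x) \<le> (\<Sum>i\<in>I. L2_norm (f i))"
    by auto
qed

lemma L2_norm_eq_0_AE:
  assumes f: "f \<in> L2" and "L2_norm f = 0"
  shows "AE x in lebesgue. f x = 0"
proof -
  have "(\<integral>\<^sup>+ x. ennreal ((cmod (f x))\<^sup>2) \<partial>lebesgue) = 0" using L2_norm_nn[OF f] assms(2) by simp
  then have "AE x in lebesgue. ennreal ((cmod (f x))\<^sup>2) = 0"
    using L2_measurable[OF f] by (subst (asm) nn_integral_0_iff_AE) auto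
  then show ?thesis by eventually_elim (simp add: ennreal_eq_0_iff)
qed

lemma L2_mult_integrable:
  assumes f: "f \<in> L2" and g: "g \<in> L2"
  shows "integrable lebesgue (\<lambda>x. f x * g x)"
proof (rule Bochner_Integration.integrable_bound)
  show "integrable lebesgue (\<lambda>x. (cmod (f x))\<^sup>2 + (cmod (g x))\<^sup>2)"
    using L2_integrable[OF f] L2_integrable[OF g] by (rule Bochner_Integration.integrable_add)
  show "(\<lambda>x. f x * g x) \<in> borel_measurable lebesgue" using f g by measurable
  have "a * b \<le> a\<^sup>2 + b\<^sup>2" if "a \<ge> 0" "b \<ge> 0" for a b :: real
    using that sum_squares_bound[of a b] mult_nonneg_nonneg[OF that] by linarith
  then show "AE x in lebesgue. cmod (f x * g x) \<le> norm ((cmod (f x))\<^sup>2 + (cmod (g x))\<^sup>2)"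
    by (simp add: norm_mult)
qed

lemma L2_Cauchy_Schwarz:
  assumes f: "f \<in> L2" and g: "g \<in> L2"
  shows "cmod (LINT x|lebesgue. f x * g x) \<le> L2_norm f * L2_norm g"
proof -
  note int = L2_mult_integrable[OF f g]
  have fm: "f \<in> borel_measurable lebesgue" and gm: "g \<in> borel_measurable lebesgue"
    using f g L2_measurable by auto
  have le1: "cmod (LINT x|lebesgue. f x * g x) \<le> (LINT x|lebesgue. cmod (f x) * cmod (g x))"
    using integral_norm_bound[of lebesgue "\<lambda>x. f x * g x"] by (simp add: norm_mult)
  have "ennreal (LINT x|lebesgue. cmod (f x) * cmod (g x)) =
      (\<integral>\<^sup>+x. ennreal (cmod (f x)) * ennreal (cmod (g x)) \<partial>lebesgue)"
    using integrable_norm[OF int]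
    by (subst nn_integral_eq_integral[symmetric]) (auto simp: norm_mult ennreal_mult)
  moreover have "(\<integral>\<^sup>+x. ennreal (cmod (f x)) * ennreal (cmod (g x)) \<partial>lebesgue)\<^sup>2 \<le>
      (\<integral>\<^sup>+x. (ennreal (cmod (f x)))\<^sup>2 \<partial>lebesgue) * (\<integral>\<^sup>+x. (ennreal (cmod (g x)))\<^sup>2 \<partial>lebesgue)"
    by (rule Cauchy_Schwarz_nn_integral) (use fm gm in measurable)
  moreover have "\<dots> = ennreal ((L2_norm f * L2_norm g)\<^sup>2)"
    by (simp add: ennreal_power L2_norm_nn f g power_mult_distrib flip: ennreal_mult)
  ultimately have "ennreal ((LINT x|lebesgue. cmod (f x) * cmod (g x))\<^sup>2) \<le> ennreal ((L2_norm f * L2_norm g)\<^sup>2)"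
    by (simp flip: ennreal_power)
  then have "(LINT x|lebesgue. cmod (f x) * cmod (g x))\<^sup>2 \<le> (L2_norm f * L2_norm g)\<^sup>2"
    by simp
  then have "(LINT x|lebesgue. cmod (f x) * cmod (g x)) \<le> L2_norm f * L2_norm g"
    by (rule power2_le_imp_le) (intro mult_nonneg_nonneg L2_norm_nonneg)
  with le1 show ?thesis by (rule order_trans)
qed

lemma L2_norm_diff_square:
  assumes f: "f \<in> L2" and g: "g \<in> L2"
  shows "(L2_norm (\<lambda>x. f x - g x))\<^sup>2
    = (L2_norm f)\<^sup>2 + (L2_norm g)\<^sup>2 - 2 * Re (LINT x|lebesgue. f x * cnj (g x))"
proof -
  note int = L2_mult_integrable[OF f L2_cnj[OF g]]
  have pw: "(cmod (a - b))\<^sup>2 = (cmod a)\<^sup>2 + (cmod b)\<^sup>2 - 2 * Re (a * cnj b)" for a b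
    using dot_norm_neg[of a b] by (simp add: inner_complex_def)
  have "(L2_norm (\<lambda>x. f x - g x))\<^sup>2
      = (LINT x|lebesgue. (cmod (f x))\<^sup>2 + (cmod (g x))\<^sup>2 - 2 * Re (f x * cnj (g x)))"
    unfolding L2_norm_square pw ..
  also have "\<dots> = (L2_norm f)\<^sup>2 + (L2_norm g)\<^sup>2 - (LINT x|lebesgue. 2 * Re (f x * cnj (g x)))"
    unfolding L2_norm_square
    by (simp only: Bochner_Integration.integral_diff[OF Bochner_Integration.integrable_add[OF
        L2_integrable[OF f] L2_integrable[OF g]] integrable_mult_right[OF integrable_Re[OF int], of 2]]
      Bochner_Integration.integral_add[OF L2_integrable[OF f] L2_integrable[OF g]])
  also have "(LINT x|lebesgue. 2 * Re (f x * cnj (g x))) = 2 * Re (LINT x|lebesgue. f x * cnj (g x))"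
    unfolding integral_mult_right_zero integral_Re[OF int] ..
  finally show ?thesis .
qed

lemma L2_dominated_convergence:
  fixes f :: "nat \<Rightarrow> 'a::euclidean_space \<Rightarrow> complex"
  assumes g: "g \<in> L2" and fm: "\<And>k. f k \<in> borel_measurable lebesgue" and hm: "h \<in> borel_measurable lebesgue"
    and bd: "\<And>k. AE x in lebesgue. cmod (f k x) \<le> cmod (g x)"
    and lim: "AE x in lebesgue. (\<lambda>k. f k x) \<longlonglongrightarrow> h x"
  shows "h \<in> L2" "(\<lambda>k. L2_norm (\<lambda>x. f k x - h x)) \<longlonglongrightarrow> 0"
proof -
  note [measurable] = fm hm L2_measurable[OF g]
  have "AE x in lebesgue. \<forall>k. cmod (f k x) \<le> cmod (g x)" using bd by (simp add: AE_all_countable)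
  with lim have hb: "AE x in lebesgue. cmod (h x) \<le> cmod (g x)"
  proof eventually_elim
    case (elim x)
    have "(\<lambda>k. cmod (f k x)) \<longlonglongrightarrow> cmod (h x)" using elim by (intro tendsto_norm)
    then show ?case by (rule LIMSEQ_le_const2) (use elim in auto)
  qed
  then show "h \<in> L2" using L2_bounded_by(1)[OF g hm, of 1] by simp
  have "(\<lambda>k. LINT x|lebesgue. (cmod (f k x - h x))\<^sup>2) \<longlonglongrightarrow> (LINT x|lebesgue. (0::real) * (cmod (g x))\<^sup>2)"
  proof (rule integral_dominated_convergence)
    show "integrable lebesgue (\<lambda>x. 4 * (cmod (g x))\<^sup>2)" using L2_integrable[OF g] by simp
    show "AE x in lebesgue. (\<lambda>k. (cmod (f k x - h x))\<^sup>2) \<longlonglongrightarrow> 0 * (cmod (g x))\<^sup>2"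
      using lim
    proof eventually_elim
      case (elim x)
      have "(\<lambda>k. (cmod (f k x - h x))\<^sup>2) \<longlonglongrightarrow> (cmod (h x - h x))\<^sup>2"
        by (intro tendsto_intros elim)
      then show ?case by simp
    qed
    show "AE x in lebesgue. norm ((cmod (f k x - h x))\<^sup>2) \<le> 4 * (cmod (g x))\<^sup>2" for k
      using bd[of k] hb
    proof eventually_elim
      case (elim x)
      have "cmod (f k x - h x) \<le> 2 * cmod (g x)"
        using norm_triangle_ineq4[of "f k x" "h x"] elim by linarith
      then have "(cmod (f k x - h x))\<^sup>2 \<le> (2 * cmod (g x))\<^sup>2" by (rule power_mono) (rule norm_ge_zero)
      also have "(2 * cmod (g x))\<^sup>2 = 4 * (cmod (g x))\<^sup>2" by (simp add: power_mult_distrib)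
      finally show ?case by simp
    qed
  next
    show "(\<lambda>x. (0::real) * (cmod (g x))\<^sup>2) \<in> borel_measurable lebesgue" by measurable
    show "(\<lambda>x. (cmod (f k x - h x))\<^sup>2) \<in> borel_measurable lebesgue" for k by measurable
  qed
  then have "(\<lambda>k. LINT x|lebesgue. (cmod (f k x - h x))\<^sup>2) \<longlonglongrightarrow> 0" unfolding mult_zero_left integral_zero .
  from tendsto_real_sqrt[OF this] show "(\<lambda>k. L2_norm (\<lambda>x. f k x - h x)) \<longlonglongrightarrow> 0"
    unfolding L2_norm_def real_sqrt_zero .
qed

lemma ennreal_le_suminf: "a k \<le> (\<Sum>k. a k)" for a :: "nat \<Rightarrow> ennreal"
  using sum_le_suminf[of a "{k}"] by simp

text \<open>A weighted sum of the squared increments has a finite integral, so that the increments are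
  dominated almost everywhere by a geometric series; Fatou's lemma then identifies the pointwise limit as the limit in norm.\<close>

lemma L2_complete_rapid:
  fixes f :: "nat \<Rightarrow> 'a::euclidean_space \<Rightarrow> complex"
  assumes f: "\<And>k. f k \<in> L2" and rapid: "\<And>k. L2_norm (\<lambda>x. f (Suc k) x - f k x) \<le> (1/2)^k"
  shows "\<exists>g\<in>L2. (\<lambda>k. L2_norm (\<lambda>x. f k x - g x)) \<longlonglongrightarrow> 0"
proof -
  define d where "d k x = f (Suc k) x - f k x" for k x
  have dL: "d k \<in> L2" for k unfolding d_def by (intro L2_diff f)
  note [measurable] = L2_measurable[OF f] L2_measurable[OF dL]
  have "(\<integral>\<^sup>+x. (\<Sum>k. ennreal (2^k * (cmod (d k x))\<^sup>2)) \<partial>lebesgue) =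
      (\<Sum>k. \<integral>\<^sup>+x. ennreal (2^k * (cmod (d k x))\<^sup>2) \<partial>lebesgue)"
    by (rule nn_integral_suminf) measurable
  also have "\<dots> = (\<Sum>k. ennreal (2^k * (L2_norm (d k))\<^sup>2))"
    by (simp add: ennreal_mult nn_integral_cmult L2_norm_nn[OF dL])
  also have "\<dots> \<le> (\<Sum>k. ennreal ((1/2)^k))"
  proof (intro suminf_le ennreal_leI)
    fix k
    have "(L2_norm (d k))\<^sup>2 \<le> ((1/2)^k)\<^sup>2"
      using rapid[of k] by (intro power_mono) (auto simp: d_def[abs_def])
    then have "2^k * (L2_norm (d k))\<^sup>2 \<le> 2^k * ((1/2)^k)\<^sup>2" by simp
    also have "2^k * ((1/2)^k)\<^sup>2 = ((1/2)^k :: real)"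
      by (simp add: power2_eq_square power_one_over)
    finally show "2^k * (L2_norm (d k))\<^sup>2 \<le> (1/2)^k" .
  qed auto
  also have "\<dots> = ennreal (\<Sum>k. (1/2)^k)"
    by (rule suminf_ennreal2) (auto intro: summable_geometric)
  also have "\<dots> < \<infinity>" by simp
  finally have fin: "(\<integral>\<^sup>+x. (\<Sum>k. ennreal (2^k * (cmod (d k x))\<^sup>2)) \<partial>lebesgue) < \<infinity>" .
  have "AE x in lebesgue. (\<Sum>k. ennreal (2^k * (cmod (d k x))\<^sup>2)) \<noteq> \<infinity>"
    by (rule nn_integral_PInf_AE) (measurable, rule less_imp_neq[OF fin])
  then have conv: "AE x in lebesgue. convergent (\<lambda>k. f k x)"
  proof eventually_elim
    case (elim x)
    define S where "S = enn2real (\<Sum>k. ennreal (2^k * (cmod (d k x))\<^sup>2))"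
    have bd: "cmod (d k x) \<le> sqrt S * (sqrt (1/2))^k" for k
    proof -
      have "ennreal (2^k * (cmod (d k x))\<^sup>2) \<le> (\<Sum>k. ennreal (2^k * (cmod (d k x))\<^sup>2))"
        by (rule ennreal_le_suminf)
      also have "\<dots> = ennreal S"
        unfolding S_def by (rule ennreal_enn2real[symmetric]) (use elim in \<open>simp only: less_top[symmetric] infinity_ennreal_def not_False_eq_True\<close>)
      finally have "ennreal (2^k * (cmod (d k x))\<^sup>2) \<le> ennreal S" .
      moreover have "0 \<le> S" unfolding S_def by (rule enn2real_nonneg)
      ultimately have "2^k * (cmod (d k x))\<^sup>2 \<le> S" using ennreal_le_iff by blast
      then have "2^k * (cmod (d k x))\<^sup>2 * (1/2)^k \<le> S * (1/2)^k"
        by (rule mult_right_mono) (rule zero_le_power, rule divide_nonneg_nonneg, rule zero_le_one, rule zero_le_numeral)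
      moreover have "2^k * (cmod (d k x))\<^sup>2 * (1/2)^k = (cmod (d k x))\<^sup>2"
        by (simp add: power_one_over)
      ultimately have "(cmod (d k x))\<^sup>2 \<le> S * (1/2)^k" by (simp only:)
      then have "cmod (d k x) \<le> sqrt (S * (1/2)^k)" by (rule real_le_rsqrt)
      then show ?thesis by (simp add: real_sqrt_mult real_sqrt_power)
    qed
    have "summable (\<lambda>k. sqrt S * (sqrt (1/2))^k)"
      by (intro summable_mult summable_geometric) simp
    then have "summable (\<lambda>k. d k x)"
      by (rule summable_comparison_test') (rule bd)
    then have "convergent (\<lambda>n. \<Sum>k<n. d k x)" unfolding summable_iff_convergent .
    moreover have "(\<Sum>k<n. d k x) = f n x - f 0 x" for n
      unfolding d_def by (rule sum_lessThan_telescope)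
    ultimately have "convergent (\<lambda>n. f n x - f 0 x)" by simp
    then have "convergent (\<lambda>n. (f n x - f 0 x) + f 0 x)"
      by (intro convergent_add convergent_const)
    then show ?case by simp
  qed
  define g where "g x = lim (\<lambda>k. f k x)" for x
  have lim: "AE x in lebesgue. (\<lambda>k. f k x) \<longlonglongrightarrow> g x"
    using conv by eventually_elim (simp add: g_def convergent_LIMSEQ_iff)
  have gm [measurable]: "g \<in> borel_measurable lebesgue"
    unfolding g_def[abs_def] by (rule borel_measurable_lim_metric) measurable
  have tail: "L2_norm (\<lambda>x. f (m + i) x - f m x) \<le> 2 * (1/2)^m" for m i
  proof -
    have "L2_norm (\<lambda>x. f (m + i) x - f m x) \<le> (\<Sum>j<i. (1/2)^(m+j))"
    proof (induction i)
      case (Suc i)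
      show ?case
        using L2_norm_diff_triangle[OF f f f, of "m + Suc i" m "m + i"] Suc rapid[of "m + i"] by simp
    qed simp
    also have "\<dots> = (1/2)^m * (\<Sum>j<i. (1/2)^j)" by (simp add: power_add sum_distrib_left)
    also have "(\<Sum>j<i. (1/2)^j) \<le> (2::real)" by (simp add: sum_gp_strict)
    finally show ?thesis by simp
  qed
  have key: "(\<lambda>x. g x - f m x) \<in> L2 \<and> L2_norm (\<lambda>x. g x - f m x) \<le> 2 * (1/2)^m" for m
  proof -
    let ?A = "\<lambda>i x. ennreal ((cmod (f (m + i) x - f m x))\<^sup>2)"
    have "AE x in lebesgue. ennreal ((cmod (g x - f m x))\<^sup>2) = liminf (\<lambda>i. ?A i x)"
      using lim
    proof eventually_elim
      case (elim x)
      have "(\<lambda>i. f (i + m) x) \<longlonglongrightarrow> g x" by (rule LIMSEQ_ignore_initial_segment[OF elim])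
      then have "(\<lambda>i. f (m + i) x) \<longlonglongrightarrow> g x" by (simp only: add.commute)
      then have "(\<lambda>i. ?A i x) \<longlonglongrightarrow> ennreal ((cmod (g x - f m x))\<^sup>2)"
        by (intro tendsto_ennrealI tendsto_power tendsto_norm tendsto_diff tendsto_const)
      from lim_imp_Liminf[OF sequentially_bot this] show ?case by (rule sym)
    qed
    then have 1: "(\<integral>\<^sup>+x. ennreal ((cmod (g x - f m x))\<^sup>2) \<partial>lebesgue) = (\<integral>\<^sup>+x. liminf (\<lambda>i. ?A i x) \<partial>lebesgue)"
      by (rule nn_integral_cong_AE)
    have 2: "(\<integral>\<^sup>+x. liminf (\<lambda>i. ?A i x) \<partial>lebesgue) \<le> liminf (\<lambda>i. \<integral>\<^sup>+x. ?A i x \<partial>lebesgue)"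
      by (rule nn_integral_liminf) measurable
    have "(\<integral>\<^sup>+x. ?A i x \<partial>lebesgue) \<le> ennreal ((2 * (1/2)^m)\<^sup>2)" for i
      unfolding L2_norm_nn[OF L2_diff(1)[OF f f]]
      by (rule ennreal_leI, rule power_mono, rule tail, rule L2_norm_nonneg)
    then have 3: "liminf (\<lambda>i. \<integral>\<^sup>+x. ?A i x \<partial>lebesgue) \<le> liminf (\<lambda>i. ennreal ((2 * (1/2)^m)\<^sup>2))"
      by (intro Liminf_mono always_eventually allI)
    have le: "(\<integral>\<^sup>+x. ennreal ((cmod (g x - f m x))\<^sup>2) \<partial>lebesgue) \<le> ennreal ((2 * (1/2)^m)\<^sup>2)"
      using order_trans[OF 2 3] unfolding 1 Liminf_const[OF sequentially_bot] .
    have meas: "(\<lambda>x. g x - f m x) \<in> borel_measurable lebesgue"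
      by (rule borel_measurable_diff[OF gm L2_measurable[OF f]])
    have nonneg: "(0::real) \<le> 2 * (1/2)^m" by simp
    show ?thesis by (rule conjI[OF L2_I_le[OF meas nonneg le]])
  qed
  have "(\<lambda>x. g x - f 0 x + f 0 x) \<in> L2" by (rule L2_add(1)[OF conjunct1[OF key] f])
  then have "g \<in> L2" by simp
  moreover have "(\<lambda>k. L2_norm (\<lambda>x. f k x - g x)) \<longlonglongrightarrow> 0"
  proof (rule tendsto_sandwich)
    show "(\<lambda>k. 0 :: real) \<longlonglongrightarrow> 0" by simp
    show "(\<lambda>k. 2 * (1/2)^k :: real) \<longlonglongrightarrow> 0"
      using tendsto_mult_right_zero[OF LIMSEQ_realpow_zero[of "1/2 :: real"], of 2] by simp
    show "\<forall>\<^sub>F k in sequentially. L2_norm (\<lambda>x. f k x - g x) \<le> 2 * (1/2)^k"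
      by (subst L2_norm_minus_commute) (intro always_eventually allI conjunct2[OF key])
  qed auto
  ultimately show ?thesis by blast
qed

lemma L2_truncate_tendsto:
  fixes f :: "'a::euclidean_space \<Rightarrow> complex"
  assumes f: "f \<in> L2"
  shows "((\<lambda>R. L2_norm (\<lambda>x. indicator (cball 0 R) x * f x - f x)) \<longlongrightarrow> 0) at_top"
proof (rule tendsto_at_topI_sequentially)
  fix X :: "nat \<Rightarrow> real" assume X: "filterlim X at_top sequentially"
  have fm: "f \<in> borel_measurable lebesgue" using f by (rule L2_measurable)
  show "(\<lambda>n. L2_norm (\<lambda>x. indicator (cball 0 (X n)) x * f x - f x)) \<longlonglongrightarrow> 0"
  proof (rule L2_dominated_convergence(2)[OF f])
    show "(\<lambda>x. indicator (cball 0 (X k)) x * f x) \<in> borel_measurable lebesgue" for k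
      by (intro borel_measurable_times borel_measurable_indicator fm) simp
    show "AE x in lebesgue. (\<lambda>k. indicator (cball 0 (X k)) x * f x) \<longlonglongrightarrow> f x"
    proof (rule AE_I2)
      fix x :: 'a
      have "\<forall>\<^sub>F k in sequentially. norm x \<le> X k" using X by (simp add: filterlim_at_top)
      then have "\<forall>\<^sub>F k in sequentially. indicator (cball 0 (X k)) x * f x = f x"
        by eventually_elim simp
      then show "(\<lambda>k. indicator (cball 0 (X k)) x * f x) \<longlonglongrightarrow> f x" by (rule tendsto_eventually)
    qed
  qed (auto simp: fm indicator_def)
qed

lemma L2_indicator_mult:
  assumes "f \<in> L2" "S \<in> sets lebesgue"
  shows "(\<lambda>x. indicator S x * f x) \<in> L2" "L2_norm (\<lambda>x. indicator S x * f x) \<le> L2_norm f"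
  using L2_mult_bounded[OF assms(1), of "indicator S" 1] assms(2) by (auto simp: indicator_def)

lemma L2_indicator_cball:
  "(\<lambda>x::'a::euclidean_space. c * indicator (cball 0 R) x) \<in> L2"
  "(L2_norm (\<lambda>x::'a::euclidean_space. indicator (cball 0 R) x))\<^sup>2 = measure lebesgue (cball (0::'a) R)"
proof -
  have ind: "(cmod (indicator (cball 0 R) x))\<^sup>2 = indicator (cball 0 R) x" for x :: 'a
    by (simp add: indicator_def)
  have "integrable lebesgue (indicator (cball (0::'a) R) :: 'a \<Rightarrow> real)"
    by (rule integrable_real_indicator) (auto simp: emeasure_lborel_cball_finite[unfolded infinity_ennreal_def])
  moreover have "(indicator (cball (0::'a) R) :: 'a \<Rightarrow> complex) \<in> borel_measurable lebesgue"
    by (rule borel_measurable_indicator) simp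
  ultimately have *: "(\<lambda>x::'a. indicator (cball 0 R) x) \<in> L2"
    by (simp add: L2_def ind)
  then show "(\<lambda>x::'a. c * indicator (cball 0 R) x) \<in> L2" by (rule L2_cmult(1))
  show "(L2_norm (\<lambda>x::'a. indicator (cball 0 R) x))\<^sup>2 = measure lebesgue (cball (0::'a) R)"
    by (simp add: L2_norm_square ind)
qed

text \<open>A bounded function with bounded support is almost everywhere a limit of continuous functions;
  clamping their values and cutting them off keeps the limit and makes the convergence dominated.\<close>

lemma L2_dense_continuous:
  fixes f :: "'a::euclidean_space \<Rightarrow> complex"
  assumes f: "f \<in> L2" and e: "e > 0"
  obtains g R M where "continuous_on UNIV g" "\<And>x. R < norm x \<Longrightarrow> g x = 0" "\<And>x. cmod (g x) \<le> M"
    "g \<in> L2" "L2_norm (\<lambda>x. g x - f x) < e"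
proof -
  have fm [measurable]: "f \<in> borel_measurable lebesgue" using f by (rule L2_measurable)
  have [measurable]: "(\<lambda>x::'a. x) \<in> borel_measurable lebesgue" by (rule borel_measurable_lebesgueI) simp
  define F where "F n x = indicator {x. norm x \<le> real n \<and> cmod (f x) \<le> real n} x * f x" for n x
  have Fm: "F n \<in> borel_measurable lebesgue" for n
    unfolding F_def by measurable
  have FL: "F n \<in> L2" for n
    by (rule L2_bounded_by(1)[OF f Fm, of 1]) (auto simp: F_def indicator_def)
  have "(\<lambda>n. L2_norm (\<lambda>x. F n x - f x)) \<longlonglongrightarrow> 0"
  proof (rule L2_dominated_convergence(2)[OF f Fm fm])
    show "AE x in lebesgue. (\<lambda>k. F k x) \<longlonglongrightarrow> f x"
    proof (rule AE_I2)
      fix x :: 'a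
      obtain N :: nat where N: "max (norm x) (cmod (f x)) \<le> real N" using real_arch_simple by blast
      have "F k x = f x" if "k \<ge> N" for k
        using N that of_nat_mono[OF that, where ?'a = real] by (auto simp: F_def)
      then show "(\<lambda>k. F k x) \<longlonglongrightarrow> f x"
        by (intro tendsto_eventually) (auto simp: eventually_sequentially)
    qed
  qed (auto simp: F_def indicator_def)
  then have "\<forall>\<^sub>F n in sequentially. L2_norm (\<lambda>x. F n x - f x) < e / 2"
    by (rule order_tendstoD) (use e in simp)
  then have "\<forall>\<^sub>F n in sequentially. L2_norm (\<lambda>x. F n x - f x) < e / 2 \<and> n \<ge> 1"
    by (intro eventually_conj) (auto simp: eventually_ge_at_top)
  then obtain n where n: "L2_norm (\<lambda>x. F n x - f x) < e / 2" "n \<ge> 1"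
    by (auto simp: eventually_sequentially)
  have "F n measurable_on UNIV"
    using Fm[of n] by (simp add: lebesgue_measurable_imp_measurable_on)
  then obtain N G where N: "negligible N" and Gc: "\<And>k. continuous_on UNIV (G k)"
    and Glim: "\<And>x. x \<notin> N \<Longrightarrow> (\<lambda>k. G k x) \<longlonglongrightarrow> F n x"
    by (auto simp: measurable_on_def)
  define c where "c x = max 0 (min 1 (real n + 1 - norm x))" for x :: 'a
  let ?B = "\<lambda>x::'a. of_real (real n) * indicator (cball 0 (real n + 1)) x :: complex"
  have BL: "?B \<in> L2" by (rule L2_indicator_cball(1))
  define p where "p z = z * of_real (real n / max (real n) (cmod z))" for z :: complex
  define H where "H k x = of_real (c x) * p (G k x)" for k x
  have pc: "continuous_on UNIV p"
    unfolding p_def using n by (intro continuous_intros) auto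
  have Hc: "continuous_on UNIV (H k)" for k
    unfolding H_def c_def
    by (intro continuous_intros continuous_on_compose2[OF pc Gc]) auto
  have cb: "0 \<le> c x" "c x \<le> 1" for x by (auto simp: c_def)
  have pb: "cmod (p z) \<le> real n" for z
  proof -
    have "cmod z * (real n / max (real n) (cmod z)) \<le> real n"
      using n by (auto simp: field_simps max_def)
    moreover have "\<bar>real n / max (real n) (cmod z)\<bar> = real n / max (real n) (cmod z)"
      by (rule abs_of_nonneg) simp
    ultimately show ?thesis by (simp only: p_def norm_mult norm_of_real)
  qed
  have Hb: "cmod (H k x) \<le> real n" for k x
    using mult_mono[OF cb(2)[of x] pb[of "G k x"]] cb by (simp add: H_def norm_mult)
  have H0: "H k x = 0" if "real n + 1 < norm x" for k x
    using that by (simp add: H_def c_def)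
  have Hm: "H k \<in> borel_measurable lebesgue" for k
    by (rule measurable_completion) (simp add: borel_measurable_continuous_onI[OF Hc])
  have HL: "H k \<in> L2" for k
  proof (rule L2_bounded_by(1)[OF BL Hm, of 1])
    show "AE x in lebesgue. cmod (H k x) \<le> 1 * cmod (?B x)"
      using Hb H0 by (auto simp: indicator_def not_le)
  qed simp
  have "(\<lambda>k. L2_norm (\<lambda>x. H k x - F n x)) \<longlonglongrightarrow> 0"
  proof (rule L2_dominated_convergence(2)[OF BL Hm Fm])
    show "AE x in lebesgue. cmod (H k x) \<le> cmod (?B x)" for k
      using Hb H0 by (auto simp: indicator_def not_le)
    have "AE x in lebesgue. x \<notin> N" using N by (simp add: AE_not_in negligible_iff_null_sets)
    then show "AE x in lebesgue. (\<lambda>k. H k x) \<longlonglongrightarrow> F n x"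
    proof eventually_elim
      case (elim x)
      have "(\<lambda>k. p (G k x)) \<longlonglongrightarrow> p (F n x)"
        by (rule continuous_on_tendsto_compose[OF pc Glim[OF elim]]) auto
      then have "(\<lambda>k. H k x) \<longlonglongrightarrow> of_real (c x) * p (F n x)"
        unfolding H_def by (intro tendsto_intros)
      also have "of_real (c x) * p (F n x) = F n x"
        using n by (auto simp: F_def c_def p_def indicator_def)
      finally show ?case .
    qed
  qed
  then have "\<forall>\<^sub>F k in sequentially. L2_norm (\<lambda>x. H k x - F n x) < e / 2"
    by (rule order_tendstoD) (use e in simp)
  then obtain k where k: "L2_norm (\<lambda>x. H k x - F n x) < e / 2"
    by (auto simp: eventually_sequentially)
  have "L2_norm (\<lambda>x. H k x - f x) < e"
    using L2_norm_diff_triangle[OF HL FL f, of k n] k n by linarith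
  then show ?thesis using that[of "H k" "real n + 1" "real n"] Hc H0 Hb HL by blast
qed

section \<open>The Fourier integral of integrable functions\<close>

lemma lebesgue_borel_representative:
  fixes f :: "'a::euclidean_space \<Rightarrow> complex"
  assumes "f \<in> borel_measurable lebesgue"
  obtains f' where "f' \<in> borel_measurable borel" "AE x in lebesgue. f x = f' x"
proof -
  have "(\<lambda>x. Re (f x)) \<in> borel_measurable lebesgue" "(\<lambda>x. Im (f x)) \<in> borel_measurable lebesgue"
    using assms by measurable
  from this[THEN completion_ex_borel_measurable_real] obtain a b :: "'a \<Rightarrow> real"
    where a: "a \<in> borel_measurable lborel" "AE x in lborel. Re (f x) = a x"
      and b: "b \<in> borel_measurable lborel" "AE x in lborel. Im (f x) = b x"
    by blast
  show thesis
  proof (rule that)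
    have [measurable]: "a \<in> borel_measurable borel" "b \<in> borel_measurable borel" using a b by simp_all
    show "(\<lambda>x. of_real (a x) + \<i> * of_real (b x)) \<in> borel_measurable borel" by measurable
    show "AE x in lebesgue. f x = of_real (a x) + \<i> * of_real (b x)"
      using AE_completion[OF a(2)] AE_completion[OF b(2)]
      by eventually_elim (simp add: complex_eq_iff)
  qed
qed

definition fourier_kernel :: "'a::euclidean_space \<Rightarrow> 'a \<Rightarrow> complex" where
  "fourier_kernel \<xi> x = exp (- \<i> * of_real (\<xi> \<bullet> x))"

abbreviation fourier_const :: "'a::euclidean_space itself \<Rightarrow> real" where
  "fourier_const _ \<equiv> (2 * pi) powr (- real DIM('a) / 2)"

lemma fourier_integral_eq:
  "fourier_integral f \<xi> =
     of_real (fourier_const TYPE('a)) * (LINT x|lebesgue. fourier_kernel \<xi> x * f x)"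
  for \<xi> :: "'a::euclidean_space"
  by (simp add: fourier_integral_def fourier_kernel_def)

lemma norm_fourier_kernel [simp]: "cmod (fourier_kernel \<xi> x) = 1"
  by (simp add: fourier_kernel_def norm_exp_eq_Re)

lemma fourier_kernel_commute: "fourier_kernel \<xi> x = fourier_kernel x \<xi>"
  by (simp add: fourier_kernel_def inner_commute)

lemma fourier_kernel_measurable_pair [measurable]:
  "(\<lambda>p. fourier_kernel (fst p) (snd p)) \<in> borel_measurable (borel \<Otimes>\<^sub>M borel)"
  unfolding fourier_kernel_def by measurable

lemma fourier_kernel_measurable: "fourier_kernel \<xi> \<in> borel_measurable borel"
  unfolding fourier_kernel_def by measurable

lemma fourier_kernel_measurable_lebesgue: "fourier_kernel \<xi> \<in> borel_measurable lebesgue"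
  by (rule borel_measurable_lebesgueI[OF fourier_kernel_measurable])

lemma fourier_integrand_integrable:
  assumes "integrable lebesgue f"
  shows "integrable lebesgue (\<lambda>x. fourier_kernel \<xi> x * f x)"
  by (rule Bochner_Integration.integrable_bound[OF assms])
     (simp_all add: norm_mult borel_measurable_times fourier_kernel_measurable_lebesgue
       borel_measurable_integrable[OF assms])

lemma fourier_integral_cong_AE:
  assumes f: "f \<in> borel_measurable lebesgue" and eq: "AE x in lebesgue. f x = g x"
  shows "fourier_integral f = fourier_integral g"
proof
  fix \<xi>
  have g: "g \<in> borel_measurable lebesgue" by (rule borel_measurable_AE[OF f eq])
  have "(LINT x|lebesgue. fourier_kernel \<xi> x * f x) = (LINT x|lebesgue. fourier_kernel \<xi> x * g x)"
    by (rule integral_cong_AE)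
       (use f g eq in \<open>auto intro!: borel_measurable_times fourier_kernel_measurable_lebesgue\<close>)
  then show "fourier_integral f \<xi> = fourier_integral g \<xi>" by (simp add: fourier_integral_eq)
qed

lemma fourier_integral_bounded:
  fixes f :: "'a::euclidean_space \<Rightarrow> complex"
  assumes "integrable lebesgue f"
  shows "cmod (fourier_integral f \<xi>) \<le> fourier_const TYPE('a) * (LINT x|lebesgue. cmod (f x))"
proof -
  have "cmod (LINT x|lebesgue. fourier_kernel \<xi> x * f x) \<le> (LINT x|lebesgue. cmod (fourier_kernel \<xi> x * f x))"
    by (rule integral_norm_bound)
  also have "\<dots> = (LINT x|lebesgue. cmod (f x))"
    unfolding norm_mult norm_fourier_kernel by simp
  finally show ?thesis
    by (simp add: fourier_integral_eq norm_mult mult_left_mono)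
qed

lemma fourier_integral_measurable:
  assumes f: "f \<in> borel_measurable lebesgue"
  shows "fourier_integral f \<in> borel_measurable borel"
proof -
  obtain f' where f'[measurable]: "f' \<in> borel_measurable borel" and eq: "AE x in lebesgue. f x = f' x"
    using lebesgue_borel_representative[OF f] .
  have "fourier_integral f' = (\<lambda>\<xi>. of_real (fourier_const TYPE('a)) *
      (LINT x|lborel. fourier_kernel \<xi> x * f' x))"
    unfolding fourier_integral_eq
    by (intro ext arg_cong2[where f = "(*)"] refl integral_completion)
       (simp add: borel_measurable_times fourier_kernel_measurable)
  also have "\<dots> \<in> borel_measurable borel"
    by measurable
  finally show ?thesis unfolding fourier_integral_cong_AE[OF f eq] .
qed

lemma fourier_integral_measurable_lebesgue:
  "f \<in> borel_measurable lebesgue \<Longrightarrow> fourier_integral f \<in> borel_measurable lebesgue"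
  by (rule borel_measurable_lebesgueI[OF fourier_integral_measurable])

lemma fourier_integral_diff:
  assumes "integrable lebesgue f" "integrable lebesgue g"
  shows "fourier_integral (\<lambda>x. f x - g x) \<xi> = fourier_integral f \<xi> - fourier_integral g \<xi>"
  using Bochner_Integration.integral_diff[OF fourier_integrand_integrable[OF assms(1)]
      fourier_integrand_integrable[OF assms(2)], of \<xi> \<xi>]
  by (simp add: fourier_integral_eq right_diff_distrib)

lemma fourier_integral_cmult:
  "fourier_integral (\<lambda>x. c * f x) \<xi> = c * fourier_integral f \<xi>"
proof -
  have "(LINT x|lebesgue. fourier_kernel \<xi> x * (c * f x)) = (LINT x|lebesgue. c * (fourier_kernel \<xi> x * f x))"
    by (simp only: mult.left_commute)
  also have "\<dots> = c * (LINT x|lebesgue. fourier_kernel \<xi> x * f x)"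
    by (rule integral_mult_right_zero)
  finally show ?thesis by (simp add: fourier_integral_eq)
qed

lemma fourier_integral_modulate:
  "fourier_integral (\<lambda>x. exp (\<i> * of_real (b \<bullet> x)) * f x) \<xi> = fourier_integral f (\<xi> - b)"
proof -
  have "fourier_kernel \<xi> x * (exp (\<i> * of_real (b \<bullet> x)) * f x) = fourier_kernel (\<xi> - b) x * f x" for x
    unfolding fourier_kernel_def mult.assoc[symmetric] exp_add[symmetric]
    by (simp add: inner_diff_left algebra_simps)
  then show ?thesis by (simp only: fourier_integral_eq)
qed

lemma integrable_mult_bounded:
  fixes f g :: "'a::euclidean_space \<Rightarrow> complex"
  assumes "integrable lebesgue f" "g \<in> borel_measurable lebesgue" "\<And>x. cmod (g x) \<le> M"
  shows "integrable lebesgue (\<lambda>x. g x * f x)"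
proof (rule Bochner_Integration.integrable_bound)
  show "integrable lebesgue (\<lambda>x. of_real M * f x)" using assms(1) by simp
  show "(\<lambda>x. g x * f x) \<in> borel_measurable lebesgue"
    using assms(2) borel_measurable_integrable[OF assms(1)] by (rule borel_measurable_times)
  have "cmod (g x * f x) \<le> cmod (of_real M * f x)" for x
  proof -
    have "cmod (g x) \<le> \<bar>M\<bar>" using assms(3)[of x] by linarith
    then show ?thesis by (simp add: norm_mult mult_right_mono)
  qed
  then show "AE x in lebesgue. cmod (g x * f x) \<le> cmod (of_real M * f x)" by simp
qed

text \<open>Both sides are, up to the normalising constant, the double integral of \<open>e\<^bsup>-\<i>\<xi>\<bullet>x\<^esup>f(x)g(\<xi>)\<close>. Borel
  representatives make the integrand measurable for the product of the Borel \<open>\<sigma>\<close>-algebras, as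
  Fubini's theorem requires.\<close>

lemma fourier_integral_multiplication_formula:
  fixes f g :: "'a::euclidean_space \<Rightarrow> complex"
  assumes f: "integrable lebesgue f" and g: "integrable lebesgue g"
  shows "(LINT \<xi>|lebesgue. fourier_integral f \<xi> * g \<xi>) = (LINT x|lebesgue. f x * fourier_integral g x)"
proof -
  note fm = borel_measurable_integrable[OF f] and gm = borel_measurable_integrable[OF g]
  obtain f' where f'[measurable]: "f' \<in> borel_measurable borel" and feq: "AE x in lebesgue. f x = f' x"
    using lebesgue_borel_representative[OF fm] .
  obtain g' where g'[measurable]: "g' \<in> borel_measurable borel" and geq: "AE x in lebesgue. g x = g' x"
    using lebesgue_borel_representative[OF gm] .
  have f'i: "integrable lborel f'"
    using integrable_cong_AE_imp[OF f borel_measurable_lebesgueI[OF f']] feq integrable_completion[of f' lborel]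
    by (simp add: eq_commute)
  have g'i: "integrable lborel g'"
    using integrable_cong_AE_imp[OF g borel_measurable_lebesgueI[OF g']] geq integrable_completion[of g' lborel]
    by (simp add: eq_commute)
  note f'leb = borel_measurable_lebesgueI[OF f']
  let ?h = "\<lambda>\<xi> x. fourier_kernel \<xi> x * f' x * g' \<xi>"
  have int: "integrable (lborel \<Otimes>\<^sub>M lborel) (case_prod ?h)"
  proof (rule lborel_pair.Fubini_integrable)
    show "case_prod ?h \<in> borel_measurable (lborel \<Otimes>\<^sub>M lborel)" by measurable
    have "(\<lambda>\<xi>. LINT x|lborel. norm (case (\<xi>, x) of (\<xi>, x) \<Rightarrow> ?h \<xi> x))
        = (\<lambda>\<xi>. (LINT x|lborel. cmod (f' x)) * cmod (g' \<xi>))"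
      unfolding prod.case norm_mult norm_fourier_kernel by simp
    then show "integrable lborel (\<lambda>\<xi>. LINT x|lborel. norm (case (\<xi>, x) of (\<xi>, x) \<Rightarrow> ?h \<xi> x))"
      using g'i by simp
    show "AE \<xi> in lborel. integrable lborel (\<lambda>x. case (\<xi>, x) of (\<xi>, x) \<Rightarrow> ?h \<xi> x)"
    proof (rule AE_I2)
      fix \<xi> :: 'a
      have "integrable lebesgue (\<lambda>x. fourier_kernel \<xi> x * f' x * g' \<xi>)"
        using fourier_integrand_integrable[of f' \<xi>] f'i integrable_completion[of f' lborel] by simp
      then show "integrable lborel (\<lambda>x. case (\<xi>, x) of (\<xi>, x) \<Rightarrow> ?h \<xi> x)"
        by (subst (asm) integrable_completion) (simp_all add: fourier_kernel_measurable borel_measurable_times)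
    qed
  qed
  have F: "fourier_integral f' \<xi> = of_real (fourier_const TYPE('a)) * (LINT x|lborel. fourier_kernel \<xi> x * f' x)"
    and G: "fourier_integral g' \<xi> = of_real (fourier_const TYPE('a)) * (LINT x|lborel. fourier_kernel \<xi> x * g' x)" for \<xi>
    unfolding fourier_integral_eq
    by (subst integral_completion; simp add: fourier_kernel_measurable borel_measurable_times)+
  have "(LINT \<xi>|lebesgue. fourier_integral f \<xi> * g \<xi>) = (LINT \<xi>|lebesgue. fourier_integral f' \<xi> * g' \<xi>)"
    unfolding fourier_integral_cong_AE[OF fm feq]
    by (rule integral_cong_AE)
       (use gm geq borel_measurable_lebesgueI[OF g'] f'leb in
         \<open>auto intro!: borel_measurable_times fourier_integral_measurable_lebesgue\<close>)
  also have "\<dots> = (LINT \<xi>|lborel. fourier_integral f' \<xi> * g' \<xi>)"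
    by (rule integral_completion)
       (simp add: borel_measurable_times fourier_integral_measurable borel_measurable_lebesgueI)
  also have "\<dots> = of_real (fourier_const TYPE('a)) * (LINT \<xi>|lborel. (LINT x|lborel. ?h \<xi> x))"
  proof -
    have "fourier_integral f' \<xi> * g' \<xi>
        = of_real (fourier_const TYPE('a)) * (LINT x|lborel. ?h \<xi> x)" for \<xi>
      unfolding F integral_mult_left_zero by (simp only: mult.assoc)
    then show ?thesis by (simp only: integral_mult_right_zero)
  qed
  also have "(LINT \<xi>|lborel. (LINT x|lborel. ?h \<xi> x)) = (LINT x|lborel. (LINT \<xi>|lborel. ?h \<xi> x))"
    by (rule lborel_pair.Fubini_integral[OF int, symmetric])
  also have "of_real (fourier_const TYPE('a)) * \<dots> = (LINT x|lborel. f' x * fourier_integral g' x)"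
  proof -
    have "(LINT \<xi>|lborel. ?h \<xi> x) = f' x * (LINT \<xi>|lborel. fourier_kernel x \<xi> * g' \<xi>)" for x
    proof -
      have "(LINT \<xi>|lborel. ?h \<xi> x) = (LINT \<xi>|lborel. f' x * (fourier_kernel x \<xi> * g' \<xi>))"
        by (simp only: fourier_kernel_commute[of x] mult_ac)
      also have "\<dots> = f' x * (LINT \<xi>|lborel. fourier_kernel x \<xi> * g' \<xi>)" by (rule integral_mult_right_zero)
      finally show ?thesis .
    qed
    moreover have "of_real (fourier_const TYPE('a)) * (LINT x|lborel. f' x * (LINT \<xi>|lborel. fourier_kernel x \<xi> * g' \<xi>))
      = (LINT x|lborel. f' x * fourier_integral g' x)"
      unfolding G by (simp only: integral_mult_right_zero[symmetric] mult.left_commute)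
    ultimately show ?thesis by (simp only:)
  qed
  also have "\<dots> = (LINT x|lebesgue. f' x * fourier_integral g' x)"
    by (rule integral_completion[symmetric])
       (simp add: borel_measurable_times fourier_integral_measurable borel_measurable_lebesgueI)
  also have "\<dots> = (LINT x|lebesgue. f x * fourier_integral g x)"
    unfolding fourier_integral_cong_AE[OF gm geq]
    by (rule integral_cong_AE)
       (use fm feq borel_measurable_lebesgueI[OF g'] f'leb in
         \<open>auto intro!: borel_measurable_times fourier_integral_measurable_lebesgue\<close>)
  finally show ?thesis .
qed

section \<open>Gaussians\<close>

lemma lborel_integral_prod:
  fixes f :: "'a::euclidean_space \<Rightarrow> real \<Rightarrow> complex"
  assumes f: "\<And>b. b \<in> Basis \<Longrightarrow> integrable lborel (f b)"
  shows "integrable lborel (\<lambda>x::'a. \<Prod>b\<in>Basis. f b (x \<bullet> b))"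
    and "(LINT x|lborel. (\<Prod>b\<in>Basis. f b ((x::'a) \<bullet> b))) = (\<Prod>b\<in>Basis. LINT t|lborel. f b t)"
proof -
  have [measurable]: "f b \<in> borel_measurable borel" if "b \<in> Basis" for b
    using borel_measurable_integrable[OF f[OF that]] by simp
  interpret product_sigma_finite "\<lambda>_::'a. lborel :: real measure" ..
  define P where "P = (\<Pi>\<^sub>M b\<in>(Basis::'a set). (lborel :: real measure))"
  define T where "T g = (\<Sum>b\<in>(Basis::'a set). g b *\<^sub>R b)" for g
  define F where "F x = (\<Prod>b\<in>Basis. f b (x \<bullet> b))" for x :: 'a
  have Tm: "T \<in> P \<rightarrow>\<^sub>M borel" unfolding P_def T_def by measurable
  have Fm: "F \<in> borel_measurable borel" unfolding F_def by measurable
  have FT: "F (T g) = (\<Prod>b\<in>Basis. f b (g b))" for g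
    unfolding F_def T_def by (rule prod.cong) (simp_all add: inner_sum_left_Basis)
  have lb: "lborel = distr P borel T"
    unfolding P_def T_def by (rule lborel_eq)
  have "integrable P (\<lambda>g. \<Prod>b\<in>Basis. f b (g b))"
    unfolding P_def by (rule product_integrable_prod) (auto intro: f)
  then have "integrable P (\<lambda>g. F (T g))" by (simp only: FT)
  then have "integrable (distr P borel T) F" by (simp only: integrable_distr_eq[OF Tm Fm])
  then show "integrable lborel (\<lambda>x::'a. \<Prod>b\<in>Basis. f b (x \<bullet> b))"
    by (simp only: lb[symmetric] F_def[abs_def])
  have "integral\<^sup>L lborel F = integral\<^sup>L P (\<lambda>g. F (T g))"
    by (subst lb) (rule integral_distr[OF Tm Fm])
  also have "\<dots> = integral\<^sup>L P (\<lambda>g. \<Prod>b\<in>Basis. f b (g b))" by (simp only: FT)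
  also have "\<dots> = (\<Prod>b\<in>Basis. LINT t|lborel. f b t)"
    unfolding P_def by (rule product_integral_prod) (auto intro: f)
  finally show "(LINT x|lborel. (\<Prod>b\<in>Basis. f b ((x::'a) \<bullet> b))) = (\<Prod>b\<in>Basis. LINT t|lborel. f b t)"
    by (simp only: F_def[abs_def])
qed

definition std_gaussian :: "'a::euclidean_space \<Rightarrow> real" where
  "std_gaussian x = (2 * pi) powr (- real DIM('a) / 2) * exp (- (norm x)\<^sup>2 / 2)"

lemma std_gaussian_nonneg [simp]: "0 \<le> std_gaussian x"
  by (simp add: std_gaussian_def)

lemma std_gaussian_measurable [measurable]: "std_gaussian \<in> borel_measurable borel"
  unfolding std_gaussian_def by measurable

lemma std_gaussian_prod: "std_gaussian x = (\<Prod>b\<in>Basis. std_normal_density (x \<bullet> b))"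
  for x :: "'a::euclidean_space"
proof -
  have "(norm x)\<^sup>2 = (\<Sum>b\<in>Basis. (x \<bullet> b)\<^sup>2)"
    unfolding power2_norm_eq_inner by (subst euclidean_inner) (simp only: power2_eq_square)
  then have "exp (- (norm x)\<^sup>2 / 2) = (\<Prod>b\<in>Basis. exp (- (x \<bullet> b)\<^sup>2 / 2))"
    by (simp add: exp_sum sum_negf sum_divide_distrib flip: exp_sum)
  moreover have "(2 * pi) powr (- real DIM('a) / 2) = (\<Prod>b\<in>(Basis::'a set). 1 / sqrt (2 * pi))"
  proof -
    have "1 / sqrt (2 * pi) = (2 * pi) powr (-(1/2))"
      by (simp add: powr_minus_divide powr_half_sqrt)
    then have "(\<Prod>b\<in>(Basis::'a set). 1 / sqrt (2 * pi)) = ((2 * pi) powr (-(1/2))) ^ DIM('a)"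
      by (simp only: prod_constant)
    also have "\<dots> = ((2 * pi) powr (-(1/2))) powr real DIM('a)"
      by (rule powr_realpow[symmetric]) simp
    also have "\<dots> = (2 * pi) powr (- real DIM('a) / 2)"
      unfolding powr_powr by simp
    finally show ?thesis by (rule sym)
  qed
  ultimately show ?thesis
    by (simp only: std_gaussian_def std_normal_density_def prod.distrib)
qed

lemma std_gaussian_fourier:
  fixes \<xi> :: "'a::euclidean_space"
  shows "integrable lborel (\<lambda>x. fourier_kernel \<xi> x * of_real (std_gaussian x))" (is ?I)
    and "(LINT x|lborel. fourier_kernel \<xi> x * of_real (std_gaussian x))
           = of_real (exp (- (norm \<xi>)\<^sup>2 / 2))" (is ?E)
proof -
  let ?f = "\<lambda>b t. of_real (std_normal_density t) * exp (\<i> * of_real (- (\<xi> \<bullet> b) * t))"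
  have eq: "fourier_kernel \<xi> x * of_real (std_gaussian x) = (\<Prod>b\<in>Basis. ?f b (x \<bullet> b))" for x
  proof -
    have "- \<i> * of_real (\<xi> \<bullet> x) = (\<Sum>b\<in>Basis. \<i> * of_real (- (\<xi> \<bullet> b) * (x \<bullet> b)))"
      by (simp add: euclidean_inner[of \<xi> x] sum_distrib_left sum_negf)
    then have "fourier_kernel \<xi> x = (\<Prod>b\<in>Basis. exp (\<i> * of_real (- (\<xi> \<bullet> b) * (x \<bullet> b))))"
      unfolding fourier_kernel_def by (simp only: exp_sum[OF finite_Basis])
    then show ?thesis
      unfolding std_gaussian_prod of_real_prod by (simp only: prod.distrib mult.commute)
  qed
  have int: "integrable lborel (?f b)" for b
  proof (rule Bochner_Integration.integrable_bound)
    show "integrable lborel std_normal_density" by (rule integrable_normal_density) simp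
    show "?f b \<in> borel_measurable lborel" by measurable
    show "AE t in lborel. cmod (?f b t) \<le> norm (std_normal_density t)"
      by (simp add: norm_mult)
  qed
  have val: "(LINT t|lborel. ?f b t) = of_real (exp (- (\<xi> \<bullet> b)\<^sup>2 / 2))" for b
  proof -
    have "of_real (exp (- (- (\<xi> \<bullet> b))\<^sup>2 / 2)) = char std_normal_distribution (- (\<xi> \<bullet> b))"
      by (simp add: char_std_normal_distribution)
    also have "\<dots> = (LINT t|lborel. std_normal_density t *\<^sub>R exp (\<i> * of_real (- (\<xi> \<bullet> b) * t)))"
      unfolding char_def
    proof (rule integral_density)
      show "(\<lambda>x. exp (\<i> * of_real (- (\<xi> \<bullet> b) * x))) \<in> borel_measurable lborel" by measurable
    qed simp_all
    finally show ?thesis by (simp add: scaleR_conv_of_real)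
  qed
  show ?I unfolding eq by (rule lborel_integral_prod(1)[OF int])
  have "(norm \<xi>)\<^sup>2 = (\<Sum>b\<in>Basis. (\<xi> \<bullet> b)\<^sup>2)"
    unfolding power2_norm_eq_inner by (subst euclidean_inner) (simp only: power2_eq_square)
  then have "exp (- (norm \<xi>)\<^sup>2 / 2) = (\<Prod>b\<in>Basis. exp (- (\<xi> \<bullet> b)\<^sup>2 / 2))"
    by (simp add: exp_sum sum_negf sum_divide_distrib flip: exp_sum)
  then show ?E unfolding eq lborel_integral_prod(2)[OF int] val of_real_prod[symmetric] by (simp only:)
qed

lemma std_gaussian_integral:
  "integrable lborel (std_gaussian :: 'a::euclidean_space \<Rightarrow> real)"
  "(LINT x|lborel. std_gaussian (x::'a)) = 1"
proof -
  have "integrable lborel (\<lambda>x::'a. complex_of_real (std_gaussian x))"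
    using std_gaussian_fourier(1)[of "0::'a"] by (simp add: fourier_kernel_def)
  from integrable_Re[OF this] show int: "integrable lborel (std_gaussian :: 'a \<Rightarrow> real)" by simp
  have "complex_of_real (LINT x|lborel. std_gaussian (x::'a)) = 1"
    using std_gaussian_fourier(2)[of "0::'a"] by (simp add: fourier_kernel_def)
  then show "(LINT x|lborel. std_gaussian (x::'a)) = 1" by simp
qed

lemma std_gaussian_nn_integral:
  "(\<integral>\<^sup>+ x. ennreal (std_gaussian (x::'a::euclidean_space)) \<partial>lborel) = 1"
  using nn_integral_eq_integral[OF std_gaussian_integral(1)] by (simp add: std_gaussian_integral(2))

lemma lborel_integral_affine:
  fixes f :: "'a::euclidean_space \<Rightarrow> complex"
  assumes f: "f \<in> borel_measurable borel" and c: "c > 0"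
  shows "(LINT x|lborel. f x) = of_real (c ^ DIM('a)) * (LINT x|lborel. f (t + c *\<^sub>R x))"
    and "integrable lborel f \<longleftrightarrow> integrable lborel (\<lambda>x. f (t + c *\<^sub>R x))"
proof -
  have T: "(\<lambda>x. t + c *\<^sub>R x) \<in> lborel \<rightarrow>\<^sub>M borel" by measurable
  let ?D = "distr lborel borel (\<lambda>x. t + c *\<^sub>R x)"
  have fD: "f \<in> borel_measurable ?D" using f by simp
  have aff: "lborel = density ?D (\<lambda>_. ennreal (c ^ DIM('a)))"
    using lborel_affine[of c t] c by simp
  have "integral\<^sup>L lborel f = integral\<^sup>L (density ?D (\<lambda>_. ennreal (c ^ DIM('a)))) f"
    by (subst aff) (rule refl)
  also have "\<dots> = integral\<^sup>L ?D (\<lambda>x. c ^ DIM('a) *\<^sub>R f x)"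
    by (rule integral_density[OF fD]) (use c in simp_all)
  also have "\<dots> = (LINT x|lborel. c ^ DIM('a) *\<^sub>R f (t + c *\<^sub>R x))"
    by (rule integral_distr[OF T]) (use f in measurable)
  also have "\<dots> = of_real (c ^ DIM('a)) * (LINT x|lborel. f (t + c *\<^sub>R x))"
    by (simp only: scaleR_conv_of_real integral_mult_right_zero)
  finally show "(LINT x|lborel. f x) = of_real (c ^ DIM('a)) * (LINT x|lborel. f (t + c *\<^sub>R x))" .
  have "integrable lborel f \<longleftrightarrow> integrable (density ?D (\<lambda>_. ennreal (c ^ DIM('a)))) f"
    by (subst aff) (rule refl)
  also have "\<dots> \<longleftrightarrow> integrable ?D (\<lambda>x. c ^ DIM('a) *\<^sub>R f x)"
    by (rule integrable_density[OF fD]) (use c in simp_all)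
  also have "\<dots> \<longleftrightarrow> integrable lborel (\<lambda>x. c ^ DIM('a) *\<^sub>R f (t + c *\<^sub>R x))"
    by (rule integrable_distr_eq[OF T]) (use f in measurable)
  also have "\<dots> \<longleftrightarrow> integrable lborel (\<lambda>x. f (t + c *\<^sub>R x))"
  proof
    assume "integrable lborel (\<lambda>x. c ^ DIM('a) *\<^sub>R f (t + c *\<^sub>R x))"
    then have "integrable lborel (\<lambda>x. inverse (c ^ DIM('a)) *\<^sub>R c ^ DIM('a) *\<^sub>R f (t + c *\<^sub>R x))"
      by (rule integrable_scaleR_right)
    then show "integrable lborel (\<lambda>x. f (t + c *\<^sub>R x))" using c by simp
  qed (rule integrable_scaleR_right)
  finally show "integrable lborel f \<longleftrightarrow> integrable lborel (\<lambda>x. f (t + c *\<^sub>R x))" .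
qed

lemma lborel_nn_integral_translate:
  fixes f :: "'a::euclidean_space \<Rightarrow> ennreal"
  assumes f: "f \<in> borel_measurable borel"
  shows "(\<integral>\<^sup>+ x. f (x + t) \<partial>lborel) = (\<integral>\<^sup>+ x. f x \<partial>lborel)"
proof -
  have "(\<integral>\<^sup>+ x. f x \<partial>distr lborel borel ((+) t)) = (\<integral>\<^sup>+ x. f (t + x) \<partial>lborel)"
    by (rule nn_integral_distr) (use f in simp_all)
  then show ?thesis by (simp only: lborel_distr_plus add.commute)
qed

abbreviation gaussian_cutoff :: "real \<Rightarrow> 'a::euclidean_space \<Rightarrow> real" where
  "gaussian_cutoff \<epsilon> \<xi> \<equiv> exp (- (norm (\<epsilon> *\<^sub>R \<xi>))\<^sup>2 / 2)"

lemma gaussian_cutoff_eq: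
  "gaussian_cutoff \<epsilon> \<xi> = (2 * pi) powr (real DIM('a) / 2) * std_gaussian (\<epsilon> *\<^sub>R \<xi>)"
  for \<xi> :: "'a::euclidean_space"
  unfolding std_gaussian_def mult.assoc[symmetric] powr_add[symmetric] by simp

lemma gaussian_cutoff_integrable:
  assumes "\<epsilon> > 0"
  shows "integrable lebesgue (\<lambda>\<xi>::'a::euclidean_space. complex_of_real (gaussian_cutoff \<epsilon> \<xi>))"
proof -
  have 1: "integrable lborel (\<lambda>\<xi>::'a. complex_of_real (std_gaussian \<xi>))"
    by (rule integrable_of_real[OF std_gaussian_integral(1)])
  have "integrable lborel (\<lambda>\<xi>::'a. complex_of_real (std_gaussian (0 + \<epsilon> *\<^sub>R \<xi>)))"
    by (subst lborel_integral_affine(2)[OF _ assms, symmetric]) (measurable, rule 1)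
  then have "integrable lborel (\<lambda>\<xi>::'a. of_real ((2 * pi) powr (real DIM('a) / 2)) * complex_of_real (std_gaussian (\<epsilon> *\<^sub>R \<xi>)))"
    by (intro integrable_mult_right) simp
  then have "integrable lborel (\<lambda>\<xi>::'a. complex_of_real (gaussian_cutoff \<epsilon> \<xi>))"
    unfolding gaussian_cutoff_eq of_real_mult .
  then show ?thesis by (subst integrable_completion) simp_all
qed

lemma fourier_integral_gaussian_cutoff:
  fixes x y :: "'a::euclidean_space"
  assumes e: "\<epsilon> > 0"
  shows "fourier_integral (\<lambda>\<xi>. cnj (fourier_kernel x \<xi>) * of_real (gaussian_cutoff \<epsilon> \<xi>)) y
    = of_real (inverse \<epsilon> ^ DIM('a) * gaussian_cutoff (inverse \<epsilon>) (y - x))"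
proof -
  let ?c = "(2 * pi) powr (- real DIM('a) / 2)" and ?c' = "(2 * pi) powr (real DIM('a) / 2)"
  let ?h = "\<lambda>\<xi>. fourier_kernel (y - x) \<xi> * complex_of_real (gaussian_cutoff \<epsilon> \<xi>)"
  have k: "fourier_kernel y \<xi> * (cnj (fourier_kernel x \<xi>) * z) = fourier_kernel (y - x) \<xi> * z" for \<xi> z
    unfolding fourier_kernel_def exp_cnj mult.assoc[symmetric] exp_add[symmetric]
    by (simp add: inner_diff_left algebra_simps)
  have hm: "?h \<in> borel_measurable borel"
    by (intro borel_measurable_times fourier_kernel_measurable) measurable
  have h: "?h (0 + inverse \<epsilon> *\<^sub>R \<eta>) = of_real ?c' * (fourier_kernel (inverse \<epsilon> *\<^sub>R (y - x)) \<eta> * of_real (std_gaussian \<eta>))" for \<eta>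
    unfolding gaussian_cutoff_eq using e by (simp add: fourier_kernel_def)
  have "fourier_integral (\<lambda>\<xi>. cnj (fourier_kernel x \<xi>) * of_real (gaussian_cutoff \<epsilon> \<xi>)) y
      = of_real ?c * (LINT \<xi>|lborel. ?h \<xi>)"
    unfolding fourier_integral_eq k by (subst integral_completion) (simp_all only: measurable_lborel2 hm)
  also have "(LINT \<xi>|lborel. ?h \<xi>) = of_real (inverse \<epsilon> ^ DIM('a)) * (LINT \<eta>|lborel. ?h (0 + inverse \<epsilon> *\<^sub>R \<eta>))"
    by (rule lborel_integral_affine(1)[OF hm]) (use e in simp)
  also have "(LINT \<eta>|lborel. ?h (0 + inverse \<epsilon> *\<^sub>R \<eta>))
      = of_real ?c' * of_real (gaussian_cutoff (inverse \<epsilon>) (y - x))"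
    unfolding h integral_mult_right_zero std_gaussian_fourier(2) ..
  also have "complex_of_real ?c * (of_real (inverse \<epsilon> ^ DIM('a)) * (of_real ?c' * of_real (gaussian_cutoff (inverse \<epsilon>) (y - x))))
    = of_real ((?c * ?c') * (inverse \<epsilon> ^ DIM('a) * gaussian_cutoff (inverse \<epsilon>) (y - x)))"
    by (simp only: of_real_mult mult_ac)
  also have "?c * ?c' = 1" by (simp flip: powr_add)
  finally show ?thesis by simp
qed

section \<open>Plancherel's identity for integrable functions\<close>

text \<open>Applying the multiplication formula twice moves both transforms onto the Gaussian cutoff, whose
  transform is a Gaussian of width \<open>\<epsilon>\<close>. The energy of the transform seen through the cutoff is therefore the
  correlation of \<open>f\<close> with its Gaussian averages.\<close>

lemma plancherel_regularised:
  fixes f :: "'a::euclidean_space \<Rightarrow> complex"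
  assumes fm: "f \<in> borel_measurable borel" and fi: "integrable lebesgue f" and e: "\<epsilon> > 0"
  shows "integrable lebesgue (\<lambda>\<xi>. fourier_integral f \<xi> *
           (cnj (fourier_integral f \<xi>) * of_real (gaussian_cutoff \<epsilon> \<xi>)))" (is ?I)
    and "(LINT \<xi>|lebesgue. fourier_integral f \<xi> *
           (cnj (fourier_integral f \<xi>) * of_real (gaussian_cutoff \<epsilon> \<xi>)))
       = (LINT x|lebesgue. f x * cnj (LINT z|lborel. of_real (std_gaussian z) * f (x + \<epsilon> *\<^sub>R z)))" (is ?E)
proof -
  let ?c = "(2 * pi) powr (- real DIM('a) / 2)"
  define B where "B = ?c * (LINT x|lebesgue. cmod (f x))"
  have fb: "cmod (fourier_integral f \<xi>) \<le> B" for \<xi>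
    unfolding B_def by (rule fourier_integral_bounded[OF fi])
  have Fm: "fourier_integral f \<in> borel_measurable lebesgue"
    by (rule fourier_integral_measurable_lebesgue[OF borel_measurable_lebesgueI[OF fm]])
  have cFm: "(\<lambda>\<xi>. cnj (fourier_integral f \<xi>)) \<in> borel_measurable lebesgue"
    by (rule borel_measurable_continuous_on[OF continuous_on_cnj[OF continuous_on_id] Fm])
  define g where "g \<xi> = cnj (fourier_integral f \<xi>) * of_real (gaussian_cutoff \<epsilon> \<xi>)" for \<xi>
  have gi: "integrable lebesgue g"
    unfolding g_def by (rule integrable_mult_bounded[OF gaussian_cutoff_integrable[OF e] cFm, of B])
      (simp only: complex_mod_cnj fb)
  show ?I unfolding g_def[symmetric] by (rule integrable_mult_bounded[OF gi Fm fb])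
  have Fg: "fourier_integral g x = cnj (LINT z|lborel. of_real (std_gaussian z) * f (x + \<epsilon> *\<^sub>R z))" for x
  proof -
    let ?h = "\<lambda>\<xi>. cnj (fourier_kernel x \<xi>) * complex_of_real (gaussian_cutoff \<epsilon> \<xi>)"
    have kcm: "(\<lambda>\<xi>. cnj (fourier_kernel x \<xi>)) \<in> borel_measurable lebesgue"
      by (rule borel_measurable_continuous_on[OF continuous_on_cnj[OF continuous_on_id]
            fourier_kernel_measurable_lebesgue])
    have hi: "integrable lebesgue ?h"
      by (rule integrable_mult_bounded[OF gaussian_cutoff_integrable[OF e] kcm, of 1])
        (simp only: complex_mod_cnj norm_fourier_kernel order_refl)
    define q where "q y = f y * of_real (inverse \<epsilon> ^ DIM('a) * gaussian_cutoff (inverse \<epsilon>) (y - x))" for y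
    have qm: "q \<in> borel_measurable borel" unfolding q_def using fm by measurable
    have qx: "q (x + \<epsilon> *\<^sub>R z) = of_real (inverse \<epsilon> ^ DIM('a) * (inverse ?c)) * (of_real (std_gaussian z) * f (x + \<epsilon> *\<^sub>R z))" for z
      using e by (simp add: q_def std_gaussian_def)
    have "fourier_integral g x = of_real ?c * (LINT \<xi>|lebesgue. cnj (fourier_integral f \<xi> * ?h \<xi>))"
      unfolding fourier_integral_eq[of g] g_def by (simp only: complex_cnj_mult complex_cnj_cnj complex_cnj_complex_of_real mult.left_commute)
    also have "\<dots> = cnj (of_real ?c * (LINT \<xi>|lebesgue. fourier_integral f \<xi> * ?h \<xi>))"
      by (subst Bochner_Integration.integral_cnj) (simp only: complex_cnj_mult complex_cnj_complex_of_real)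
    also have "(LINT \<xi>|lebesgue. fourier_integral f \<xi> * ?h \<xi>) = (LINT y|lebesgue. q y)"
      unfolding fourier_integral_multiplication_formula[OF fi hi] fourier_integral_gaussian_cutoff[OF e] q_def ..
    also have "\<dots> = (LINT y|lborel. q y)"
      by (rule integral_completion) (simp only: measurable_lborel2 qm)
    also have "\<dots> = of_real (\<epsilon> ^ DIM('a)) * (LINT z|lborel. q (x + \<epsilon> *\<^sub>R z))"
      by (rule lborel_integral_affine(1)[OF qm e])
    also have "(LINT z|lborel. q (x + \<epsilon> *\<^sub>R z)) = of_real (inverse \<epsilon> ^ DIM('a) * (inverse ?c)) *
        (LINT z|lborel. of_real (std_gaussian z) * f (x + \<epsilon> *\<^sub>R z))"
      unfolding qx by (rule integral_mult_right_zero)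
    also have "complex_of_real ?c * (of_real (\<epsilon> ^ DIM('a)) * (of_real (inverse \<epsilon> ^ DIM('a) * (inverse ?c)) * w)) = w" for w
    proof -
      have "?c * (\<epsilon> ^ DIM('a) * (inverse \<epsilon> ^ DIM('a) * (inverse ?c))) = 1"
      proof -
        have cancel: "c * (a * (inverse a * inverse c)) = 1" if "a \<noteq> 0" "c \<noteq> 0" for a c :: real
          using that by (simp add: field_simps)
        show ?thesis unfolding power_inverse by (rule cancel) (use e in simp_all)
      qed
      then show ?thesis by (simp only: of_real_mult[symmetric] mult.assoc[symmetric] of_real_1 mult_1)
    qed
    finally show ?thesis .
  qed
  show ?E
    unfolding g_def[symmetric] fourier_integral_multiplication_formula[OF fi gi] Fg ..
qed

lemma ennreal_norm_integral_le:
  fixes f :: "'a \<Rightarrow> complex"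
  shows "ennreal (cmod (integral\<^sup>L M f)) \<le> (\<integral>\<^sup>+ x. ennreal (cmod (f x)) \<partial>M)"
proof (cases "integrable M f")
  case True
  then show ?thesis by (rule integral_norm_bound_ennreal)
next
  case False
  then show ?thesis by (simp add: not_integrable_integral_eq)
qed

text \<open>Averaging does not increase the correlation: each translate of \<open>|f|\<close> has the norm of \<open>f\<close>, so its product
  with \<open>|f|\<close> integrates to at most the square of that norm, and the Gaussian has mass one.\<close>

lemma gaussian_average_bound:
  fixes f :: "'a::euclidean_space \<Rightarrow> complex"
  assumes fm [measurable]: "f \<in> borel_measurable borel" and fL: "f \<in> L2"
  shows "cmod (LINT x|lebesgue. f x * cnj (LINT z|lborel. of_real (std_gaussian z) * f (x + \<epsilon> *\<^sub>R z))) \<le> (L2_norm f)\<^sup>2"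
proof -
  let ?a = "\<lambda>x. ennreal (cmod (f x))"
  let ?S = "ennreal ((L2_norm f)\<^sup>2)"
  have S: "(\<integral>\<^sup>+ x. ennreal ((cmod (f x))\<^sup>2) \<partial>lborel) = ?S"
    using L2_norm_nn[OF fL] by (simp only: nn_integral_completion)
  have half: "ennreal (1/2) * (?S + ?S) = ?S"
  proof -
    have "?S + ?S = ennreal ((L2_norm f)\<^sup>2 + (L2_norm f)\<^sup>2)"
      by (rule ennreal_plus[symmetric]) (rule zero_le_power2)+
    moreover have "ennreal (1/2) * ennreal ((L2_norm f)\<^sup>2 + (L2_norm f)\<^sup>2)
        = ennreal (1/2 * ((L2_norm f)\<^sup>2 + (L2_norm f)\<^sup>2))"
      by (rule ennreal_mult[symmetric]) simp_all
    moreover have "1/2 * ((L2_norm f)\<^sup>2 + (L2_norm f)\<^sup>2) = (L2_norm f)\<^sup>2" by simp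
    ultimately show ?thesis by (simp only:)
  qed
  have inner: "(\<integral>\<^sup>+ x. ?a x * ?a (x + t) \<partial>lborel) \<le> ?S" for t
  proof -
    have pw: "?a x * ?a (x + t) \<le> ennreal (1/2) * (ennreal ((cmod (f x))\<^sup>2) + ennreal ((cmod (f (x + t)))\<^sup>2))" for x
    proof -
      have "cmod (f x) * cmod (f (x + t)) = 1/2 * (2 * cmod (f x) * cmod (f (x + t)))" by simp
      also have "\<dots> \<le> 1/2 * ((cmod (f x))\<^sup>2 + (cmod (f (x + t)))\<^sup>2)"
        by (rule mult_left_mono[OF sum_squares_bound]) simp
      finally have "cmod (f x) * cmod (f (x + t)) \<le> 1/2 * ((cmod (f x))\<^sup>2 + (cmod (f (x + t)))\<^sup>2)" .
      then have "ennreal (cmod (f x) * cmod (f (x + t))) \<le> ennreal (1/2 * ((cmod (f x))\<^sup>2 + (cmod (f (x + t)))\<^sup>2))"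
        by (rule ennreal_leI)
      then show ?thesis by (simp only: ennreal_mult' norm_ge_zero ennreal_plus zero_le_power2)
    qed
    have "(\<integral>\<^sup>+ x. ?a x * ?a (x + t) \<partial>lborel) \<le>
        (\<integral>\<^sup>+ x. ennreal (1/2) * (ennreal ((cmod (f x))\<^sup>2) + ennreal ((cmod (f (x + t)))\<^sup>2)) \<partial>lborel)"
      by (rule nn_integral_mono) (rule pw)
    also have "\<dots> = ennreal (1/2) * (\<integral>\<^sup>+ x. ennreal ((cmod (f x))\<^sup>2) + ennreal ((cmod (f (x + t)))\<^sup>2) \<partial>lborel)"
      by (rule nn_integral_cmult) measurable
    also have "(\<integral>\<^sup>+ x. ennreal ((cmod (f x))\<^sup>2) + ennreal ((cmod (f (x + t)))\<^sup>2) \<partial>lborel)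
        = (\<integral>\<^sup>+ x. ennreal ((cmod (f x))\<^sup>2) \<partial>lborel) + (\<integral>\<^sup>+ x. ennreal ((cmod (f (x + t)))\<^sup>2) \<partial>lborel)"
      by (rule nn_integral_add) measurable
    also have "(\<integral>\<^sup>+ x. ennreal ((cmod (f (x + t)))\<^sup>2) \<partial>lborel) = (\<integral>\<^sup>+ x. ennreal ((cmod (f x))\<^sup>2) \<partial>lborel)"
      by (rule lborel_nn_integral_translate) measurable
    finally show ?thesis unfolding S half .
  qed
  let ?m = "\<lambda>x. LINT z|lborel. of_real (std_gaussian z) * f (x + \<epsilon> *\<^sub>R z)"
  let ?N = "\<lambda>z::'a. ennreal (std_gaussian z)"
  have "ennreal (cmod (LINT x|lebesgue. f x * cnj (?m x))) \<le> (\<integral>\<^sup>+ x. ennreal (cmod (f x * cnj (?m x))) \<partial>lebesgue)"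
    by (rule ennreal_norm_integral_le)
  also have "\<dots> = (\<integral>\<^sup>+ x. ennreal (cmod (f x * cnj (?m x))) \<partial>lborel)"
    by (rule nn_integral_completion)
  also have "\<dots> \<le> (\<integral>\<^sup>+ x. (\<integral>\<^sup>+ z. ?N z * (?a x * ?a (x + \<epsilon> *\<^sub>R z)) \<partial>lborel) \<partial>lborel)"
  proof (rule nn_integral_mono)
    fix x :: 'a
    have "ennreal (cmod (f x * cnj (?m x))) = ?a x * ennreal (cmod (?m x))"
      by (simp add: norm_mult ennreal_mult)
    also have "\<dots> \<le> ?a x * (\<integral>\<^sup>+ z. ennreal (cmod (of_real (std_gaussian z) * f (x + \<epsilon> *\<^sub>R z))) \<partial>lborel)"
      by (rule mult_left_mono[OF ennreal_norm_integral_le]) simp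
    also have "\<dots> = (\<integral>\<^sup>+ z. ?a x * ennreal (cmod (of_real (std_gaussian z) * f (x + \<epsilon> *\<^sub>R z))) \<partial>lborel)"
      by (rule nn_integral_cmult[symmetric]) measurable
    also have "\<dots> = (\<integral>\<^sup>+ z. ?N z * (?a x * ?a (x + \<epsilon> *\<^sub>R z)) \<partial>lborel)"
      by (rule nn_integral_cong) (simp add: norm_mult ennreal_mult mult_ac)
    finally show "ennreal (cmod (f x * cnj (?m x))) \<le> (\<integral>\<^sup>+ z. ?N z * (?a x * ?a (x + \<epsilon> *\<^sub>R z)) \<partial>lborel)" .
  qed
  also have "\<dots> = (\<integral>\<^sup>+ z. (\<integral>\<^sup>+ x. ?N z * (?a x * ?a (x + \<epsilon> *\<^sub>R z)) \<partial>lborel) \<partial>lborel)"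
    by (rule lborel_pair.Fubini'[symmetric]) measurable
  also have "\<dots> \<le> (\<integral>\<^sup>+ z. ?N z * ?S \<partial>lborel)"
  proof (rule nn_integral_mono)
    fix z :: 'a
    have "(\<integral>\<^sup>+ x. ?N z * (?a x * ?a (x + \<epsilon> *\<^sub>R z)) \<partial>lborel) = ?N z * (\<integral>\<^sup>+ x. ?a x * ?a (x + \<epsilon> *\<^sub>R z) \<partial>lborel)"
      by (rule nn_integral_cmult) measurable
    also have "\<dots> \<le> ?N z * ?S" by (rule mult_left_mono[OF inner]) simp
    finally show "(\<integral>\<^sup>+ x. ?N z * (?a x * ?a (x + \<epsilon> *\<^sub>R z)) \<partial>lborel) \<le> ?N z * ?S" .
  qed
  also have "\<dots> = (\<integral>\<^sup>+ z. ?N z \<partial>lborel) * ?S"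
    by (rule nn_integral_multc) measurable
  also have "\<dots> = ?S" by (simp only: std_gaussian_nn_integral mult_1)
  finally show ?thesis by (simp only: ennreal_le_iff zero_le_power2)
qed

lemma plancherel_energy:
  fixes f :: "'a::euclidean_space \<Rightarrow> complex"
  assumes fm: "f \<in> borel_measurable borel" and fi: "integrable lebesgue f" and e: "\<epsilon> > 0"
  shows "integrable lebesgue (\<lambda>\<xi>. (cmod (fourier_integral f \<xi>))\<^sup>2 * gaussian_cutoff \<epsilon> \<xi>)" (is ?I)
    and "complex_of_real (LINT \<xi>|lebesgue. (cmod (fourier_integral f \<xi>))\<^sup>2 * gaussian_cutoff \<epsilon> \<xi>)
       = (LINT x|lebesgue. f x * cnj (LINT z|lborel. of_real (std_gaussian z) * f (x + \<epsilon> *\<^sub>R z)))" (is ?E)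
proof -
  have eq: "fourier_integral f \<xi> * (cnj (fourier_integral f \<xi>) * of_real (gaussian_cutoff \<epsilon> \<xi>))
      = complex_of_real ((cmod (fourier_integral f \<xi>))\<^sup>2 * gaussian_cutoff \<epsilon> \<xi>)" for \<xi>
    unfolding of_real_mult complex_norm_square by (simp only: mult.assoc)
  note * = plancherel_regularised[OF fm fi e, unfolded eq]
  show ?I using integrable_Re[OF *(1)] by (simp only: Re_complex_of_real)
  show ?E using *(2) by (simp only: integral_complex_of_real)
qed

lemma gaussian_cutoff_tendsto:
  "(\<lambda>k. gaussian_cutoff (inverse (real (Suc k))) \<xi>) \<longlonglongrightarrow> 1"
proof -
  have "(\<lambda>k. gaussian_cutoff (inverse (real (Suc k))) \<xi>) \<longlonglongrightarrow> exp (- (norm (0 *\<^sub>R \<xi>))\<^sup>2 / 2)"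
    by (intro tendsto_exp tendsto_divide tendsto_minus tendsto_power tendsto_norm tendsto_scaleR
        tendsto_const LIMSEQ_inverse_real_of_nat) simp
  then show ?thesis by simp
qed

text \<open>Fatou's lemma removes the cutoff as \<open>\<epsilon> \<rightarrow> 0\<close>.\<close>

lemma fourier_integral_contraction:
  fixes f :: "'a::euclidean_space \<Rightarrow> complex"
  assumes fm: "f \<in> borel_measurable borel" and fi: "integrable lebesgue f" and fL: "f \<in> L2"
  shows "fourier_integral f \<in> L2" "L2_norm (fourier_integral f) \<le> L2_norm f"
proof -
  let ?J = "\<lambda>k \<xi>. (cmod (fourier_integral f \<xi>))\<^sup>2 * gaussian_cutoff (inverse (real (Suc k))) \<xi>"
  have Fm: "fourier_integral f \<in> borel_measurable lebesgue"
    by (rule fourier_integral_measurable_lebesgue[OF borel_measurable_lebesgueI[OF fm]])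
  have ek: "0 < inverse (real (Suc k))" for k by simp
  have J0: "0 \<le> ?J k \<xi>" for k \<xi> by simp
  have Jb: "(\<integral>\<^sup>+ \<xi>. ennreal (?J k \<xi>) \<partial>lebesgue) \<le> ennreal ((L2_norm f)\<^sup>2)" for k
  proof -
    have eqJ: "(\<integral>\<^sup>+ \<xi>. ennreal (?J k \<xi>) \<partial>lebesgue) = ennreal (LINT \<xi>|lebesgue. ?J k \<xi>)"
      by (rule nn_integral_eq_integral[OF plancherel_energy(1)[OF fm fi ek]]) (rule AE_I2, rule J0)
    have "(LINT \<xi>|lebesgue. ?J k \<xi>) \<le> cmod (complex_of_real (LINT \<xi>|lebesgue. ?J k \<xi>))"
      unfolding norm_of_real by (rule abs_ge_self)
    also have "\<dots> \<le> (L2_norm f)\<^sup>2"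
      unfolding plancherel_energy(2)[OF fm fi ek] by (rule gaussian_average_bound[OF fm fL])
    finally have "(LINT \<xi>|lebesgue. ?J k \<xi>) \<le> (L2_norm f)\<^sup>2" .
    with eqJ show ?thesis by (simp only: ennreal_leI)
  qed
  have lim: "(\<lambda>k. ennreal (?J k \<xi>)) \<longlonglongrightarrow> ennreal ((cmod (fourier_integral f \<xi>))\<^sup>2)" for \<xi>
    using tendsto_ennrealI[OF tendsto_mult[OF tendsto_const[of "(cmod (fourier_integral f \<xi>))\<^sup>2"]
        gaussian_cutoff_tendsto[of \<xi>]]] unfolding mult_1_right .
  have 1: "(\<integral>\<^sup>+ \<xi>. ennreal ((cmod (fourier_integral f \<xi>))\<^sup>2) \<partial>lebesgue)
      = (\<integral>\<^sup>+ \<xi>. liminf (\<lambda>k. ennreal (?J k \<xi>)) \<partial>lebesgue)"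
    by (rule nn_integral_cong) (rule lim_imp_Liminf[OF sequentially_bot lim, symmetric])
  have 2: "(\<integral>\<^sup>+ \<xi>. liminf (\<lambda>k. ennreal (?J k \<xi>)) \<partial>lebesgue)
      \<le> liminf (\<lambda>k. \<integral>\<^sup>+ \<xi>. ennreal (?J k \<xi>) \<partial>lebesgue)"
    by (rule nn_integral_liminf)
       (intro measurable_compose[OF _ measurable_ennreal] borel_measurable_integrable
         plancherel_energy(1)[OF fm fi ek])
  have 3: "liminf (\<lambda>k. \<integral>\<^sup>+ \<xi>. ennreal (?J k \<xi>) \<partial>lebesgue) \<le> liminf (\<lambda>k. ennreal ((L2_norm f)\<^sup>2))"
    by (rule Liminf_mono, rule always_eventually, rule allI, rule Jb)
  have le: "(\<integral>\<^sup>+ \<xi>. ennreal ((cmod (fourier_integral f \<xi>))\<^sup>2) \<partial>lebesgue) \<le> ennreal ((L2_norm f)\<^sup>2)"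
    using order_trans[OF 2 3] unfolding 1 Liminf_const[OF sequentially_bot] .
  show "fourier_integral f \<in> L2" "L2_norm (fourier_integral f) \<le> L2_norm f"
    by (rule L2_I_le[OF Fm L2_norm_nonneg le])+
qed

text \<open>For bounded continuous \<open>f\<close> the Gaussian averages converge pointwise to \<open>f\<close>, so that no energy is
  lost in the limit \<open>\<epsilon> \<rightarrow> 0\<close>.\<close>

lemma fourier_integral_isometry_continuous:
  fixes f :: "'a::euclidean_space \<Rightarrow> complex"
  assumes fc: "continuous_on UNIV f" and bd: "\<And>x. cmod (f x) \<le> M"
    and fi: "integrable lebesgue f" and fL: "f \<in> L2"
  shows "L2_norm (fourier_integral f) = L2_norm f"
proof -
  have fm [measurable]: "f \<in> borel_measurable borel" by (rule borel_measurable_continuous_onI[OF fc])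
  let ?e = "\<lambda>k. inverse (real (Suc k))"
  have ek: "0 < ?e k" for k by simp
  note FL = fourier_integral_contraction(1)[OF fm fi fL]
  let ?F = "\<lambda>\<xi>. (cmod (fourier_integral f \<xi>))\<^sup>2"
  let ?J = "\<lambda>k \<xi>. ?F \<xi> * gaussian_cutoff (?e k) \<xi>"
  let ?A = "\<lambda>k. LINT \<xi>|lebesgue. ?J k \<xi>"
  have A: "?A \<longlonglongrightarrow> (LINT \<xi>|lebesgue. ?F \<xi> * 1)"
  proof (rule integral_dominated_convergence)
    show "integrable lebesgue (\<lambda>\<xi>. ?F \<xi>)" by (rule L2_integrable[OF FL])
    show "(\<lambda>\<xi>. ?F \<xi> * 1) \<in> borel_measurable lebesgue"
      unfolding mult_1_right by (rule borel_measurable_integrable[OF L2_integrable[OF FL]])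
    show "(\<lambda>\<xi>. ?J k \<xi>) \<in> borel_measurable lebesgue" for k
      by (rule borel_measurable_integrable[OF plancherel_energy(1)[OF fm fi ek]])
    show "AE \<xi> in lebesgue. (\<lambda>k. ?J k \<xi>)
        \<longlonglongrightarrow> ?F \<xi> * 1"
      by (rule AE_I2) (rule tendsto_mult[OF tendsto_const gaussian_cutoff_tendsto])
    show "AE \<xi> in lebesgue. norm (?J k \<xi>)
        \<le> ?F \<xi>" for k
      by (rule AE_I2) (simp add: mult_left_le)
  qed
  let ?p = "\<lambda>k x z. of_real (std_gaussian z) * f (x + ?e k *\<^sub>R z)"
  let ?m = "\<lambda>k x. LINT z|lborel. ?p k x z"
  have Ni: "integrable lborel (\<lambda>z::'a. std_gaussian z * M)"
    by (rule integrable_mult_left) (rule std_gaussian_integral(1))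
  have Nb: "norm (of_real (std_gaussian z) * f y) \<le> std_gaussian z * M" for z :: 'a and y
    by (simp add: norm_mult mult_left_mono bd)
  have ml: "(\<lambda>k. ?m k x) \<longlonglongrightarrow> f x" for x
  proof -
    have "(\<lambda>k. ?m k x) \<longlonglongrightarrow> (LINT z|lborel. of_real (std_gaussian (z::'a)) * f x)"
    proof (rule integral_dominated_convergence[OF _ _ Ni])
      show "AE z in lborel. (\<lambda>k. ?p k x z) \<longlonglongrightarrow> of_real (std_gaussian z) * f x"
      proof (rule AE_I2)
        fix z :: 'a
        have "(\<lambda>k. x + ?e k *\<^sub>R z) \<longlonglongrightarrow> x + 0 *\<^sub>R z"
          by (intro tendsto_add tendsto_const tendsto_scaleR LIMSEQ_inverse_real_of_nat)
        then have "(\<lambda>k. f (x + ?e k *\<^sub>R z)) \<longlonglongrightarrow> f (x + 0 *\<^sub>R z)"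
          by (rule continuous_on_tendsto_compose[OF fc]) simp_all
        then have "(\<lambda>k. f (x + ?e k *\<^sub>R z)) \<longlonglongrightarrow> f x" by (simp only: scaleR_zero_left add_0_right)
        then show "(\<lambda>k. ?p k x z) \<longlonglongrightarrow> of_real (std_gaussian z) * f x"
          by (rule tendsto_mult[OF tendsto_const])
      qed
      show "AE z in lborel. norm (?p k x z) \<le> std_gaussian z * M" for k
        by (rule AE_I2) (rule Nb)
    qed measurable
    also have "(LINT z|lborel. of_real (std_gaussian (z::'a)) * f x) = f x"
      by (simp add: std_gaussian_integral)
    finally show ?thesis .
  qed
  have mb: "cmod (?m k x) \<le> M" for k x
  proof -
    have "cmod (?m k x) \<le> (LINT z|lborel. norm (?p k x z))"
      by (rule integral_norm_bound)
    also have "\<dots> \<le> (LINT z|lborel. std_gaussian (z::'a) * M)"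
    proof (rule integral_mono[OF _ Ni])
      show "integrable lborel (\<lambda>z. norm (?p k x z))"
      proof (rule Bochner_Integration.integrable_bound[OF Ni])
        show "AE z in lborel. norm (norm (?p k x z)) \<le> norm (std_gaussian z * M)"
          by (rule AE_I2) (use order_trans[OF Nb abs_ge_self] in \<open>simp only: real_norm_def abs_norm_cancel\<close>)
      qed measurable
    qed (rule Nb)
    also have "\<dots> = M" by (simp add: std_gaussian_integral)
    finally show ?thesis .
  qed
  have mm: "?m k \<in> borel_measurable borel" for k by measurable
  have cm: "(\<lambda>x. f x * cnj (?m k x)) \<in> borel_measurable lebesgue" for k
    by (intro borel_measurable_lebesgueI borel_measurable_times fm
        borel_measurable_continuous_on[OF continuous_on_cnj[OF continuous_on_id]] mm)
  have R: "(\<lambda>k. LINT x|lebesgue. f x * cnj (?m k x)) \<longlonglongrightarrow> (LINT x|lebesgue. f x * cnj (f x))"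
  proof (rule integral_dominated_convergence)
    show "integrable lebesgue (\<lambda>x. cmod (f x) * M)" using fi by simp
    show "(\<lambda>x. f x * cnj (f x)) \<in> borel_measurable lebesgue"
      by (rule borel_measurable_integrable[OF L2_mult_integrable[OF fL L2_cnj[OF fL]]])
    show "(\<lambda>x. f x * cnj (?m k x)) \<in> borel_measurable lebesgue" for k by (rule cm)
    show "AE x in lebesgue. (\<lambda>k. f x * cnj (?m k x)) \<longlonglongrightarrow> f x * cnj (f x)"
      by (rule AE_I2) (rule tendsto_mult[OF tendsto_const tendsto_cnj[OF ml]])
    show "AE x in lebesgue. norm (f x * cnj (?m k x)) \<le> cmod (f x) * M" for k
      by (rule AE_I2) (simp only: norm_mult complex_mod_cnj mult_left_mono[OF mb norm_ge_zero])
  qed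
  have lim1: "(\<lambda>k. complex_of_real (?A k)) \<longlonglongrightarrow> of_real ((L2_norm (fourier_integral f))\<^sup>2)"
    using tendsto_of_real[OF A] unfolding mult_1_right L2_norm_square .
  have sq: "(LINT x|lebesgue. f x * cnj (f x)) = of_real ((L2_norm f)\<^sup>2)"
    unfolding complex_norm_square[symmetric] L2_norm_square by (rule integral_complex_of_real)
  have lim2: "(\<lambda>k. complex_of_real (?A k)) \<longlonglongrightarrow> (LINT x|lebesgue. f x * cnj (f x))"
    using R by (simp only: plancherel_energy(2)[OF fm fi ek])
  have "complex_of_real ((L2_norm (fourier_integral f))\<^sup>2) = of_real ((L2_norm f)\<^sup>2)"
    by (simp only: LIMSEQ_unique[OF lim1 lim2] sq)
  then have "(L2_norm (fourier_integral f))\<^sup>2 = (L2_norm f)\<^sup>2"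
    unfolding of_real_eq_iff .
  then show ?thesis by (rule power2_eq_imp_eq) (rule L2_norm_nonneg)+
qed

text \<open>A linear contraction that is isometric on a dense subspace is isometric.\<close>

lemma fourier_integral_isometry:
  fixes f :: "'a::euclidean_space \<Rightarrow> complex"
  assumes fi: "integrable lebesgue f" and fL: "f \<in> L2"
  shows "fourier_integral f \<in> L2" "L2_norm (fourier_integral f) = L2_norm f"
proof -
  have contr: "fourier_integral g \<in> L2" "L2_norm (fourier_integral g) \<le> L2_norm g"
    if g: "integrable lebesgue g" "g \<in> L2" for g :: "'a \<Rightarrow> complex"
  proof -
    obtain g' where g': "g' \<in> borel_measurable borel" "AE x in lebesgue. g x = g' x"
      using lebesgue_borel_representative[OF L2_measurable[OF g(2)]] .
    note g'L = L2_cong_AE[OF g(2) g'(2)]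
    have g'i: "integrable lebesgue g'"
      by (rule integrable_cong_AE_imp[OF g(1) borel_measurable_lebesgueI[OF g'(1)]])
         (use g'(2) in \<open>simp only: eq_commute\<close>)
    show "fourier_integral g \<in> L2" "L2_norm (fourier_integral g) \<le> L2_norm g"
      using fourier_integral_contraction[OF g'(1) g'i g'L(1)]
      unfolding fourier_integral_cong_AE[OF L2_measurable[OF g(2)] g'(2)] g'L(2) by this+
  qed
  show FL: "fourier_integral f \<in> L2" by (rule contr[OF fi fL])
  have "L2_norm f \<le> L2_norm (fourier_integral f) + e" if e: "e > 0" for e
  proof -
    have e2: "e / 2 > 0" using e by simp
    obtain g R M where gc: "continuous_on UNIV g" and g0: "\<And>x. R < norm x \<Longrightarrow> g x = 0"
      and gb: "\<And>x. cmod (g x) \<le> M" and gL: "g \<in> L2" and gf: "L2_norm (\<lambda>x. g x - f x) < e / 2"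
      by (rule L2_dense_continuous[OF fL e2]) (rule that)
    have "integrable lebesgue (\<lambda>x. 1 * indicator (cball 0 R) x * g x)"
      by (rule L2_mult_integrable[OF L2_indicator_cball(1) gL])
    moreover have "1 * indicator (cball 0 R) x * g x = g x" for x
      using g0[of x] by (cases "norm x \<le> R") auto
    ultimately have gi: "integrable lebesgue g" by (simp only:)
    have di: "integrable lebesgue (\<lambda>x. g x - f x)" and dL: "(\<lambda>x. g x - f x) \<in> L2"
      using Bochner_Integration.integrable_diff[OF gi fi] L2_diff(1)[OF gL fL] by this+
    have "L2_norm (\<lambda>x. fourier_integral g x - fourier_integral f x) \<le> L2_norm (\<lambda>x. g x - f x)"
      using contr(2)[OF di dL] unfolding fourier_integral_diff[OF gi fi, symmetric] .
    moreover have "L2_norm (fourier_integral g) \<le> L2_norm (fourier_integral f)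
        + L2_norm (\<lambda>x. fourier_integral g x - fourier_integral f x)"
      by (rule L2_norm_le_diff[OF contr(1)[OF gi gL] FL])
    moreover have "L2_norm (fourier_integral g) = L2_norm g"
      by (rule fourier_integral_isometry_continuous[OF gc gb gi gL])
    moreover have "L2_norm f \<le> L2_norm g + L2_norm (\<lambda>x. f x - g x)"
      by (rule L2_norm_le_diff[OF fL gL])
    moreover have "L2_norm (\<lambda>x. f x - g x) = L2_norm (\<lambda>x. g x - f x)"
      by (rule L2_norm_minus_commute)
    ultimately show ?thesis using gf by linarith
  qed
  then have "L2_norm f \<le> L2_norm (fourier_integral f)" by (rule field_le_epsilon)
  with contr(2)[OF fi fL] show "L2_norm (fourier_integral f) = L2_norm f" by (rule order_antisym)
qed

section \<open>The Fourier--Plancherel transform\<close>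

abbreviation truncate :: "real \<Rightarrow> ('a::euclidean_space \<Rightarrow> complex) \<Rightarrow> 'a \<Rightarrow> complex" where
  "truncate R f \<equiv> (\<lambda>x. indicator (cball 0 R) x * f x)"

lemma truncate_L2:
  assumes "f \<in> L2"
  shows "truncate R f \<in> L2"
  by (rule L2_indicator_mult(1)[OF assms]) simp

lemma truncate_integrable:
  assumes "f \<in> L2"
  shows "integrable lebesgue (truncate R f)"
  using L2_mult_integrable[OF L2_indicator_cball(1)[of 1 R] assms] by (simp only: mult_1)

lemma fourier_truncate_L2: "f \<in> L2 \<Longrightarrow> fourier_integral (truncate R f) \<in> L2"
  by (rule fourier_integral_isometry(1)[OF truncate_integrable truncate_L2])

lemma fourier_truncate_dist:
  assumes f: "f \<in> L2"
  shows "L2_norm (\<lambda>\<xi>. fourier_integral (truncate R f) \<xi> - fourier_integral (truncate R' f) \<xi>)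
    = L2_norm (\<lambda>x. truncate R f x - truncate R' f x)"
  unfolding fourier_integral_diff[OF truncate_integrable[OF f] truncate_integrable[OF f], symmetric]
  by (rule fourier_integral_isometry(2)[OF
        Bochner_Integration.integrable_diff[OF truncate_integrable[OF f] truncate_integrable[OF f]]
        L2_diff(1)[OF truncate_L2[OF f] truncate_L2[OF f]]])

text \<open>The convergence in the definition of the Plancherel transform is convergence in norm.\<close>

lemma L2_tendsto_iff:
  assumes "\<And>R. h R \<in> L2" "g \<in> L2"
  shows "((\<lambda>R. \<integral>\<^sup>+ \<xi>. ennreal ((cmod (h R \<xi> - g \<xi>))\<^sup>2) \<partial>lebesgue) \<longlongrightarrow> 0) F
    \<longleftrightarrow> ((\<lambda>R. L2_norm (\<lambda>\<xi>. h R \<xi> - g \<xi>)) \<longlongrightarrow> 0) F"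
proof -
  have "((\<lambda>R. ennreal ((L2_norm (\<lambda>\<xi>. h R \<xi> - g \<xi>))\<^sup>2)) \<longlongrightarrow> ennreal 0) F
    \<longleftrightarrow> ((\<lambda>R. (L2_norm (\<lambda>\<xi>. h R \<xi> - g \<xi>))\<^sup>2) \<longlongrightarrow> 0) F"
    by (rule tendsto_ennreal_iff) (auto intro!: always_eventually)
  also have "\<dots> \<longleftrightarrow> ((\<lambda>R. L2_norm (\<lambda>\<xi>. h R \<xi> - g \<xi>)) \<longlongrightarrow> 0) F"
  proof
    assume "((\<lambda>R. (L2_norm (\<lambda>\<xi>. h R \<xi> - g \<xi>))\<^sup>2) \<longlongrightarrow> 0) F"
    from tendsto_real_sqrt[OF this] show "((\<lambda>R. L2_norm (\<lambda>\<xi>. h R \<xi> - g \<xi>)) \<longlongrightarrow> 0) F"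
      by (simp only: real_sqrt_abs abs_of_nonneg[OF L2_norm_nonneg] real_sqrt_zero)
  next
    assume "((\<lambda>R. L2_norm (\<lambda>\<xi>. h R \<xi> - g \<xi>)) \<longlongrightarrow> 0) F"
    from tendsto_power[OF this, of 2] show "((\<lambda>R. (L2_norm (\<lambda>\<xi>. h R \<xi> - g \<xi>))\<^sup>2) \<longlongrightarrow> 0) F"
      by (simp only: zero_power2)
  qed
  finally show ?thesis
    unfolding L2_norm_nn[OF L2_diff(1)[OF assms]] ennreal_0 .
qed

lemma L2_fourier_iff:
  "L2_fourier f g \<longleftrightarrow> f \<in> L2 \<and> g \<in> L2 \<and>
     ((\<lambda>R. L2_norm (\<lambda>\<xi>. fourier_integral (truncate R f) \<xi> - g \<xi>)) \<longlongrightarrow> 0) at_top"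
  unfolding L2_fourier_def using L2_tendsto_iff[of "\<lambda>R. fourier_integral (truncate R f)" g at_top, OF fourier_truncate_L2] by blast

lemma L2_fourier_D:
  assumes "L2_fourier f g"
  shows "f \<in> L2" "g \<in> L2"
    "((\<lambda>R. L2_norm (\<lambda>\<xi>. fourier_integral (truncate R f) \<xi> - g \<xi>)) \<longlongrightarrow> 0) at_top"
  using assms unfolding L2_fourier_iff by blast+

lemma L2_fourier_I:
  assumes "f \<in> L2" "g \<in> L2"
    "((\<lambda>R. L2_norm (\<lambda>\<xi>. fourier_integral (truncate R f) \<xi> - g \<xi>)) \<longlongrightarrow> 0) at_top"
  shows "L2_fourier f g"
  unfolding L2_fourier_iff by (intro conjI assms)

lemma tendsto_zero_le:
  fixes h k :: "'b \<Rightarrow> real"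
  assumes "(h \<longlongrightarrow> 0) F" "\<And>R. 0 \<le> k R" "\<And>R. k R \<le> h R"
  shows "(k \<longlongrightarrow> 0) F"
  by (rule tendsto_sandwich[OF _ _ tendsto_const assms(1)]) (auto intro!: always_eventually assms)

lemma L2_norm_tendsto:
  assumes h: "\<And>R. h R \<in> L2" and g: "g \<in> L2" and lim: "((\<lambda>R. L2_norm (\<lambda>\<xi>. h R \<xi> - g \<xi>)) \<longlongrightarrow> 0) F"
  shows "((\<lambda>R. L2_norm (h R)) \<longlongrightarrow> L2_norm g) F"
proof -
  have "((\<lambda>R. \<bar>L2_norm (h R) - L2_norm g\<bar>) \<longlongrightarrow> 0) F"
  proof (rule tendsto_zero_le[OF lim])
    fix R
    have "L2_norm g \<le> L2_norm (h R) + L2_norm (\<lambda>\<xi>. h R \<xi> - g \<xi>)"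
      using L2_norm_le_diff[OF g h] unfolding L2_norm_minus_commute[of g] .
    with L2_norm_le_diff[OF h g, of R]
    show "\<bar>L2_norm (h R) - L2_norm g\<bar> \<le> L2_norm (\<lambda>\<xi>. h R \<xi> - g \<xi>)" by linarith
  qed simp
  then show ?thesis by (simp only: tendsto_rabs_zero_iff LIM_zero_iff)
qed

lemma L2_fourier_isometry:
  assumes "L2_fourier f g"
  shows "L2_norm g = L2_norm f"
proof -
  note D = L2_fourier_D[OF assms]
  have "((\<lambda>R. L2_norm (fourier_integral (truncate R f))) \<longlongrightarrow> L2_norm g) at_top"
    by (rule L2_norm_tendsto[OF fourier_truncate_L2[OF D(1)] D(2,3)])
  moreover have "((\<lambda>R. L2_norm (truncate R f)) \<longlongrightarrow> L2_norm f) at_top"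
    by (rule L2_norm_tendsto[OF truncate_L2[OF D(1)] D(1) L2_truncate_tendsto[OF D(1)]])
  ultimately show ?thesis
    unfolding fourier_integral_isometry(2)[OF truncate_integrable[OF D(1)] truncate_L2[OF D(1)]]
    by (rule tendsto_unique[OF trivial_limit_at_top_linorder])
qed

text \<open>By isometry the transforms of the truncations form a Cauchy family, at the rate at which the
  truncations converge. Along radii for which that rate is geometric they converge to some \<open>g\<close>, and the
  rate carries this over to all radii.\<close>

lemma L2_fourier_exists:
  fixes f :: "'a::euclidean_space \<Rightarrow> complex"
  assumes f: "f \<in> L2"
  obtains g where "L2_fourier f g"
proof -
  let ?T = "\<lambda>R. L2_norm (\<lambda>x. truncate R f x - f x)"
  let ?E = "\<lambda>g a. L2_norm (\<lambda>\<xi>. fourier_integral (truncate a f) \<xi> - g \<xi>)"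
  note T = truncate_L2[OF f] and FT = fourier_truncate_L2[OF f]
  have "\<exists>R. ?T R \<le> (1/2)^k / 2" for k :: nat
  proof -
    have "eventually (\<lambda>R. ?T R < (1/2)^k / 2) at_top"
      by (rule order_tendstoD(2)[OF L2_truncate_tendsto[OF f]]) simp
    from eventually_happens[OF this] show ?thesis by (auto intro: less_imp_le)
  qed
  then obtain R where R: "\<And>k. ?T (R k) \<le> (1/2)^k / 2" by metis
  have dist: "L2_norm (\<lambda>\<xi>. fourier_integral (truncate a f) \<xi> - fourier_integral (truncate b f) \<xi>) \<le> ?T a + ?T b" for a b
    using L2_norm_diff_triangle[OF T f T, of a b]
    unfolding fourier_truncate_dist[OF f] L2_norm_minus_commute[of f] .
  have "L2_norm (\<lambda>\<xi>. fourier_integral (truncate (R (Suc k)) f) \<xi> - fourier_integral (truncate (R k) f) \<xi>) \<le> (1/2)^k" for k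
  proof -
    have "?T (R (Suc k)) + ?T (R k) \<le> (1/2)^(Suc k) / 2 + (1/2)^k / 2"
      by (rule add_mono[OF R R])
    also have "\<dots> \<le> (1/2)^k" by simp
    finally show ?thesis using dist[of "R (Suc k)" "R k"] by linarith
  qed
  from L2_complete_rapid[OF FT this] obtain g where g: "g \<in> L2"
    and lim: "(\<lambda>k. ?E g (R k)) \<longlonglongrightarrow> 0"
    by (rule bexE)
  have "?E g a \<le> ?T a" for a
  proof (rule LIMSEQ_le_const)
    have "(\<lambda>k. (1/2::real)^k / 2) \<longlonglongrightarrow> 0 / 2"
      by (intro tendsto_divide tendsto_const LIMSEQ_realpow_zero) simp_all
    then show "(\<lambda>k. ?T a + (1/2)^k / 2 + ?E g (R k)) \<longlonglongrightarrow> ?T a"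
      using tendsto_add[OF tendsto_add[OF tendsto_const[of "?T a"]] lim, of "\<lambda>k. (1/2)^k / 2" 0] by simp
    have "?E g a
      \<le> ?T a + (1/2)^k / 2 + ?E g (R k)" for k
      using L2_norm_diff_triangle[OF FT FT g, of a "R k"] dist[of a "R k"] R[of k] by linarith
    then show "\<exists>N. \<forall>k\<ge>N. ?E g a
      \<le> ?T a + (1/2)^k / 2 + ?E g (R k)" by simp
  qed
  then have "((\<lambda>a. ?E g a) \<longlongrightarrow> 0) at_top"
    by (rule tendsto_zero_le[OF L2_truncate_tendsto[OF f] L2_norm_nonneg])
  from L2_fourier_I[OF f g this] show thesis by (rule that)
qed

lemma L2_fourier_diff:
  assumes "L2_fourier f F" "L2_fourier g G"
  shows "L2_fourier (\<lambda>x. f x - g x) (\<lambda>\<xi>. F \<xi> - G \<xi>)"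
proof -
  note f = L2_fourier_D[OF assms(1)] and g = L2_fourier_D[OF assms(2)]
  note fT = truncate_integrable[OF f(1)] and gT = truncate_integrable[OF g(1)]
  have eq: "fourier_integral (truncate R (\<lambda>x. f x - g x)) \<xi> - (F \<xi> - G \<xi>)
     = (fourier_integral (truncate R f) \<xi> - F \<xi>) - (fourier_integral (truncate R g) \<xi> - G \<xi>)" for R \<xi>
    unfolding right_diff_distrib fourier_integral_diff[OF fT gT] by simp
  show ?thesis
  proof (rule L2_fourier_I)
    have "((\<lambda>R. L2_norm (\<lambda>\<xi>. fourier_integral (truncate R f) \<xi> - F \<xi>)
        + L2_norm (\<lambda>\<xi>. fourier_integral (truncate R g) \<xi> - G \<xi>)) \<longlongrightarrow> 0) at_top"
      using tendsto_add[OF f(3) g(3)] by (simp only: add_0)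
    then show "((\<lambda>R. L2_norm (\<lambda>\<xi>. fourier_integral (truncate R (\<lambda>x. f x - g x)) \<xi> - (F \<xi> - G \<xi>))) \<longlongrightarrow> 0) at_top"
      unfolding eq
      by (rule tendsto_zero_le[OF _ L2_norm_nonneg])
         (rule L2_diff(2)[OF L2_diff(1)[OF fourier_truncate_L2[OF f(1)] f(2)] L2_diff(1)[OF fourier_truncate_L2[OF g(1)] g(2)]])
  qed (rule L2_diff(1)[OF f(1) g(1)] L2_diff(1)[OF f(2) g(2)])+
qed

lemma L2_fourier_cmult:
  assumes "L2_fourier f F"
  shows "L2_fourier (\<lambda>x. c * f x) (\<lambda>\<xi>. c * F \<xi>)"
proof -
  note f = L2_fourier_D[OF assms(1)]
  have eq: "fourier_integral (truncate R (\<lambda>x. c * f x)) \<xi> - c * F \<xi>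
     = c * (fourier_integral (truncate R f) \<xi> - F \<xi>)" for R \<xi>
    unfolding mult.left_commute[of _ c] fourier_integral_cmult right_diff_distrib ..
  show ?thesis
  proof (rule L2_fourier_I)
    show "((\<lambda>R. L2_norm (\<lambda>\<xi>. fourier_integral (truncate R (\<lambda>x. c * f x)) \<xi> - c * F \<xi>)) \<longlongrightarrow> 0) at_top"
      unfolding eq L2_cmult(2)[OF L2_diff(1)[OF fourier_truncate_L2[OF f(1)] f(2)]]
      by (rule tendsto_mult_right_zero[OF f(3)])
  qed (rule L2_cmult(1)[OF f(1)] L2_cmult(1)[OF f(2)])+
qed

lemma L2_fourier_add:
  assumes "L2_fourier f F" "L2_fourier g G"
  shows "L2_fourier (\<lambda>x. f x + g x) (\<lambda>\<xi>. F \<xi> + G \<xi>)"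
  using L2_fourier_diff[OF assms(1) L2_fourier_cmult[OF assms(2), of "-1"]] by simp

lemma L2_fourier_0: "L2_fourier (\<lambda>x. 0) (\<lambda>\<xi>. 0)"
  by (rule L2_fourier_I) (simp_all add: fourier_integral_def)

lemma L2_fourier_sum:
  assumes "finite I" "\<And>i. i \<in> I \<Longrightarrow> L2_fourier (f i) (F i)"
  shows "L2_fourier (\<lambda>x. \<Sum>i\<in>I. f i x) (\<lambda>\<xi>. \<Sum>i\<in>I. F i \<xi>)"
  using assms
proof (induction I rule: finite_induct)
  case empty
  show ?case unfolding sum.empty by (rule L2_fourier_0)
next
  case (insert i I)
  have "L2_fourier (\<lambda>x. f i x + (\<Sum>i\<in>I. f i x)) (\<lambda>\<xi>. F i \<xi> + (\<Sum>i\<in>I. F i \<xi>))"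
    by (rule L2_fourier_add[OF insert.prems insert.IH]) (use insert.prems in simp_all)
  then show ?case unfolding sum.insert[OF insert.hyps] .
qed

lemma L2_fourier_unique:
  assumes "L2_fourier f F" "L2_fourier f G"
  shows "AE \<xi> in lebesgue. F \<xi> = G \<xi>"
proof -
  have *: "L2_fourier (\<lambda>x. f x - f x) (\<lambda>\<xi>. F \<xi> - G \<xi>)" by (rule L2_fourier_diff[OF assms])
  have "L2_norm (\<lambda>\<xi>. F \<xi> - G \<xi>) = 0"
    using L2_fourier_isometry[OF *] by simp
  from L2_norm_eq_0_AE[OF L2_fourier_D(2)[OF *] this] show ?thesis by simp
qed

lemma L2_fourier_cong_AE:
  assumes "L2_fourier f F" "AE x in lebesgue. f x = g x" "AE \<xi> in lebesgue. F \<xi> = G \<xi>"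
  shows "L2_fourier g G"
proof -
  note D = L2_fourier_D[OF assms(1)]
  have g: "g \<in> L2" and G: "G \<in> L2" by (rule L2_cong_AE(1)[OF D(1) assms(2)], rule L2_cong_AE(1)[OF D(2) assms(3)])
  have "fourier_integral (truncate R f) = fourier_integral (truncate R g)" for R
    by (rule fourier_integral_cong_AE[OF L2_measurable[OF truncate_L2[OF D(1)]]])
       (use assms(2) in eventually_elim, simp)
  moreover have "L2_norm (\<lambda>\<xi>. h \<xi> - G \<xi>) = L2_norm (\<lambda>\<xi>. h \<xi> - F \<xi>)" if "h \<in> L2" for h
    by (rule L2_cong_AE(2)[OF L2_diff(1)[OF that D(2)]]) (use assms(3) in eventually_elim, simp)
  ultimately show ?thesis
    using D(3) fourier_truncate_L2[OF g] by (intro L2_fourier_I g G) simp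
qed

lemma L2_product_tendsto:
  assumes a: "\<And>R. a R \<in> L2" "A \<in> L2" "((\<lambda>R. L2_norm (\<lambda>x. a R x - A x)) \<longlongrightarrow> 0) F"
    and b: "\<And>R. b R \<in> L2" "B \<in> L2" "((\<lambda>R. L2_norm (\<lambda>x. b R x - B x)) \<longlongrightarrow> 0) F"
  shows "((\<lambda>R. LINT x|lebesgue. a R x * b R x) \<longlongrightarrow> (LINT x|lebesgue. A x * B x)) F"
proof -
  have "((\<lambda>R. cmod ((LINT x|lebesgue. a R x * b R x) - (LINT x|lebesgue. A x * B x))) \<longlongrightarrow> 0) F"
  proof (rule tendsto_zero_le)
    have "((\<lambda>R. L2_norm (\<lambda>x. a R x - A x) * L2_norm (b R) + L2_norm A * L2_norm (\<lambda>x. b R x - B x))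
       \<longlongrightarrow> 0 * L2_norm B + L2_norm A * 0) F"
      by (intro tendsto_add tendsto_mult tendsto_const a b L2_norm_tendsto[OF b])
    then show "((\<lambda>R. L2_norm (\<lambda>x. a R x - A x) * L2_norm (b R) + L2_norm A * L2_norm (\<lambda>x. b R x - B x)) \<longlongrightarrow> 0) F"
      by simp
    fix R
    note int = L2_mult_integrable
    have eq: "(LINT x|lebesgue. a R x * b R x) - (LINT x|lebesgue. A x * B x)
      = (LINT x|lebesgue. (a R x - A x) * b R x) + (LINT x|lebesgue. A x * (b R x - B x))"
      using Bochner_Integration.integral_diff[OF int[OF a(1) b(1)] int[OF a(2) b(1)], of R R R]
        Bochner_Integration.integral_diff[OF int[OF a(2) b(1)] int[OF a(2) b(2)], of R]
      by (simp add: left_diff_distrib right_diff_distrib)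
    show "cmod ((LINT x|lebesgue. a R x * b R x) - (LINT x|lebesgue. A x * B x))
      \<le> L2_norm (\<lambda>x. a R x - A x) * L2_norm (b R) + L2_norm A * L2_norm (\<lambda>x. b R x - B x)"
      unfolding eq using norm_triangle_ineq[of "LINT x|lebesgue. (a R x - A x) * b R x" "LINT x|lebesgue. A x * (b R x - B x)"]
        L2_Cauchy_Schwarz[OF L2_diff(1)[OF a(1,2)] b(1), of R R] L2_Cauchy_Schwarz[OF a(2) L2_diff(1)[OF b(1,2)], of R]
      by linarith
  qed simp
  then show ?thesis by (simp only: tendsto_norm_zero_iff LIM_zero_iff)
qed

lemma L2_fourier_multiplication_formula:
  assumes "L2_fourier f F" "L2_fourier g G"
  shows "(LINT \<xi>|lebesgue. F \<xi> * g \<xi>) = (LINT x|lebesgue. f x * G x)"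
proof (rule tendsto_unique[OF trivial_limit_at_top_linorder])
  note f = L2_fourier_D[OF assms(1)] and g = L2_fourier_D[OF assms(2)]
  show "((\<lambda>R. LINT \<xi>|lebesgue. fourier_integral (truncate R f) \<xi> * truncate R g \<xi>)
      \<longlongrightarrow> (LINT \<xi>|lebesgue. F \<xi> * g \<xi>)) at_top"
    by (rule L2_product_tendsto[OF fourier_truncate_L2[OF f(1)] f(2,3) truncate_L2[OF g(1)] g(1) L2_truncate_tendsto[OF g(1)]])
  show "((\<lambda>R. LINT \<xi>|lebesgue. fourier_integral (truncate R f) \<xi> * truncate R g \<xi>)
      \<longlongrightarrow> (LINT x|lebesgue. f x * G x)) at_top"
    unfolding fourier_integral_multiplication_formula[OF truncate_integrable[OF f(1)] truncate_integrable[OF g(1)]]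
    by (rule L2_product_tendsto[OF truncate_L2[OF f(1)] f(1) L2_truncate_tendsto[OF f(1)] fourier_truncate_L2[OF g(1)] g(2,3)])
qed

text \<open>Let \<open>k\<close> be the transform of the conjugate of \<open>g\<close>. The transform \<open>h\<close> of the conjugate of \<open>k\<close> has the
  norm of \<open>g\<close>, and by the multiplication formula the inner product of \<open>h\<close> and \<open>g\<close> is the square of
  that norm. Equality in the Cauchy--Schwarz inequality forces \<open>h = g\<close>.\<close>

lemma L2_fourier_surj:
  assumes g: "g \<in> L2"
  obtains f where "L2_fourier f g"
proof -
  obtain k where k: "L2_fourier (\<lambda>x. cnj (g x)) k" by (rule L2_fourier_exists[OF L2_cnj[OF g]])
  note kL = L2_fourier_D(2)[OF k]
  obtain h where h: "L2_fourier (\<lambda>x. cnj (k x)) h" by (rule L2_fourier_exists[OF L2_cnj[OF kL]])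
  note hL = L2_fourier_D(2)[OF h]
  have nk: "L2_norm k = L2_norm g" using L2_fourier_isometry[OF k] by (simp only: L2_norm_cnj)
  have nh: "L2_norm h = L2_norm g" using L2_fourier_isometry[OF h] by (simp only: L2_norm_cnj nk)
  have "(LINT \<xi>|lebesgue. h \<xi> * cnj (g \<xi>)) = (LINT x|lebesgue. cnj (k x) * k x)"
    by (rule L2_fourier_multiplication_formula[OF h k])
  also have "\<dots> = (LINT x|lebesgue. complex_of_real ((cmod (k x))\<^sup>2))"
    unfolding complex_norm_square by (simp only: mult.commute)
  also have "\<dots> = of_real ((L2_norm g)\<^sup>2)"
    unfolding nk[symmetric] L2_norm_square by (rule integral_complex_of_real)
  finally have "(L2_norm (\<lambda>\<xi>. h \<xi> - g \<xi>))\<^sup>2 = 0"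
    unfolding L2_norm_diff_square[OF hL g] nh by simp
  then have "L2_norm (\<lambda>\<xi>. h \<xi> - g \<xi>) = 0" by simp
  from L2_norm_eq_0_AE[OF L2_diff(1)[OF hL g] this]
  have "AE \<xi> in lebesgue. h \<xi> = g \<xi>" by simp
  from L2_fourier_cong_AE[OF h _ this] have "L2_fourier (\<lambda>x. cnj (k x)) g" by simp
  then show thesis by (rule that)
qed

lemma lebesgue_translation:
  fixes t :: "'a::euclidean_space"
  shows "(\<lambda>x. t + x) \<in> lebesgue \<rightarrow>\<^sub>M lebesgue" "distr lebesgue lebesgue (\<lambda>x. t + x) = lebesgue"
proof -
  have T: "t + (\<Sum>j\<in>Basis. (1 * (x \<bullet> j)) *\<^sub>R j) = t + x" for x
    by (simp add: euclidean_representation)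
  show "(\<lambda>x. t + x) \<in> lebesgue \<rightarrow>\<^sub>M lebesgue"
    using lebesgue_affine_measurable[of "\<lambda>_. 1" t] unfolding T by simp
  have "lebesgue = density (distr lebesgue lebesgue (\<lambda>x. t + x)) (\<lambda>_. 1)"
    using lebesgue_affine_euclidean[of "\<lambda>_. 1" t] unfolding T by simp
  then show "distr lebesgue lebesgue (\<lambda>x. t + x) = lebesgue" unfolding density_1 by (rule sym)
qed

lemma L2_translate:
  fixes g :: "'a::euclidean_space \<Rightarrow> complex"
  assumes g: "g \<in> L2"
  shows "(\<lambda>x. g (x - b)) \<in> L2" "L2_norm (\<lambda>x. g (x - b)) = L2_norm g"
proof -
  let ?T = "\<lambda>x. - b + x"
  note T = lebesgue_translation[of "- b"]
  have m: "(\<lambda>x. g (?T x)) \<in> borel_measurable lebesgue"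
    by (rule measurable_compose[OF T(1) L2_measurable[OF g]])
  have n: "(\<lambda>x. ennreal ((cmod (g x))\<^sup>2)) \<in> borel_measurable lebesgue"
    using L2_measurable[OF g] by measurable
  have "(\<integral>\<^sup>+ x. ennreal ((cmod (g (?T x)))\<^sup>2) \<partial>lebesgue) = (\<integral>\<^sup>+ x. ennreal ((cmod (g x))\<^sup>2) \<partial>distr lebesgue lebesgue ?T)"
    by (rule nn_integral_distr[symmetric, OF T(1)]) (use n in simp)
  then have eq: "(\<integral>\<^sup>+ x. ennreal ((cmod (g (?T x)))\<^sup>2) \<partial>lebesgue) = ennreal ((L2_norm g)\<^sup>2)"
    unfolding T(2) L2_norm_nn[OF g] .
  have L: "(\<lambda>x. g (?T x)) \<in> L2"
    by (rule L2_I_le(1)[OF m L2_norm_nonneg eq_refl[OF eq]])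
  have "(L2_norm (\<lambda>x. g (?T x)))\<^sup>2 = (L2_norm g)\<^sup>2"
    using eq unfolding L2_norm_nn[OF L] by (subst (asm) ennreal_inj) simp_all
  then have "L2_norm (\<lambda>x. g (?T x)) = L2_norm g"
    by (rule power2_eq_imp_eq) (rule L2_norm_nonneg)+
  with L show "(\<lambda>x. g (x - b)) \<in> L2" "L2_norm (\<lambda>x. g (x - b)) = L2_norm g"
    by (simp_all only: uminus_add_conv_diff)
qed

lemma L2_fourier_modulate:
  fixes f :: "'a::euclidean_space \<Rightarrow> complex"
  assumes "L2_fourier f F"
  shows "L2_fourier (\<lambda>x. exp (\<i> * of_real (b \<bullet> x)) * f x) (\<lambda>\<xi>. F (\<xi> - b))"
proof -
  note f = L2_fourier_D[OF assms]
  have em: "(\<lambda>x. exp (\<i> * of_real (b \<bullet> x))) \<in> borel_measurable lebesgue"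
    by (rule borel_measurable_lebesgueI) measurable
  have en: "cmod (exp (\<i> * of_real (b \<bullet> x))) = 1" for x by (rule norm_exp_i_times)
  have eq: "fourier_integral (truncate R (\<lambda>x. exp (\<i> * of_real (b \<bullet> x)) * f x)) \<xi>
      = fourier_integral (truncate R f) (\<xi> - b)" for R \<xi>
    unfolding fourier_integral_modulate[symmetric] by (simp only: mult.left_commute)
  show ?thesis
  proof (rule L2_fourier_I)
    show "(\<lambda>x. exp (\<i> * of_real (b \<bullet> x)) * f x) \<in> L2" by (rule L2_mult_unimodular(1)[OF f(1) em en])
    show "(\<lambda>\<xi>. F (\<xi> - b)) \<in> L2" by (rule L2_translate(1)[OF f(2)])
    have "L2_norm (\<lambda>\<xi>. fourier_integral (truncate R f) (\<xi> - b) - F (\<xi> - b))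
       = L2_norm (\<lambda>\<xi>. fourier_integral (truncate R f) \<xi> - F \<xi>)" for R
      by (rule L2_translate(2)[OF L2_diff(1)[OF fourier_truncate_L2[OF f(1)] f(2)]])
    then show "((\<lambda>R. L2_norm (\<lambda>\<xi>. fourier_integral (truncate R (\<lambda>x. exp (\<i> * of_real (b \<bullet> x)) * f x)) \<xi> - F (\<xi> - b))) \<longlongrightarrow> 0) at_top"
      unfolding eq using f(3) by (simp only:)
  qed
qed

section \<open>The propagator weighted with a regularised inverse velocity\<close>

text \<open>The mean value theorem produces the factor \<open>b\<^bsup>s-1\<^esup>\<close>; the additional factor \<open>b\<close> turns it into \<open>b\<^sup>s\<close>, which
  the denominator of the inverse velocity can absorb.\<close>

lemma powr_difference_le:
  fixes a b s :: real
  assumes s: "1 \<le> s" and a: "0 \<le> a" and ab: "a \<le> b"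
  shows "b * (b powr s - a powr s) \<le> s * b powr s * (b - a)"
proof -
  consider "a = b" | "a = 0" "a < b" | "0 < a" "a < b" using a ab by linarith
  then show ?thesis
  proof cases
    case 1
    then show ?thesis by simp
  next
    case 2
    have "1 * (b powr s * b) \<le> s * (b powr s * b)"
      by (rule mult_right_mono[OF s]) (use 2 in simp)
    with 2 show ?thesis by (simp add: mult_ac)
  next
    case 3
    have "\<exists>z>a. z < b \<and> b powr s - a powr s = (b - a) * (s * z powr (s - 1))"
    proof (rule MVT2[OF 3(2)])
      fix x assume "a \<le> x" "x \<le> b"
      then show "DERIV (\<lambda>x. x powr s) x :> s * x powr (s - 1)"
        using 3 by (intro has_real_derivative_powr) simp
    qed
    then obtain z where z: "a < z" "z < b" and eq: "b powr s - a powr s = (b - a) * (s * z powr (s - 1))"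
      by blast
    have "z powr (s - 1) \<le> b powr (s - 1)"
      by (rule powr_mono2) (use z 3 s in simp_all)
    then have "b * ((b - a) * (s * z powr (s - 1))) \<le> b * ((b - a) * (s * b powr (s - 1)))"
      using 3 s by (intro mult_left_mono) simp_all
    also have "\<dots> = s * (b * b powr (s - 1)) * (b - a)" by (simp only: mult_ac)
    also have "b * b powr (s - 1) = b powr s" using powr_mult_base[of b "s - 1"] 3 by simp
    finally show ?thesis unfolding eq .
  qed
qed

lemma norm_exp_i_diff_le: "cmod (exp (\<i> * of_real a) - exp (\<i> * of_real b)) \<le> \<bar>a - b\<bar>"
proof -
  have "exp (\<i> * of_real a) - exp (\<i> * of_real b) = exp (\<i> * of_real b) * (exp (\<i> * of_real (a - b)) - 1)"
    by (simp add: right_diff_distrib flip: exp_add)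
  then have "cmod (exp (\<i> * of_real a) - exp (\<i> * of_real b)) = cmod (exp (\<i> * of_real (a - b)) - 1)"
    by (simp only: norm_mult norm_exp_i_times mult_1)
  also have "\<dots> = 2 * \<bar>sin ((a - b) / 2)\<bar>" by (rule dist_exp_i_1)
  also have "\<dots> \<le> \<bar>a - b\<bar>" using abs_sin_x_le_abs_x[of "(a - b) / 2"] by simp
  finally show ?thesis .
qed

definition propagator :: "real \<Rightarrow> real \<Rightarrow> 'a::euclidean_space \<Rightarrow> complex" where
  "propagator s \<tau> \<xi> = exp (- \<i> * of_real (\<tau> * norm \<xi> powr s))"

text \<open>The components of \<open>\<xi>/(D + |\<xi>|\<^sup>s)\<close>. For \<open>D = 0\<close> this field is \<open>s v/|v|\<^sup>2\<close> with the group velocity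
  \<open>v = s|\<xi>|\<^bsup>s-2\<^esup>\<xi>\<close>; a positive \<open>D\<close> removes the singularity at the origin.\<close>

definition inv_velocity :: "real \<Rightarrow> real \<Rightarrow> 'a::euclidean_space \<Rightarrow> 'a \<Rightarrow> real" where
  "inv_velocity s D j \<xi> = (\<xi> \<bullet> j) / (D + norm \<xi> powr s)"

definition weighted_propagator :: "real \<Rightarrow> real \<Rightarrow> real \<Rightarrow> 'a::euclidean_space \<Rightarrow> 'a \<Rightarrow> complex" where
  "weighted_propagator s \<tau> D j \<xi> = propagator s \<tau> \<xi> * of_real (inv_velocity s D j \<xi>)"

lemma propagator_alt: "propagator s \<tau> \<xi> = exp (\<i> * of_real (- (\<tau> * norm \<xi> powr s)))"
  by (simp add: propagator_def)

lemma norm_propagator [simp]: "cmod (propagator s \<tau> \<xi>) = 1"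
  unfolding propagator_alt by (rule norm_exp_i_times)

lemma propagator_measurable: "propagator s \<tau> \<in> borel_measurable lebesgue"
  unfolding propagator_def by (rule borel_measurable_lebesgueI) measurable

lemma weighted_propagator_measurable: "weighted_propagator s \<tau> D j \<in> borel_measurable lebesgue"
  unfolding weighted_propagator_def propagator_def inv_velocity_def
  by (rule borel_measurable_lebesgueI) measurable

text \<open>The weight vanishes at the origin, where the phase has a kink if \<open>s = 1\<close>, and behaves like the
  reciprocal of the group velocity at infinity, which compensates the growth of the gradient of the phase.
  For both effects the weight has to be evaluated at the point of larger norm in the term that contains
  the difference of the phases.\<close>

lemma weighted_propagator_lipschitz:
  fixes \<xi> \<zeta> j :: "'a::euclidean_space"
  assumes s: "1 \<le> s" and D: "0 < D" and \<tau>: "0 \<le> \<tau>" and j: "j \<in> Basis"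
  shows "cmod (weighted_propagator s \<tau> D j \<zeta> - weighted_propagator s \<tau> D j \<xi>)
    \<le> (\<tau> * s + (1 + s) / D) * norm (\<zeta> - \<xi>)"
proof -
  have *: "cmod (weighted_propagator s \<tau> D j \<zeta> - weighted_propagator s \<tau> D j \<xi>)
    \<le> (\<tau> * s + (1 + s) / D) * norm (\<zeta> - \<xi>)" if le: "norm \<xi> \<le> norm \<zeta>" for \<xi> \<zeta> :: 'a
  proof -
    define A B d where "A = norm \<xi> powr s" and "B = norm \<zeta> powr s" and "d = norm (\<zeta> - \<xi>)"
    have A0: "0 \<le> A" and B0: "0 \<le> B" by (simp_all add: A_def B_def)
    have AB: "A \<le> B" unfolding A_def B_def by (rule powr_mono2) (use s le in simp_all)
    have dn: "norm \<zeta> - norm \<xi> \<le> d" unfolding d_def by (rule norm_triangle_ineq2)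
    have key: "norm \<zeta> * (B - A) \<le> s * B * d"
    proof -
      have "norm \<zeta> * (B - A) \<le> s * B * (norm \<zeta> - norm \<xi>)"
        unfolding A_def B_def by (rule powr_difference_le[OF s norm_ge_zero le])
      also have "\<dots> \<le> s * B * d" using dn s B0 by (intro mult_left_mono) simp_all
      finally show ?thesis .
    qed
    have frac: "B / (D + B) \<le> 1" using D B0 by simp
    have d0: "0 \<le> d" by (simp add: d_def)
    have coord: "\<bar>x \<bullet> j\<bar> \<le> norm x" for x :: 'a using Basis_le_norm[OF j] .
    have quot: "norm \<zeta> * (B - A) / (D + B) \<le> s * d"
    proof -
      have "norm \<zeta> * (B - A) / (D + B) \<le> s * B * d / (D + B)"
        using key D B0 by (intro divide_right_mono) simp_all
      also have "\<dots> = s * d * (B / (D + B))" by simp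
      also have "\<dots> \<le> s * d * 1" using frac s d0 by (intro mult_left_mono) simp_all
      finally show ?thesis by simp
    qed
    have phase: "cmod (propagator s \<tau> \<zeta> - propagator s \<tau> \<xi>) \<le> \<tau> * (B - A)"
    proof -
      have "cmod (propagator s \<tau> \<zeta> - propagator s \<tau> \<xi>) \<le> \<bar>- (\<tau> * B) - - (\<tau> * A)\<bar>"
        unfolding propagator_alt A_def B_def by (rule norm_exp_i_diff_le)
      also have "\<bar>- (\<tau> * B) - - (\<tau> * A)\<bar> = \<bar>\<tau> * (B - A)\<bar>"
        unfolding abs_minus_commute[of "- (\<tau> * B)"] by (simp add: right_diff_distrib abs_minus_commute)
      also have "\<dots> = \<tau> * (B - A)" using \<tau> AB by simp
      finally show ?thesis .
    qed
    have m\<zeta>: "\<bar>inv_velocity s D j \<zeta>\<bar> \<le> norm \<zeta> / (D + B)"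
      unfolding inv_velocity_def B_def[symmetric] abs_divide
      using D B0 coord[of \<zeta>] by (simp add: divide_right_mono)
    have term1: "cmod ((propagator s \<tau> \<zeta> - propagator s \<tau> \<xi>) * of_real (inv_velocity s D j \<zeta>)) \<le> \<tau> * s * d"
    proof -
      have "cmod ((propagator s \<tau> \<zeta> - propagator s \<tau> \<xi>) * of_real (inv_velocity s D j \<zeta>))
          \<le> \<tau> * (B - A) * (norm \<zeta> / (D + B))"
        unfolding norm_mult norm_of_real using phase m\<zeta> \<tau> AB by (intro mult_mono) simp_all
      also have "\<dots> = \<tau> * (norm \<zeta> * (B - A) / (D + B))" by simp
      also have "\<dots> \<le> \<tau> * (s * d)" by (rule mult_left_mono[OF quot \<tau>])
      finally show ?thesis by simp
    qed
    have "inv_velocity s D j \<zeta> - inv_velocity s D j \<xi>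
        = ((\<zeta> - \<xi>) \<bullet> j) / (D + A) - (\<zeta> \<bullet> j) * (B - A) / (D + B) / (D + A)"
    proof -
      have fd: "x / b - y / a = (x - y) / a - x * (b - a) / b / a" if "a \<noteq> 0" "b \<noteq> 0" for x y a b :: real
        using that by (simp add: field_simps)
      have BA: "B - A = (D + B) - (D + A)" by simp
      have nz: "D + A \<noteq> 0" "D + B \<noteq> 0" using D A0 B0 by linarith+
      show ?thesis
        unfolding inv_velocity_def A_def[symmetric] B_def[symmetric] inner_diff_left BA
        by (rule fd[OF nz])
    qed
    also have "\<bar>\<dots>\<bar> \<le> d / D + s * d / D"
    proof -
      have "\<bar>((\<zeta> - \<xi>) \<bullet> j) / (D + A)\<bar> \<le> d / D"
        unfolding abs_divide d_def using D A0 coord[of "\<zeta> - \<xi>"] by (intro frac_le) simp_all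
      moreover have "\<bar>(\<zeta> \<bullet> j) * (B - A) / (D + B) / (D + A)\<bar> \<le> s * d / D"
      proof -
        have "\<bar>(\<zeta> \<bullet> j) * (B - A) / (D + B)\<bar> \<le> norm \<zeta> * (B - A) / (D + B)"
          unfolding abs_divide abs_mult using D B0 AB coord[of \<zeta>]
          by (simp add: divide_right_mono mult_right_mono)
        then have "\<bar>(\<zeta> \<bullet> j) * (B - A) / (D + B)\<bar> \<le> s * d" using quot by linarith
        then show ?thesis
          unfolding abs_divide[of _ "D + A"] using D A0 s d0 by (intro frac_le) simp_all
      qed
      ultimately show ?thesis by linarith
    qed
    finally have term2: "cmod (propagator s \<tau> \<xi> * of_real (inv_velocity s D j \<zeta> - inv_velocity s D j \<xi>)) \<le> d / D + s * d / D"
      by (simp only: norm_mult norm_propagator norm_of_real mult_1)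
    have "weighted_propagator s \<tau> D j \<zeta> - weighted_propagator s \<tau> D j \<xi>
      = (propagator s \<tau> \<zeta> - propagator s \<tau> \<xi>) * of_real (inv_velocity s D j \<zeta>)
        + propagator s \<tau> \<xi> * of_real (inv_velocity s D j \<zeta> - inv_velocity s D j \<xi>)"
      by (simp add: weighted_propagator_def algebra_simps)
    then have "cmod (weighted_propagator s \<tau> D j \<zeta> - weighted_propagator s \<tau> D j \<xi>) \<le> \<tau> * s * d + (d / D + s * d / D)"
      using norm_triangle_le[OF add_mono[OF term1 term2]] by (simp only:)
    also have "\<dots> = (\<tau> * s + (1 + s) / D) * d" using D by (simp add: field_simps)
    finally show ?thesis unfolding d_def .
  qed
  show ?thesis
  proof (cases "norm \<xi> \<le> norm \<zeta>")
    case True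
    then show ?thesis by (rule *)
  next
    case False
    then show ?thesis using *[of \<zeta> \<xi>] by (simp add: norm_minus_commute)
  qed
qed

lemma inv_velocity_bound:
  fixes \<xi> j :: "'a::euclidean_space"
  assumes s: "1 \<le> s" and D: "0 < D" and R: "0 < R" and j: "j \<in> Basis"
  shows "\<bar>inv_velocity s D j \<xi>\<bar> \<le> R / D + R powr (1 - s)"
proof -
  have A0: "0 \<le> norm \<xi> powr s" by simp
  have "\<bar>inv_velocity s D j \<xi>\<bar> \<le> norm \<xi> / (D + norm \<xi> powr s)"
    unfolding inv_velocity_def abs_divide
    using D A0 Basis_le_norm[OF j, of \<xi>] by (simp add: divide_right_mono)
  also have "\<dots> \<le> R / D + R powr (1 - s)"
  proof (cases "norm \<xi> \<le> R")
    case True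
    have "norm \<xi> / (D + norm \<xi> powr s) \<le> R / D"
      using True D A0 R by (intro frac_le) simp_all
    then show ?thesis by (simp add: add_increasing2)
  next
    case False
    have p: "0 < norm \<xi>" using False R by linarith
    have "norm \<xi> / (D + norm \<xi> powr s) \<le> norm \<xi> / norm \<xi> powr s"
      using D p by (intro divide_left_mono mult_pos_pos add_pos_pos) simp_all
    also have "\<dots> = norm \<xi> powr (1 - s)" using p by (simp add: powr_diff)
    also have "\<dots> \<le> R powr (1 - s)" using False R s by (intro powr_mono2') simp_all
    finally show ?thesis using R D by (simp add: add_increasing)
  qed
  finally show ?thesis .
qed

text \<open>Off the origin, the divergence of the vector field formed by the weighted propagators
  consists of a main term carrying the factor \<open>\<tau>\<close> and a remainder that is bounded independently of \<open>\<tau>\<close>.\<close>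

definition symbol_remainder :: "real \<Rightarrow> real \<Rightarrow> 'a::euclidean_space \<Rightarrow> real" where
  "symbol_remainder s D \<xi> =
     s * norm \<xi> powr s / (D + norm \<xi> powr s)\<^sup>2 - real DIM('a) / (D + norm \<xi> powr s)"

lemma symbol_remainder_bound:
  fixes \<xi> :: "'a::euclidean_space"
  assumes s: "1 \<le> s" and D: "0 < D"
  shows "\<bar>symbol_remainder s D \<xi>\<bar> \<le> (real DIM('a) + s) / D"
proof -
  let ?A = "norm \<xi> powr s"
  have A0: "0 \<le> ?A" by simp
  have frac: "?A / (D + ?A) \<le> 1" by (subst divide_le_eq_1_pos) (use D A0 in linarith)+
  have s1: "s / (D + ?A) \<le> s / D" using D A0 s by (intro frac_le) simp_all
  have "s * ?A / (D + ?A)\<^sup>2 = s / (D + ?A) * (?A / (D + ?A))" by (simp add: power2_eq_square)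
  also have "\<dots> \<le> s / D * 1"
    using D A0 s by (intro mult_mono s1 frac) simp_all
  finally have 1: "s * ?A / (D + ?A)\<^sup>2 \<le> s / D" by simp
  have 2: "real DIM('a) / (D + ?A) \<le> real DIM('a) / D"
    using D A0 by (intro frac_le) simp_all
  have "0 \<le> s * ?A / (D + ?A)\<^sup>2" "0 \<le> real DIM('a) / (D + ?A)" using s D A0 by simp_all
  with 1 2 have "\<bar>symbol_remainder s D \<xi>\<bar> \<le> s / D + real DIM('a) / D"
    unfolding symbol_remainder_def by linarith
  then show ?thesis by (simp add: add_divide_distrib add.commute)
qed

lemma has_vector_derivative_sequence:
  fixes q :: "real \<Rightarrow> complex"
  assumes q: "(q has_vector_derivative d) (at 0)"
  shows "(\<lambda>k. (q (inverse (real (Suc k))) - q 0) / of_real (inverse (real (Suc k)))) \<longlonglongrightarrow> d"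
proof -
  have lim: "((\<lambda>h. norm (q (0 + h) - q 0 - h *\<^sub>R d) / norm h) \<longlongrightarrow> 0) (at 0)"
    using q unfolding has_vector_derivative_def has_derivative_at by (rule conjunct2)
  have "filterlim (\<lambda>k. inverse (real (Suc k))) (at 0) sequentially"
    by (rule filterlim_atI[OF LIMSEQ_inverse_real_of_nat]) simp
  from filterlim_compose[OF lim this]
  have "(\<lambda>k. norm (q (0 + inverse (real (Suc k))) - q 0 - inverse (real (Suc k)) *\<^sub>R d) / norm (inverse (real (Suc k)))) \<longlonglongrightarrow> 0" .
  moreover have "norm (q (0 + h) - q 0 - h *\<^sub>R d) / norm h = norm ((q h - q 0) / of_real h - d)" if "h > 0" for h :: real
  proof -
    have "(q h - q 0) / of_real h - d = (q (0 + h) - q 0 - h *\<^sub>R d) / of_real h"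
      using that by (simp add: diff_divide_distrib scaleR_conv_of_real)
    then show ?thesis by (simp only: norm_divide norm_of_real real_norm_def)
  qed
  ultimately have "(\<lambda>k. norm ((q (inverse (real (Suc k))) - q 0) / of_real (inverse (real (Suc k))) - d)) \<longlonglongrightarrow> 0"
    by simp
  then show ?thesis by (simp only: tendsto_norm_zero_iff LIM_zero_iff)
qed

text \<open>Along a line, \<open>|\<xi> - tj|\<^sup>2\<close> is a quadratic polynomial in \<open>t\<close> that is positive at \<open>0\<close>, and \<open>|\<xi> - tj|\<^sup>s\<close> is a
  real power of it.\<close>

lemma weighted_propagator_derivative:
  fixes \<xi> j :: "'a::euclidean_space" and s \<tau> :: real
  assumes D: "0 < D" and x0: "\<xi> \<noteq> 0" and j: "j \<in> Basis"
  defines "A \<equiv> norm \<xi> powr s" and "c \<equiv> - s * norm \<xi> powr (s - 2)"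
  shows "((\<lambda>t. weighted_propagator s \<tau> D j (\<xi> - t *\<^sub>R j)) has_vector_derivative
    propagator s \<tau> \<xi> * (- \<i> * of_real (\<tau> * c * (\<xi> \<bullet> j)\<^sup>2 / (D + A))
       - of_real (1 / (D + A) + c * (\<xi> \<bullet> j)\<^sup>2 / (D + A)\<^sup>2))) (at 0)"
proof -
  define N where "N t = (norm \<xi>)\<^sup>2 - 2 * t * (\<xi> \<bullet> j) + t\<^sup>2" for t
  have N: "(norm (\<xi> - t *\<^sub>R j))\<^sup>2 = N t" for t
    unfolding N_def power2_norm_eq_inner
    using inner_Basis[OF j j] by (simp add: inner_diff_left inner_diff_right inner_commute power2_eq_square algebra_simps)
  have np: "norm x powr p = ((norm x)\<^sup>2) powr (p / 2)" for x :: 'a and p :: real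
    by (simp add: powr_powr flip: powr_numeral)
  define a where "a t = N t powr (s / 2)" for t
  have a: "norm (\<xi> - t *\<^sub>R j) powr s = a t" for t
    unfolding np[of _ s] N a_def ..
  have N0: "N 0 = (norm \<xi>)\<^sup>2" by (simp add: N_def)
  have a0: "a 0 = A" using a[of 0] by (simp add: A_def)
  have pos: "D + a 0 \<noteq> 0" using D by (simp add: a_def add_pos_nonneg less_imp_neq[symmetric])
  have dN: "(N has_real_derivative - 2 * (\<xi> \<bullet> j)) (at 0)"
    unfolding N_def by (auto intro!: derivative_eq_intros)
  have da: "(a has_real_derivative c * (\<xi> \<bullet> j)) (at 0)"
  proof -
    have "((\<lambda>z. z powr (s / 2)) has_real_derivative (s / 2) * N 0 powr (s / 2 - 1)) (at (N 0))"
      by (rule has_real_derivative_powr) (use x0 in \<open>simp add: N0\<close>)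
    from DERIV_chain2[OF this dN]
    have "(a has_real_derivative (s / 2) * N 0 powr (s / 2 - 1) * (- 2 * (\<xi> \<bullet> j))) (at 0)"
      unfolding a_def .
    moreover have "N 0 powr (s / 2 - 1) = norm \<xi> powr (s - 2)"
      unfolding N0 np[of \<xi> "s - 2"] by (simp add: diff_divide_distrib)
    moreover have "s / 2 * norm \<xi> powr (s - 2) * (- 2 * (\<xi> \<bullet> j)) = c * (\<xi> \<bullet> j)" by (simp add: c_def)
    ultimately show ?thesis by (simp only:)
  qed
  define S where "S t = (\<xi> \<bullet> j - t) / (D + a t)" for t
  have dS: "(S has_real_derivative - (1 / (D + A) + c * (\<xi> \<bullet> j)\<^sup>2 / (D + A)\<^sup>2)) (at 0)"
  proof -
    have "(S has_real_derivative ((0 - 1) * (D + a 0) - (\<xi> \<bullet> j - 0) * (0 + c * (\<xi> \<bullet> j))) / ((D + a 0) * (D + a 0))) (at 0)"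
      unfolding S_def
      by (rule DERIV_divide[OF DERIV_diff[OF DERIV_const DERIV_ident] DERIV_add[OF DERIV_const da] pos])
    also have "((0 - 1) * (D + a 0) - (\<xi> \<bullet> j - 0) * (0 + c * (\<xi> \<bullet> j))) / ((D + a 0) * (D + a 0))
      = - (1 / (D + A) + c * (\<xi> \<bullet> j)\<^sup>2 / (D + A)\<^sup>2)"
    proof -
      have "((0 - 1) * B - (x - 0) * (0 + c * x)) / (B * B) = - (1 / B + c * x\<^sup>2 / B\<^sup>2)"
        if "B \<noteq> 0" for B x :: real
        using that by (simp add: field_simps power2_eq_square)
      from this[OF pos] show ?thesis unfolding a0 .
    qed
    finally show ?thesis .
  qed
  define E where "E t = exp (- \<i> * of_real (\<tau> * a t))" for t
  have dE: "(E has_vector_derivative (- \<i> * of_real (\<tau> * (c * (\<xi> \<bullet> j)))) * E 0) (at 0)"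
  proof -
    have "((\<lambda>t. - \<i> * complex_of_real (\<tau> * a t)) has_vector_derivative - \<i> * of_real (\<tau> * (c * (\<xi> \<bullet> j)))) (at 0)"
      by (rule has_vector_derivative_mult_right[OF has_vector_derivative_of_real[OF DERIV_cmult[OF da]]])
    from field_vector_diff_chain_at[OF this DERIV_exp]
    show ?thesis unfolding E_def o_def .
  qed
  have w: "weighted_propagator s \<tau> D j (\<xi> - t *\<^sub>R j) = E t * of_real (S t)" for t
    using j by (simp add: weighted_propagator_def propagator_def inv_velocity_def a E_def S_def inner_diff_left)
  have "((\<lambda>t. E t * of_real (S t)) has_vector_derivative
      E 0 * of_real (- (1 / (D + A) + c * (\<xi> \<bullet> j)\<^sup>2 / (D + A)\<^sup>2))
      + (- \<i> * of_real (\<tau> * (c * (\<xi> \<bullet> j)))) * E 0 * of_real (S 0)) (at 0)"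
    by (rule has_vector_derivative_mult[OF dE has_vector_derivative_of_real[OF dS]])
  also have "E 0 * of_real (- (1 / (D + A) + c * (\<xi> \<bullet> j)\<^sup>2 / (D + A)\<^sup>2))
      + (- \<i> * of_real (\<tau> * (c * (\<xi> \<bullet> j)))) * E 0 * of_real (S 0)
      = E 0 * (- \<i> * of_real (\<tau> * (c * (\<xi> \<bullet> j)) * S 0) - of_real (1 / (D + A) + c * (\<xi> \<bullet> j)\<^sup>2 / (D + A)\<^sup>2))"
    by (simp add: algebra_simps)
  also have "\<tau> * (c * (\<xi> \<bullet> j)) * S 0 = \<tau> * c * (\<xi> \<bullet> j)\<^sup>2 / (D + A)"
    by (simp add: S_def a0 power2_eq_square)
  also have "E 0 = propagator s \<tau> \<xi>" by (simp add: E_def a0 A_def propagator_def)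
  finally show ?thesis unfolding w .
qed

lemma weighted_propagator_divergence:
  fixes \<xi> :: "'a::euclidean_space"
  assumes D: "0 < D" and x0: "\<xi> \<noteq> 0"
  shows "(\<lambda>k. \<Sum>j\<in>Basis. (weighted_propagator s \<tau> D j (\<xi> - inverse (real (Suc k)) *\<^sub>R j)
        - weighted_propagator s \<tau> D j \<xi>) / of_real (inverse (real (Suc k))))
    \<longlonglongrightarrow> propagator s \<tau> \<xi> * (\<i> * of_real (\<tau> * s * (norm \<xi> powr s / (D + norm \<xi> powr s)))
         + of_real (symbol_remainder s D \<xi>))"
proof -
  define A c where "A = norm \<xi> powr s" and "c = - s * norm \<xi> powr (s - 2)"
  let ?d = "\<lambda>j. propagator s \<tau> \<xi> * (- \<i> * of_real (\<tau> * c * (\<xi> \<bullet> j)\<^sup>2 / (D + A))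
       - of_real (1 / (D + A) + c * (\<xi> \<bullet> j)\<^sup>2 / (D + A)\<^sup>2))"
  have sq: "(\<Sum>j\<in>Basis. (\<xi> \<bullet> j)\<^sup>2) = (norm \<xi>)\<^sup>2"
    unfolding power2_norm_eq_inner by (subst (2) euclidean_inner) (simp only: power2_eq_square)
  have csq: "c * (norm \<xi>)\<^sup>2 = - s * A"
  proof -
    have "norm \<xi> powr (s - 2) * (norm \<xi>)\<^sup>2 = norm \<xi> powr (s - 2) * norm \<xi> powr 2"
      by (simp add: powr_numeral)
    also have "\<dots> = A" unfolding A_def powr_add[symmetric] by simp
    finally show ?thesis by (simp add: c_def)
  qed
  have "(\<lambda>k. \<Sum>j\<in>Basis. (weighted_propagator s \<tau> D j (\<xi> - inverse (real (Suc k)) *\<^sub>R j)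
        - weighted_propagator s \<tau> D j (\<xi> - 0 *\<^sub>R j)) / of_real (inverse (real (Suc k))))
    \<longlonglongrightarrow> (\<Sum>j\<in>Basis. ?d j)"
    unfolding A_def c_def
    by (rule tendsto_sum, rule has_vector_derivative_sequence, rule weighted_propagator_derivative[OF D x0])
  also have "(\<Sum>j\<in>Basis. ?d j) = propagator s \<tau> \<xi> *
      (- \<i> * of_real (\<tau> * (c * (\<Sum>j\<in>Basis. (\<xi> \<bullet> j)\<^sup>2)) / (D + A))
       - of_real (real DIM('a) / (D + A) + c * (\<Sum>j\<in>Basis. (\<xi> \<bullet> j)\<^sup>2) / (D + A)\<^sup>2))"
  proof -
    have "(\<Sum>j\<in>Basis. p * (z * of_real (x j) - of_real (y j)))
       = p * (z * of_real (\<Sum>j\<in>Basis. x j) - of_real (\<Sum>j\<in>Basis. y j))"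
      for p z :: complex and x y :: "'a \<Rightarrow> real"
      by (simp only: of_real_sum sum_distrib_left sum_subtractf right_diff_distrib)
    moreover have "(\<Sum>j\<in>Basis. \<tau> * c * (\<xi> \<bullet> j)\<^sup>2 / (D + A)) = \<tau> * (c * (\<Sum>j\<in>Basis. (\<xi> \<bullet> j)\<^sup>2)) / (D + A)"
      by (simp only: sum_distrib_left sum_divide_distrib mult.assoc)
    moreover have "(\<Sum>j\<in>Basis. 1 / (D + A) + c * (\<xi> \<bullet> j)\<^sup>2 / (D + A)\<^sup>2)
        = real DIM('a) / (D + A) + c * (\<Sum>j\<in>Basis. (\<xi> \<bullet> j)\<^sup>2) / (D + A)\<^sup>2"
      by (simp add: sum.distrib sum_distrib_left sum_divide_distrib)
    ultimately show ?thesis by (simp only:)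
  qed
  also have "\<dots> = propagator s \<tau> \<xi> * (\<i> * of_real (\<tau> * s * (A / (D + A))) + of_real (symbol_remainder s D \<xi>))"
    unfolding sq csq symbol_remainder_def A_def[symmetric] by (simp add: algebra_simps)
  finally show ?thesis unfolding A_def scaleR_zero_left diff_zero .
qed

section \<open>Localised states leave the ball of the minimal velocity\<close>

lemma modulation_difference_le:
  fixes x j :: "'a::euclidean_space"
  assumes \<eta>: "0 < \<eta>" and j: "j \<in> Basis"
  shows "cmod (inverse (of_real \<eta>) * (exp (\<i> * of_real ((\<eta> *\<^sub>R j) \<bullet> x)) * z - z)) \<le> norm x * cmod z"
proof -
  let ?a = "(\<eta> *\<^sub>R j) \<bullet> x"
  have "exp (\<i> * of_real ?a) * z - z = (exp (\<i> * of_real ?a) - exp (\<i> * of_real 0)) * z"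
    by (simp add: left_diff_distrib)
  then have "cmod (inverse (of_real \<eta>) * (exp (\<i> * of_real ?a) * z - z))
      = inverse \<eta> * (cmod (exp (\<i> * of_real ?a) - exp (\<i> * of_real 0)) * cmod z)"
    using \<eta> by (simp only: norm_mult norm_inverse norm_of_real abs_of_pos)
  also have "\<dots> \<le> inverse \<eta> * (\<bar>?a - 0\<bar> * cmod z)"
    using \<eta> by (intro mult_left_mono mult_right_mono norm_exp_i_diff_le) simp_all
  also have "\<dots> = \<bar>x \<bullet> j\<bar> * cmod z"
    using \<eta> by (simp add: abs_mult inner_commute)
  also have "\<dots> \<le> norm x * cmod z"
    by (rule mult_right_mono[OF Basis_le_norm[OF j] norm_ge_zero])
  finally show ?thesis .
qed

text \<open>The factor \<open>\<phi> = |\<xi>|\<^sup>s/(D + |\<xi>|\<^sup>s)\<close> selects the frequencies that move. Up to terms bounded independently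
  of \<open>\<tau>\<close>, the multiple \<open>\<i>\<tau>s \<phi>\<close> of the propagator is the divergence of the weighted propagators. Its product with
  \<open>h\<close> differs from the divergence of the products by weighted propagators times derivatives of \<open>h\<close>, which have norm at
  most \<open>r\<parallel>f\<parallel>\<close> as \<open>f\<close> lives in the ball of radius \<open>r\<close>. The inverse transform of that divergence is a sum of coordinates
  times functions of norm at most \<open>M\<parallel>f\<parallel>\<close>, and on the ball of radius \<open>\<rho>\<close> the coordinates are at most \<open>\<rho>\<close>.\<close>

lemma fast_part_local_bound:
  fixes f h v :: "'a::euclidean_space \<Rightarrow> complex"
  assumes s: "1 \<le> s" and D: "0 < D" and \<tau>: "0 < \<tau>" and r: "0 \<le> r" and \<rho>: "0 \<le> \<rho>"
    and M: "\<And>j \<xi>::'a. j \<in> Basis \<Longrightarrow> \<bar>inv_velocity s D j \<xi>\<bar> \<le> M"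
    and fh: "L2_fourier f h" and supp: "\<And>x. r \<le> norm x \<Longrightarrow> f x = 0"
    and v: "L2_fourier v (\<lambda>\<xi>. propagator s \<tau> \<xi> * of_real (norm \<xi> powr s / (D + norm \<xi> powr s)) * h \<xi>)"
  shows "\<tau> * s * L2_norm (\<lambda>x. indicator (ball 0 \<rho>) x * v x)
    \<le> (real DIM('a) * (\<rho> * M) + (real DIM('a) + s) / D + real DIM('a) * (M * r)) * L2_norm f"
proof -
  let ?n = "real DIM('a)"
  define \<eta> where "\<eta> k = inverse (real (Suc k))" for k
  define W where "W = (weighted_propagator s \<tau> D :: 'a \<Rightarrow> 'a \<Rightarrow> complex)"
  define L where "L = \<tau> * s + (1 + s) / D"
  define P where "P \<xi> = propagator s \<tau> \<xi> * (\<i> * of_real (\<tau> * s * (norm \<xi> powr s / (D + norm \<xi> powr s)))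
      + of_real (symbol_remainder s D \<xi>))" for \<xi> :: 'a
  define Q where "Q k \<xi> = (\<Sum>j\<in>Basis. (W j (\<xi> - \<eta> k *\<^sub>R j) - W j \<xi>) / of_real (\<eta> k))" for k and \<xi> :: 'a
  note fL = L2_fourier_D(1)[OF fh] and hL = L2_fourier_D(2)[OF fh]
  note vL = L2_fourier_D(1)[OF v]
  have hf: "L2_norm h = L2_norm f" by (rule L2_fourier_isometry[OF fh])
  have \<eta>: "0 < \<eta> k" for k by (simp add: \<eta>_def)
  have \<eta>0: "complex_of_real (\<eta> k) \<noteq> 0" for k using \<eta>[of k] by simp
  have M0: "0 \<le> M" using M[OF SOME_Basis, of 0] abs_ge_zero order_trans by blast
  have Wm: "W j \<in> borel_measurable lebesgue" for j
    unfolding W_def by (rule weighted_propagator_measurable)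
  have Wb: "cmod (W j \<xi>) \<le> M" if "j \<in> Basis" for j \<xi>
    unfolding W_def weighted_propagator_def norm_mult norm_propagator norm_of_real mult_1 by (rule M[OF that])
  define K where "K j \<xi> = W j \<xi> * h \<xi>" for j \<xi>
  have K: "K j \<in> L2" "L2_norm (K j) \<le> M * L2_norm f" if "j \<in> Basis" for j
    unfolding K_def hf[symmetric] by (rule L2_mult_bounded[OF hL Wm Wb[OF that]])+
  have "\<exists>G. L2_fourier G (K j)" if "j \<in> Basis" for j
    using L2_fourier_surj[OF K(1)[OF that]] by blast
  then obtain G where G: "\<And>j. j \<in> Basis \<Longrightarrow> L2_fourier (G j) (K j)" by metis
  have GL: "G j \<in> L2" "L2_norm (G j) \<le> M * L2_norm f" if "j \<in> Basis" for j
    using L2_fourier_D(1)[OF G[OF that]] L2_fourier_isometry[OF G[OF that]] K(2)[OF that] by simp_all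

  \<comment> \<open>A difference quotient in \<open>\<xi>\<close> is the transform of a multiple by \<open>(e\<^bsup>\<i>\<eta>x\<^sub>j\<^esup> - 1)/\<eta>\<close>, which is at most \<open>|x|\<close>
    for every step \<open>\<eta>\<close>. This controls the products \<open>K\<close> on the ball of radius \<open>\<rho>\<close> and \<open>h\<close> itself.\<close>
  define X where "X k j x = inverse (of_real (\<eta> k)) * (exp (\<i> * of_real ((\<eta> k *\<^sub>R j) \<bullet> x)) * G j x - G j x)" for k j x
  define dK where "dK k j \<xi> = inverse (of_real (\<eta> k)) * (K j (\<xi> - \<eta> k *\<^sub>R j) - K j \<xi>)" for k j \<xi>
  define dh where "dh k j \<xi> = inverse (of_real (\<eta> k)) * (h (\<xi> - \<eta> k *\<^sub>R j) - h \<xi>)" for k j \<xi>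
  have X: "L2_fourier (X k j) (dK k j)" if "j \<in> Basis" for k j
    unfolding X_def dK_def
    by (rule L2_fourier_cmult[OF L2_fourier_diff[OF L2_fourier_modulate[OF G[OF that]] G[OF that]]])
  note XL = L2_fourier_D(1)[OF X]
  have XB: "L2_norm (\<lambda>x. indicator (ball 0 \<rho>) x * X k j x) \<le> \<rho> * (M * L2_norm f)" if j: "j \<in> Basis" for k j
  proof -
    have "L2_norm (\<lambda>x. indicator (ball 0 \<rho>) x * X k j x) \<le> \<rho> * L2_norm (G j)"
    proof (rule L2_bounded_by(2)[OF GL(1)[OF j] _ \<rho>])
      show "(\<lambda>x. indicator (ball 0 \<rho>) x * X k j x) \<in> borel_measurable lebesgue"
        by (rule L2_measurable[OF L2_indicator_mult(1)[OF XL[OF j]]]) simp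
      show "AE x in lebesgue. cmod (indicator (ball 0 \<rho>) x * X k j x) \<le> \<rho> * cmod (G j x)"
      proof (rule AE_I2)
        fix x :: 'a
        show "cmod (indicator (ball 0 \<rho>) x * X k j x) \<le> \<rho> * cmod (G j x)"
        proof (cases "norm x < \<rho>")
          case True
          have "cmod (X k j x) \<le> norm x * cmod (G j x)"
            unfolding X_def by (rule modulation_difference_le[OF \<eta> j])
          also have "\<dots> \<le> \<rho> * cmod (G j x)" using True by (intro mult_right_mono) simp_all
          finally show ?thesis using True by simp
        next
          case False
          then show ?thesis using \<rho> by simp
        qed
      qed
    qed
    also have "\<dots> \<le> \<rho> * (M * L2_norm f)" by (rule mult_left_mono[OF GL(2)[OF j] \<rho>])
    finally show ?thesis .
  qed
  have dhL: "dh k j \<in> L2" "L2_norm (dh k j) \<le> r * L2_norm f" if j: "j \<in> Basis" for k j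
  proof -
    let ?g = "\<lambda>x. inverse (of_real (\<eta> k)) * (exp (\<i> * of_real ((\<eta> k *\<^sub>R j) \<bullet> x)) * f x - f x)"
    have g: "L2_fourier ?g (dh k j)"
      unfolding dh_def by (rule L2_fourier_cmult[OF L2_fourier_diff[OF L2_fourier_modulate[OF fh] fh]])
    show "dh k j \<in> L2" by (rule L2_fourier_D(2)[OF g])
    have "L2_norm ?g \<le> r * L2_norm f"
    proof (rule L2_bounded_by(2)[OF fL L2_measurable[OF L2_fourier_D(1)[OF g]] r], rule AE_I2)
      fix x :: 'a
      show "cmod (?g x) \<le> r * cmod (f x)"
      proof (cases "r \<le> norm x")
        case True
        then show ?thesis using supp[OF True] by simp
      next
        case False
        have "cmod (?g x) \<le> norm x * cmod (f x)" by (rule modulation_difference_le[OF \<eta> j])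
        also have "\<dots> \<le> r * cmod (f x)" using False by (intro mult_right_mono) simp_all
        finally show ?thesis .
      qed
    qed
    then show "L2_norm (dh k j) \<le> r * L2_norm f" unfolding L2_fourier_isometry[OF g] .
  qed

  have Qm: "Q k \<in> borel_measurable lebesgue" for k
    unfolding Q_def W_def weighted_propagator_def propagator_def inv_velocity_def
    by (rule borel_measurable_lebesgueI) measurable
  have Pm: "P \<in> borel_measurable lebesgue"
    unfolding P_def propagator_def symbol_remainder_def
    by (rule borel_measurable_lebesgueI) measurable
  have Qb: "cmod (Q k \<xi>) \<le> ?n * L" for k \<xi>
  proof -
    have "cmod (Q k \<xi>) \<le> (\<Sum>j\<in>(Basis::'a set). L)"
      unfolding Q_def
    proof (rule sum_norm_le)
      fix j :: 'a assume j: "j \<in> Basis"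
      have "cmod (W j (\<xi> - \<eta> k *\<^sub>R j) - W j \<xi>) \<le> L * norm ((\<xi> - \<eta> k *\<^sub>R j) - \<xi>)"
        unfolding W_def L_def by (rule weighted_propagator_lipschitz[OF s D less_imp_le[OF \<tau>] j])
      also have "norm ((\<xi> - \<eta> k *\<^sub>R j) - \<xi>) = \<eta> k" using \<eta>[of k] j by simp
      finally show "cmod ((W j (\<xi> - \<eta> k *\<^sub>R j) - W j \<xi>) / of_real (\<eta> k)) \<le> L"
        using \<eta>[of k] by (simp add: norm_divide pos_divide_le_eq)
    qed
    then show ?thesis by simp
  qed
  have L0: "0 \<le> ?n * L" using s D \<tau> by (simp add: L_def)
  define B where "B \<xi> = of_real (?n * L) * h \<xi>" for \<xi>
  have BL: "B \<in> L2" unfolding B_def by (rule L2_cmult(1)[OF hL])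
  have QhL: "(\<lambda>\<xi>. Q k \<xi> * h \<xi>) \<in> L2" for k by (rule L2_mult_bounded(1)[OF hL Qm Qb])
  \<comment> \<open>The quotients \<open>Q k\<close> of the weighted propagators converge to their divergence \<open>P\<close> off the origin and are
    bounded by the Lipschitz constant, which may depend on \<open>\<tau>\<close>: it only serves to pass to the limit.\<close>
  have bd: "AE \<xi> in lebesgue. cmod (Q k \<xi> * h \<xi>) \<le> cmod (B \<xi>)" for k
    by (rule AE_I2) (use Qb[of k] L0 in \<open>simp only: B_def norm_mult norm_of_real abs_of_nonneg mult_right_mono norm_ge_zero\<close>)
  have "AE \<xi> in lebesgue. \<xi> \<noteq> (0::'a)" by (rule AE_completion[OF AE_lborel_singleton])
  then have conv: "AE \<xi> in lebesgue. (\<lambda>k. Q k \<xi> * h \<xi>) \<longlonglongrightarrow> P \<xi> * h \<xi>"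
  proof eventually_elim
    case (elim \<xi>)
    have "(\<lambda>k. Q k \<xi>) \<longlonglongrightarrow> P \<xi>"
      unfolding Q_def P_def W_def \<eta>_def by (rule weighted_propagator_divergence[OF D elim])
    then show ?case by (rule tendsto_mult[OF _ tendsto_const])
  qed
  have Phm: "(\<lambda>\<xi>. P \<xi> * h \<xi>) \<in> borel_measurable lebesgue"
    by (rule borel_measurable_times[OF Pm L2_measurable[OF hL]])
  note PhL = L2_dominated_convergence(1)[OF BL L2_measurable[OF QhL] Phm bd conv]
    and lim = L2_dominated_convergence(2)[OF BL L2_measurable[OF QhL] Phm bd conv]

  define Rm where "Rm \<xi> = propagator s \<tau> \<xi> * of_real (symbol_remainder s D \<xi>) * h \<xi>" for \<xi>
  have Rm: "Rm \<in> L2" "L2_norm Rm \<le> (?n + s) / D * L2_norm f"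
  proof -
    have m: "(\<lambda>\<xi>::'a. propagator s \<tau> \<xi> * of_real (symbol_remainder s D \<xi>)) \<in> borel_measurable lebesgue"
      unfolding propagator_def symbol_remainder_def by (rule borel_measurable_lebesgueI) measurable
    have b: "cmod (propagator s \<tau> \<xi> * of_real (symbol_remainder s D \<xi>)) \<le> (?n + s) / D" for \<xi> :: 'a
      unfolding norm_mult norm_propagator norm_of_real mult_1 by (rule symbol_remainder_bound[OF s D])
    show "Rm \<in> L2" "L2_norm Rm \<le> (?n + s) / D * L2_norm f"
      unfolding Rm_def hf[symmetric] by (rule L2_mult_bounded[OF hL m b])+
  qed
  define Y where "Y k j \<xi> = W j (\<xi> - \<eta> k *\<^sub>R j) * dh k j \<xi>" for k j \<xi>
  have Y: "Y k j \<in> L2" "L2_norm (Y k j) \<le> M * (r * L2_norm f)" if j: "j \<in> Basis" for k j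
  proof -
    have m: "(\<lambda>\<xi>. W j (\<xi> - \<eta> k *\<^sub>R j)) \<in> borel_measurable lebesgue"
      unfolding W_def weighted_propagator_def propagator_def inv_velocity_def
      by (rule borel_measurable_lebesgueI) measurable
    show "Y k j \<in> L2" unfolding Y_def by (rule L2_mult_bounded(1)[OF dhL(1)[OF j] m Wb[OF j]])
    have "L2_norm (Y k j) \<le> M * L2_norm (dh k j)"
      unfolding Y_def by (rule L2_mult_bounded(2)[OF dhL(1)[OF j] m Wb[OF j]])
    also have "\<dots> \<le> M * (r * L2_norm f)" by (rule mult_left_mono[OF dhL(2)[OF j] M0])
    finally show "L2_norm (Y k j) \<le> M * (r * L2_norm f)" .
  qed

  \<comment> \<open>The discrete product rule: the difference quotients of \<open>K\<close> are \<open>Q k\<close> times \<open>h\<close> plus shifted weighted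
    propagators times the difference quotients of \<open>h\<close>.\<close>
  define c where "c = \<i> * complex_of_real (\<tau> * s)"
  have cn: "cmod c = \<tau> * s" using \<tau> s by (simp add: c_def norm_mult)
  define V where "V \<xi> = propagator s \<tau> \<xi> * of_real (norm \<xi> powr s / (D + norm \<xi> powr s)) * h \<xi>" for \<xi>
  define S where "S k x = (\<Sum>j\<in>Basis. X k j x)" for k x
  have SL: "L2_fourier (S k) (\<lambda>\<xi>. \<Sum>j\<in>Basis. dK k j \<xi>)" for k
    unfolding S_def by (rule L2_fourier_sum[OF finite_Basis X])
  have diff: "L2_fourier (\<lambda>x. c * v x - S k x) (\<lambda>\<xi>. c * V \<xi> - (\<Sum>j\<in>Basis. dK k j \<xi>))" for k
    unfolding V_def by (rule L2_fourier_diff[OF L2_fourier_cmult[OF v] SL])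
  have id: "c * V \<xi> - (\<Sum>j\<in>Basis. dK k j \<xi>) = (P \<xi> * h \<xi> - Q k \<xi> * h \<xi>) - Rm \<xi> - (\<Sum>j\<in>Basis. Y k j \<xi>)" for k \<xi>
  proof -
    have "dK k j \<xi> = (W j (\<xi> - \<eta> k *\<^sub>R j) - W j \<xi>) / of_real (\<eta> k) * h \<xi> + Y k j \<xi>" for j
      using \<eta>0[of k] by (simp add: dK_def K_def Y_def dh_def divide_inverse algebra_simps)
    then have "(\<Sum>j\<in>Basis. dK k j \<xi>) = Q k \<xi> * h \<xi> + (\<Sum>j\<in>Basis. Y k j \<xi>)"
      by (simp only: sum.distrib Q_def sum_distrib_right)
    moreover have "c * V \<xi> = P \<xi> * h \<xi> - Rm \<xi>"
      by (simp add: c_def V_def P_def Rm_def algebra_simps)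
    ultimately show ?thesis by simp
  qed
  have Yn: "L2_norm (\<lambda>\<xi>. \<Sum>j\<in>Basis. Y k j \<xi>) \<le> ?n * (M * (r * L2_norm f))" for k
  proof -
    have "L2_norm (\<lambda>\<xi>. \<Sum>j\<in>Basis. Y k j \<xi>) \<le> (\<Sum>j\<in>Basis. L2_norm (Y k j))"
      by (rule L2_sum(2)[OF finite_Basis Y(1)])
    also have "\<dots> \<le> (\<Sum>j\<in>(Basis::'a set). M * (r * L2_norm f))" by (rule sum_mono[OF Y(2)])
    finally show ?thesis by simp
  qed
  have Sn: "L2_norm (\<lambda>x. indicator (ball 0 \<rho>) x * S k x) \<le> ?n * (\<rho> * (M * L2_norm f))" for k
  proof -
    have "L2_norm (\<lambda>x. \<Sum>j\<in>Basis. indicator (ball 0 \<rho>) x * X k j x)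
        \<le> (\<Sum>j\<in>Basis. L2_norm (\<lambda>x. indicator (ball 0 \<rho>) x * X k j x))"
      by (rule L2_sum(2)[OF finite_Basis]) (rule L2_indicator_mult(1)[OF XL], simp_all)
    also have "\<dots> \<le> (\<Sum>j\<in>(Basis::'a set). \<rho> * (M * L2_norm f))" by (rule sum_mono[OF XB])
    finally show ?thesis by (simp add: S_def sum_distrib_left)
  qed
  let ?Z = "\<lambda>k. L2_norm (\<lambda>\<xi>. Q k \<xi> * h \<xi> - P \<xi> * h \<xi>)"
  have main: "\<tau> * s * L2_norm (\<lambda>x. indicator (ball 0 \<rho>) x * v x)
      \<le> ?n * (\<rho> * (M * L2_norm f)) + ((?n + s) / D * L2_norm f + ?n * (M * (r * L2_norm f))) + ?Z k" for k
  proof -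
    let ?I = "\<lambda>g x. indicator (ball 0 \<rho>) x * g x :: complex"
    have IL: "?I g \<in> L2" "L2_norm (?I g) \<le> L2_norm g" if "g \<in> L2" for g :: "'a \<Rightarrow> complex"
      by (rule L2_indicator_mult[OF that], simp)+
    note sL = L2_fourier_D(1)[OF SL[of k]] and dL = L2_fourier_D(1)[OF diff[of k]]
    note cvL = L2_cmult(1)[OF vL, of c]
    have "\<tau> * s * L2_norm (?I v) = L2_norm (\<lambda>x. c * ?I v x)"
      unfolding L2_cmult(2)[OF IL(1)[OF vL]] cn ..
    also have "(\<lambda>x. c * ?I v x) = ?I (\<lambda>x. c * v x)" by (simp only: mult.left_commute)
    also have "L2_norm (?I (\<lambda>x. c * v x)) \<le> L2_norm (?I (S k)) + L2_norm (\<lambda>x. ?I (\<lambda>x. c * v x) x - ?I (S k) x)"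
      by (rule L2_norm_le_diff[OF IL(1)[OF cvL] IL(1)[OF sL]])
    also have "(\<lambda>x. ?I (\<lambda>x. c * v x) x - ?I (S k) x) = ?I (\<lambda>x. c * v x - S k x)"
      by (simp only: right_diff_distrib)
    also have "L2_norm (?I (\<lambda>x. c * v x - S k x)) \<le> L2_norm (\<lambda>x. c * v x - S k x)"
      by (rule IL(2)[OF dL])
    also have "L2_norm (\<lambda>x. c * v x - S k x) = L2_norm (\<lambda>\<xi>. (P \<xi> * h \<xi> - Q k \<xi> * h \<xi>) - Rm \<xi> - (\<Sum>j\<in>Basis. Y k j \<xi>))"
      unfolding L2_fourier_isometry[OF diff, symmetric] id ..
    also have "\<dots> \<le> L2_norm (\<lambda>\<xi>. P \<xi> * h \<xi> - Q k \<xi> * h \<xi>) + L2_norm Rm + L2_norm (\<lambda>\<xi>. \<Sum>j\<in>Basis. Y k j \<xi>)"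
    proof -
      note 1 = L2_diff[OF PhL QhL[of k]]
      note 2 = L2_diff[OF 1(1) Rm(1)]
      have "(\<lambda>\<xi>. \<Sum>j\<in>Basis. Y k j \<xi>) \<in> L2" by (rule L2_sum(1)[OF finite_Basis Y(1)])
      note 3 = L2_diff(2)[OF 2(1) this]
      show ?thesis using 2(2) 3 by linarith
    qed
    also have "L2_norm (\<lambda>\<xi>. P \<xi> * h \<xi> - Q k \<xi> * h \<xi>) = ?Z k" by (rule L2_norm_minus_commute)
    finally show ?thesis using Sn[of k] Rm(2) Yn[of k] by linarith
  qed
  have "\<tau> * s * L2_norm (\<lambda>x. indicator (ball 0 \<rho>) x * v x)
      \<le> ?n * (\<rho> * (M * L2_norm f)) + ((?n + s) / D * L2_norm f + ?n * (M * (r * L2_norm f))) + 0"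
    by (rule LIMSEQ_le_const[OF tendsto_add[OF tendsto_const lim]]) (use main in blast)
  also have "\<dots> = (?n * (\<rho> * M) + (?n + s) / D + ?n * (M * r)) * L2_norm f"
    by (simp add: distrib_right mult.assoc)
  finally show ?thesis .
qed

lemma compact_support_transform_bounded:
  fixes f h :: "'a::euclidean_space \<Rightarrow> complex"
  assumes fh: "L2_fourier f h" and supp: "\<And>x. r \<le> norm x \<Longrightarrow> f x = 0"
  shows "AE \<xi> in lebesgue. cmod (h \<xi>)
    \<le> fourier_const TYPE('a) * (sqrt (measure lebesgue (cball (0::'a) r)) * L2_norm f)"
proof -
  note fL = L2_fourier_D(1)[OF fh]
  have tr: "truncate R f = f" if "r \<le> R" for R
  proof
    fix x
    show "truncate R f x = f x" using supp[of x] that by (cases "norm x \<le> R") auto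
  qed
  have fi: "integrable lebesgue f" using truncate_integrable[OF fL, of r] unfolding tr[OF order_refl] .
  have FL: "fourier_integral f \<in> L2" by (rule fourier_integral_isometry(1)[OF fi fL])
  have "L2_fourier f (fourier_integral f)"
  proof (rule L2_fourier_I[OF fL FL], rule tendsto_eventually)
    show "eventually (\<lambda>R. L2_norm (\<lambda>\<xi>. fourier_integral (truncate R f) \<xi> - fourier_integral f \<xi>) = 0) at_top"
      using eventually_ge_at_top[of r] by eventually_elim (simp add: tr)
  qed
  from L2_fourier_unique[OF fh this] have eq: "AE \<xi> in lebesgue. h \<xi> = fourier_integral f \<xi>" .
  define g where "g x = complex_of_real (cmod (f x))" for x
  have gm: "g \<in> borel_measurable lebesgue" unfolding g_def using L2_measurable[OF fL] by measurable
  have gL: "g \<in> L2" "L2_norm g \<le> 1 * L2_norm f"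
    using L2_bounded_by[OF fL gm, of 1] by (simp_all add: g_def)
  have "(LINT x|lebesgue. (1 * indicator (cball 0 r) x) * g x) = (LINT x|lebesgue. g x)"
  proof (rule Bochner_Integration.integral_cong[OF refl])
    fix x
    show "(1 * indicator (cball 0 r) x) * g x = g x"
      using supp[of x] by (cases "norm x \<le> r") (auto simp: g_def)
  qed
  also have "\<dots> = of_real (LINT x|lebesgue. cmod (f x))" unfolding g_def by (rule integral_complex_of_real)
  finally have "cmod (of_real (LINT x|lebesgue. cmod (f x)))
      \<le> L2_norm (\<lambda>x::'a. 1 * indicator (cball 0 r) x) * L2_norm g"
    using L2_Cauchy_Schwarz[OF L2_indicator_cball(1)[of 1 r] gL(1)] by (simp only:)
  also have "L2_norm (\<lambda>x::'a. 1 * indicator (cball 0 r) x) = sqrt (measure lebesgue (cball (0::'a) r))"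
    using L2_indicator_cball(2)[where 'a = 'a, of r] real_sqrt_unique L2_norm_nonneg
    by (metis (no_types, lifting) mult_1 ext)
  also have "\<dots> * L2_norm g \<le> sqrt (measure lebesgue (cball (0::'a) r)) * L2_norm f"
    using gL(2) by (intro mult_left_mono) simp_all
  finally have int: "(LINT x|lebesgue. cmod (f x)) \<le> sqrt (measure lebesgue (cball (0::'a) r)) * L2_norm f"
    by (simp only: norm_of_real)
  have "cmod (fourier_integral f \<xi>) \<le> fourier_const TYPE('a) * (sqrt (measure lebesgue (cball (0::'a) r)) * L2_norm f)" for \<xi>
    by (rule order_trans[OF fourier_integral_bounded[OF fi] mult_left_mono[OF int powr_ge_zero]])
  then show ?thesis using eq by (auto elim: eventually_mono)
qed

text \<open>The uncertainty principle. On the ball of radius \<open>\<kappa>/r\<close> the transform is bounded pointwise, and the product of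
  the volumes of the balls of radii \<open>r\<close> and \<open>\<kappa>/r\<close> does not depend on \<open>r\<close>; outside, the factor in front of
  \<open>h\<close> is at most \<open>\<delta>/\<kappa>\<^sup>s\<close>.\<close>

lemma slow_part_bound:
  fixes f h :: "'a::euclidean_space \<Rightarrow> complex"
  assumes fh: "L2_fourier f h" and supp: "\<And>x. r \<le> norm x \<Longrightarrow> f x = 0"
    and r: "0 < r" and \<kappa>: "0 < \<kappa>" and \<delta>: "0 < \<delta>" and s: "1 \<le> s"
  defines "D \<equiv> \<delta> * r powr (- s)"
  shows "(\<lambda>\<xi>. of_real (D / (D + norm \<xi> powr s)) * h \<xi>) \<in> L2" (is "?w \<in> L2")
    and "L2_norm (\<lambda>\<xi>. of_real (D / (D + norm \<xi> powr s)) * h \<xi>)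
      \<le> (fourier_const TYPE('a) * unit_ball_vol (real DIM('a)) * sqrt (\<kappa> ^ DIM('a)) + \<delta> / \<kappa> powr s) * L2_norm f"
proof -
  note hL = L2_fourier_D(2)[OF fh]
  have D: "0 < D" using \<delta> r by (simp add: D_def)
  define b where "b = fourier_const TYPE('a) * (sqrt (measure lebesgue (cball (0::'a) r)) * L2_norm f)"
  have b0: "0 \<le> b" by (simp add: b_def)
  have hb: "AE \<xi> in lebesgue. cmod (h \<xi>) \<le> b"
    unfolding b_def by (rule compact_support_transform_bounded[OF fh supp])
  define k where "k = \<kappa> / r"
  have k: "0 < k" using \<kappa> r by (simp add: k_def)
  let ?m = "\<lambda>\<xi>::'a. complex_of_real (D / (D + norm \<xi> powr s))"
  have mm: "?m \<in> borel_measurable lebesgue" by (rule borel_measurable_lebesgueI) measurable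
  have frac: "0 \<le> D / (D + norm \<xi> powr s)" "D / (D + norm \<xi> powr s) \<le> 1" for \<xi> :: 'a
  proof -
    have "0 \<le> norm \<xi> powr s" by simp
    then show "0 \<le> D / (D + norm \<xi> powr s)" "D / (D + norm \<xi> powr s) \<le> 1"
      using D by (simp_all only: divide_nonneg_nonneg add_nonneg_nonneg less_imp_le divide_le_eq_1_pos add_pos_nonneg le_add_same_cancel1)
  qed
  have m1: "cmod (?m \<xi>) \<le> 1" for \<xi>
    unfolding norm_of_real using frac by (simp only: abs_of_nonneg)
  show wL: "?w \<in> L2" by (rule L2_mult_bounded(1)[OF hL mm m1])
  define lo where "lo = (\<lambda>\<xi>. indicator (cball 0 k) \<xi> * ?w \<xi>)"
  have loL: "lo \<in> L2" unfolding lo_def by (rule L2_indicator_mult(1)[OF wL]) simp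
  have lo: "L2_norm lo \<le> b * L2_norm (\<lambda>\<xi>::'a. 1 * indicator (cball 0 k) \<xi>)"
  proof (rule L2_bounded_by(2)[OF L2_indicator_cball(1) L2_measurable[OF loL] b0])
    show "AE \<xi> in lebesgue. cmod (lo \<xi>) \<le> b * cmod (1 * indicator (cball 0 k) \<xi>)"
      using hb
    proof eventually_elim
      case (elim \<xi>)
      have "cmod (?w \<xi>) \<le> 1 * cmod (h \<xi>)"
        unfolding norm_mult by (rule mult_right_mono[OF m1 norm_ge_zero])
      then have "cmod (?w \<xi>) \<le> b" using elim by simp
      then show ?case by (cases "\<xi> \<in> cball 0 k") (simp_all add: lo_def)
    qed
  qed
  have vol: "L2_norm (\<lambda>\<xi>::'a. 1 * indicator (cball 0 k) \<xi>) = sqrt (measure lebesgue (cball (0::'a) k))"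
    using L2_indicator_cball(2)[where 'a = 'a, of k] real_sqrt_unique L2_norm_nonneg
    by (metis (no_types, lifting) mult_1 ext)
  have ball: "measure lebesgue (cball (0::'a) a) = unit_ball_vol (real DIM('a)) * a ^ DIM('a)" if "0 \<le> a" for a
    using content_cball[OF that, of "0::'a"] by simp
  have U0: "0 \<le> unit_ball_vol (real DIM('a))" by simp
  have "sqrt (measure lebesgue (cball (0::'a) r)) * sqrt (measure lebesgue (cball (0::'a) k))
      = unit_ball_vol (real DIM('a)) * sqrt (\<kappa> ^ DIM('a))"
  proof -
    have "measure lebesgue (cball (0::'a) r) * measure lebesgue (cball (0::'a) k)
      = (unit_ball_vol (real DIM('a)))\<^sup>2 * (r * k) ^ DIM('a)"
      unfolding ball[OF less_imp_le[OF r]] ball[OF less_imp_le[OF k]]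
      by (simp add: power_mult_distrib power2_eq_square)
    also have "r * k = \<kappa>" using r by (simp add: k_def)
    finally show ?thesis
      by (simp only: real_sqrt_mult[symmetric]) (simp only: real_sqrt_mult real_sqrt_abs abs_of_nonneg[OF U0])
  qed
  then have lo': "L2_norm lo \<le> fourier_const TYPE('a) * unit_ball_vol (real DIM('a)) * sqrt (\<kappa> ^ DIM('a)) * L2_norm f"
    using lo unfolding vol b_def by (metis mult.assoc mult.commute mult.left_commute)
  have rest: "L2_norm (\<lambda>\<xi>. ?w \<xi> - lo \<xi>) \<le> D / k powr s * L2_norm h"
  proof (rule L2_bounded_by(2)[OF hL L2_measurable[OF L2_diff(1)[OF wL loL]]])
    show "0 \<le> D / k powr s" using D by simp
    show "AE \<xi> in lebesgue. cmod (?w \<xi> - lo \<xi>) \<le> D / k powr s * cmod (h \<xi>)"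
    proof (rule AE_I2)
      fix \<xi> :: 'a
      show "cmod (?w \<xi> - lo \<xi>) \<le> D / k powr s * cmod (h \<xi>)"
      proof (cases "norm \<xi> \<le> k")
        case True
        then show ?thesis using D by (simp add: lo_def)
      next
        case False
        have kp: "0 < k powr s" using k by simp
        have "k powr s \<le> norm \<xi> powr s" by (rule powr_mono2) (use False k s in simp_all)
        then have "D / (D + norm \<xi> powr s) \<le> D / k powr s"
          using D kp by (intro divide_left_mono mult_pos_pos) linarith+
        then have "cmod (?m \<xi>) \<le> D / k powr s"
          unfolding norm_of_real using frac(1)[of \<xi>] by (simp only: abs_of_nonneg)
        then have "cmod (?w \<xi>) \<le> D / k powr s * cmod (h \<xi>)"
          unfolding norm_mult by (rule mult_right_mono[OF _ norm_ge_zero])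
        moreover have "lo \<xi> = 0" using False by (simp add: lo_def)
        ultimately show ?thesis by simp
      qed
    qed
  qed
  have "D / k powr s = \<delta> / \<kappa> powr s"
    using r \<kappa> by (simp add: D_def k_def powr_divide powr_minus field_simps)
  then have rest': "L2_norm (\<lambda>\<xi>. ?w \<xi> - lo \<xi>) \<le> \<delta> / \<kappa> powr s * L2_norm f"
    using rest unfolding L2_fourier_isometry[OF fh] by (simp only:)
  have "L2_norm ?w \<le> L2_norm lo + L2_norm (\<lambda>\<xi>. ?w \<xi> - lo \<xi>)"
    by (rule L2_norm_le_diff[OF wL loL])
  then show "L2_norm ?w \<le> (fourier_const TYPE('a) * unit_ball_vol (real DIM('a)) * sqrt (\<kappa> ^ DIM('a)) + \<delta> / \<kappa> powr s) * L2_norm f"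
    unfolding distrib_right using lo' rest' by linarith
qed

text \<open>The constants are chosen in the order \<open>\<kappa>\<close>, \<open>\<delta>\<close>, then \<open>\<sigma>\<close> and \<open>T0\<close>: the first two bound the slow part by
  \<open>\<parallel>f\<parallel>/8\<close> and the last two the fast part by \<open>\<parallel>f\<parallel>/4\<close>. They are independent of \<open>r\<close> because
  \<open>D = \<delta>r\<^bsup>-s\<^esup>\<close> and \<open>\<rho> = \<sigma>\<tau>/r\<^bsup>s-1\<^esup>\<close> scale as a power of a frequency and as a length.\<close>

lemma localised_state_escapes:
  fixes s :: real
  assumes s: "1 \<le> s"
  obtains \<sigma> T0 :: real where "0 < \<sigma>" "0 < T0"
    and "\<And>r \<tau> (f :: 'a::euclidean_space \<Rightarrow> complex) h v. 0 < r \<Longrightarrow> r powr s * T0 < \<tau> \<Longrightarrow>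
      L2_fourier f h \<Longrightarrow> (\<And>x. r \<le> norm x \<Longrightarrow> f x = 0) \<Longrightarrow>
      L2_fourier v (\<lambda>\<xi>. propagator s \<tau> \<xi> * h \<xi>) \<Longrightarrow>
      L2_norm (\<lambda>x. indicator (ball 0 (\<sigma> * \<tau> / r powr (s - 1))) x * v x) \<le> 1/2 * L2_norm f"
proof -
  let ?n = "real DIM('a)"
  define a where "a = fourier_const TYPE('a) * unit_ball_vol ?n"
  have a: "0 < a" unfolding a_def by (rule mult_pos_pos) simp_all
  define \<kappa> where "\<kappa> = min 1 ((1 / (16 * a))\<^sup>2)"
  have \<kappa>: "0 < \<kappa>" "\<kappa> \<le> 1" "\<kappa> \<le> (1 / (16 * a))\<^sup>2" using a by (simp_all add: \<kappa>_def)
  define \<delta> where "\<delta> = \<kappa> powr s / 16"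
  have \<delta>: "0 < \<delta>" using \<kappa> by (simp add: \<delta>_def)
  have small: "a * sqrt (\<kappa> ^ DIM('a)) + \<delta> / \<kappa> powr s \<le> 1/8"
  proof -
    have "\<kappa> ^ DIM('a) \<le> \<kappa> ^ 1" using \<kappa> by (intro power_decreasing) (simp_all add: Suc_leI)
    then have "\<kappa> ^ DIM('a) \<le> (1 / (16 * a))\<^sup>2" using \<kappa>(3) by simp
    then have "sqrt (\<kappa> ^ DIM('a)) \<le> sqrt ((1 / (16 * a))\<^sup>2)" by (rule real_sqrt_le_mono)
    also have "\<dots> = 1 / (16 * a)" using a by simp
    finally have "a * sqrt (\<kappa> ^ DIM('a)) \<le> a * (1 / (16 * a))" by (rule mult_left_mono) (use a in simp)
    moreover have "a * (1 / (16 * a)) = 1/16" using a by simp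
    moreover have "\<delta> / \<kappa> powr s = 1/16" using \<kappa> by (simp add: \<delta>_def)
    ultimately show ?thesis by simp
  qed
  define m where "m = 1 / \<delta> + 1"
  have m: "0 < m" using \<delta> by (simp add: m_def add_pos_pos)
  have n: "0 < ?n" by simp
  define \<sigma> where "\<sigma> = 1 / (8 * (?n * m))"
  define b where "b = (?n + s) / \<delta> + ?n * m"
  have b: "0 < b" using n m \<delta> s by (simp add: b_def add_pos_pos)
  define T0 where "T0 = 8 * b"
  have pos: "0 < \<sigma>" "0 < T0" using n m b by (simp_all add: \<sigma>_def T0_def)
  show thesis
  proof (rule that[OF pos])
    fix r \<tau> :: real and f h v :: "'a \<Rightarrow> complex"
    assume r: "0 < r" and rt: "r powr s * T0 < \<tau>" and fh: "L2_fourier f h"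
      and supp: "\<And>x. r \<le> norm x \<Longrightarrow> f x = 0"
      and v: "L2_fourier v (\<lambda>\<xi>. propagator s \<tau> \<xi> * h \<xi>)"
    let ?I = "\<lambda>g x. indicator (ball 0 (\<sigma> * \<tau> / r powr (s - 1))) x * g x :: complex"
    define D where "D = \<delta> * r powr (- s)"
    have D: "0 < D" using \<delta> r by (simp add: D_def)
    have rp: "0 < r powr s" "0 < r powr (s - 1)" using r by simp_all
    have "0 < r powr s * T0" using rp(1) pos(2) by (rule mult_pos_pos)
    with rt have \<tau>: "0 < \<tau>" by linarith
    note hL = L2_fourier_D(2)[OF fh] and vL = L2_fourier_D(1)[OF v]
    define M where "M = r powr (s - 1) * m"
    \<comment> \<open>The inverse velocity is bounded by splitting at \<open>|\<xi>| = 1/r\<close>, the frequency scale of \<open>f\<close>.\<close>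
    have M: "\<bar>inv_velocity s D j \<xi>\<bar> \<le> M" if "j \<in> Basis" for j \<xi> :: 'a
    proof -
      have "\<bar>inv_velocity s D j \<xi>\<bar> \<le> inverse r / D + inverse r powr (1 - s)"
        by (rule inv_velocity_bound[OF s D _ that]) (use r in simp)
      also have "inverse r / D = r powr (s - 1) * (1 / \<delta>)"
        using r \<delta> by (simp add: D_def powr_minus powr_diff field_simps)
      also have "inverse r powr (1 - s) = r powr (s - 1)"
        using r by (simp add: powr_def ln_inverse algebra_simps)
      finally show ?thesis by (simp add: M_def m_def distrib_left)
    qed
    let ?\<phi> = "\<lambda>\<xi>::'a. complex_of_real (norm \<xi> powr s / (D + norm \<xi> powr s))"
    have Dp: "D + norm \<xi> powr s > 0" for \<xi> :: 'a using D by (simp add: add_pos_nonneg)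
    have \<phi>m: "(\<lambda>\<xi>::'a. propagator s \<tau> \<xi> * ?\<phi> \<xi>) \<in> borel_measurable lebesgue"
      unfolding propagator_def by (rule borel_measurable_lebesgueI) measurable
    have \<phi>b: "cmod (propagator s \<tau> \<xi> * ?\<phi> \<xi>) \<le> 1" for \<xi> :: 'a
    proof -
      have "norm \<xi> powr s / (D + norm \<xi> powr s) \<le> 1"
        by (subst divide_le_eq_1_pos[OF Dp]) (use D in simp)
      moreover have "0 \<le> norm \<xi> powr s / (D + norm \<xi> powr s)"
        by (rule divide_nonneg_pos[OF powr_ge_zero Dp])
      ultimately show ?thesis
        unfolding norm_mult norm_propagator norm_of_real by (simp only: abs_of_nonneg mult_1)
    qed
    obtain v1 where v1: "L2_fourier v1 (\<lambda>\<xi>. propagator s \<tau> \<xi> * ?\<phi> \<xi> * h \<xi>)"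
      by (rule L2_fourier_surj[OF L2_mult_bounded(1)[OF hL \<phi>m \<phi>b]])
    note v1L = L2_fourier_D(1)[OF v1]
    have fast: "L2_norm (?I v1) \<le> 1/4 * L2_norm f"
    proof -
      let ?N = "L2_norm (?I v1)"
      have "\<tau> * s * ?N \<le> (?n * ((\<sigma> * \<tau> / r powr (s - 1)) * M) + (?n + s) / D + ?n * (M * r)) * L2_norm f"
      proof (rule fast_part_local_bound[OF s D \<tau> _ _ M fh supp v1])
        show "0 \<le> \<sigma> * \<tau> / r powr (s - 1)" using pos \<tau> by simp
      qed (use r in simp_all)
      also have "?n * ((\<sigma> * \<tau> / r powr (s - 1)) * M) = 1/8 * \<tau>"
        using rp n m by (simp add: M_def \<sigma>_def)
      also have "(?n + s) / D = (?n + s) / \<delta> * r powr s"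
        using r by (simp add: D_def powr_minus divide_simps)
      also have "?n * (M * r) = ?n * m * r powr s"
        using powr_mult_base[of r "s - 1"] r by (simp add: M_def mult_ac)
      also have "1/8 * \<tau> + (?n + s) / \<delta> * r powr s + ?n * m * r powr s = 1/8 * \<tau> + r powr s * T0 / 8"
        by (simp add: T0_def b_def algebra_simps)
      also have "(1/8 * \<tau> + r powr s * T0 / 8) * L2_norm f \<le> (1/4 * \<tau>) * L2_norm f"
        by (rule mult_right_mono[OF _ L2_norm_nonneg]) (use rt in linarith)
      finally have "\<tau> * (s * ?N) \<le> \<tau> * (1/4 * L2_norm f)" by (simp only: mult_ac)
      then have "s * ?N \<le> 1/4 * L2_norm f" using \<tau> by (rule mult_left_le_imp_le)
      moreover have "1 * ?N \<le> s * ?N" by (rule mult_right_mono[OF s L2_norm_nonneg])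
      ultimately show ?thesis by linarith
    qed
    have slow: "L2_norm (\<lambda>x. v x - v1 x) \<le> 1/8 * L2_norm f"
    proof -
      note sl = slow_part_bound[OF fh supp r \<kappa>(1) \<delta> s, folded D_def a_def]
      have d: "L2_fourier (\<lambda>x. v x - v1 x) (\<lambda>\<xi>. propagator s \<tau> \<xi> * h \<xi> - propagator s \<tau> \<xi> * ?\<phi> \<xi> * h \<xi>)"
        by (rule L2_fourier_diff[OF v v1])
      have "propagator s \<tau> \<xi> * h \<xi> - propagator s \<tau> \<xi> * ?\<phi> \<xi> * h \<xi>
          = propagator s \<tau> \<xi> * (of_real (D / (D + norm \<xi> powr s)) * h \<xi>)" for \<xi>
      proof -
        have "D / (D + norm \<xi> powr s) = 1 - norm \<xi> powr s / (D + norm \<xi> powr s)"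
          using Dp[of \<xi>] by (simp add: field_simps)
        then show ?thesis by (simp only: of_real_diff of_real_1 left_diff_distrib right_diff_distrib mult.assoc mult_1)
      qed
      then have "L2_norm (\<lambda>x. v x - v1 x) = L2_norm (\<lambda>\<xi>. propagator s \<tau> \<xi> * (of_real (D / (D + norm \<xi> powr s)) * h \<xi>))"
        using L2_fourier_isometry[OF d] by (simp only:)
      also have "\<dots> = L2_norm (\<lambda>\<xi>. of_real (D / (D + norm \<xi> powr s)) * h \<xi>)"
        by (rule L2_mult_unimodular(2)[OF sl(1) propagator_measurable norm_propagator])
      also have "\<dots> \<le> (a * sqrt (\<kappa> ^ DIM('a)) + \<delta> / \<kappa> powr s) * L2_norm f" by (rule sl(2))
      also have "\<dots> \<le> 1/8 * L2_norm f" by (rule mult_right_mono[OF small L2_norm_nonneg])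
      finally show ?thesis .
    qed
    have IL: "?I g \<in> L2" "L2_norm (?I g) \<le> L2_norm g" if "g \<in> L2" for g :: "'a \<Rightarrow> complex"
      by (rule L2_indicator_mult[OF that], simp)+
    have dL: "(\<lambda>x. v x - v1 x) \<in> L2" by (rule L2_diff(1)[OF vL v1L])
    have "L2_norm (?I v) \<le> L2_norm (?I v1) + L2_norm (\<lambda>x. ?I v x - ?I v1 x)"
      by (rule L2_norm_le_diff[OF IL(1)[OF vL] IL(1)[OF v1L]])
    also have "(\<lambda>x. ?I v x - ?I v1 x) = ?I (\<lambda>x. v x - v1 x)" by (simp only: right_diff_distrib)
    finally show "L2_norm (?I v) \<le> 1/2 * L2_norm f"
      using fast slow IL(2)[OF dL] L2_norm_nonneg[of f] by linarith
  qed
qed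

section \<open>The solution in terms of its Fourier transform\<close>

text \<open>Testing the equality of the two operators on a function with nowhere vanishing transform
  determines the symbol. A Gaussian divided by \<open>1 + |b|\<close> is such a transform and stays square-integrable
  when multiplied by \<open>b\<close>.\<close>

lemma fourier_multiplier_symbol_unique:
  fixes a b :: "'a::euclidean_space \<Rightarrow> real"
  assumes eq: "fourier_multiplier (\<lambda>\<xi>. of_real (b \<xi>)) = fourier_multiplier (\<lambda>\<xi>. of_real (a \<xi>))"
    and b [measurable]: "b \<in> borel_measurable borel"
  shows "AE \<xi> in lebesgue. a \<xi> = b \<xi>"
proof -
  define q where "q \<xi> = complex_of_real (gaussian_cutoff 1 \<xi>)" for \<xi> :: 'a
  have qm: "q \<in> borel_measurable borel" unfolding q_def by measurable
  have qi: "integrable lebesgue q" unfolding q_def by (rule gaussian_cutoff_integrable) simp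
  have "integrable lebesgue (\<lambda>\<xi>. (cmod (q \<xi>))\<^sup>2)"
  proof (rule Bochner_Integration.integrable_bound[OF qi])
    show "(\<lambda>\<xi>. (cmod (q \<xi>))\<^sup>2) \<in> borel_measurable lebesgue"
      by (rule borel_measurable_lebesgueI) (use qm in measurable)
    have "(cmod (q \<xi>))\<^sup>2 \<le> cmod (q \<xi>)" for \<xi>
      unfolding power2_eq_square by (rule mult_left_le) (simp_all add: q_def)
    then show "AE \<xi> in lebesgue. norm ((cmod (q \<xi>))\<^sup>2) \<le> cmod (q \<xi>)" by simp
  qed
  then have qL: "q \<in> L2" unfolding L2_def using borel_measurable_lebesgueI[OF qm] by simp
  let ?d = "\<lambda>\<xi>. complex_of_real (1 / (1 + \<bar>b \<xi>\<bar>))" and ?e = "\<lambda>\<xi>. complex_of_real (b \<xi> / (1 + \<bar>b \<xi>\<bar>))"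
  have dL: "(\<lambda>\<xi>. ?d \<xi> * q \<xi>) \<in> L2"
  proof (rule L2_mult_bounded(1)[OF qL])
    show "?d \<in> borel_measurable lebesgue" by (rule borel_measurable_lebesgueI) measurable
    show "cmod (?d \<xi>) \<le> 1" for \<xi> unfolding norm_of_real by (simp add: field_simps)
  qed
  have eL: "(\<lambda>\<xi>. ?e \<xi> * q \<xi>) \<in> L2"
  proof (rule L2_mult_bounded(1)[OF qL])
    show "?e \<in> borel_measurable lebesgue" by (rule borel_measurable_lebesgueI) measurable
    show "cmod (?e \<xi>) \<le> 1" for \<xi> unfolding norm_of_real abs_divide by (simp add: field_simps)
  qed
  obtain f where f: "L2_fourier f (\<lambda>\<xi>. ?d \<xi> * q \<xi>)" by (rule L2_fourier_surj[OF dL])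
  obtain g where g: "L2_fourier g (\<lambda>\<xi>. ?e \<xi> * q \<xi>)" by (rule L2_fourier_surj[OF eL])
  have "(\<lambda>\<xi>. ?e \<xi> * q \<xi>) = (\<lambda>\<xi>. of_real (b \<xi>) * (?d \<xi> * q \<xi>))"
    by (rule ext) simp
  with f g have "fourier_multiplier (\<lambda>\<xi>. of_real (b \<xi>)) f g"
    unfolding fourier_multiplier_def by metis
  then have "fourier_multiplier (\<lambda>\<xi>. of_real (a \<xi>)) f g" unfolding eq .
  then obtain h where h: "L2_fourier f h" "L2_fourier g (\<lambda>\<xi>. of_real (a \<xi>) * h \<xi>)"
    unfolding fourier_multiplier_def by blast
  show ?thesis
    using L2_fourier_unique[OF f h(1)] L2_fourier_unique[OF g h(2)]
  proof eventually_elim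
    case (elim \<xi>)
    have "?e \<xi> * q \<xi> = of_real (a \<xi>) * (?d \<xi> * q \<xi>)" using elim by simp
    moreover have "q \<xi> \<noteq> 0" by (simp add: q_def)
    ultimately have "complex_of_real (b \<xi> / (1 + \<bar>b \<xi>\<bar>)) = of_real (a \<xi> * (1 / (1 + \<bar>b \<xi>\<bar>)))" by simp
    then have "b \<xi> / (1 + \<bar>b \<xi>\<bar>) = a \<xi> / (1 + \<bar>b \<xi>\<bar>)" unfolding of_real_eq_iff by simp
    moreover have "1 + \<bar>b \<xi>\<bar> \<noteq> 0" by linarith
    ultimately show ?case by simp
  qed
qed

lemma frac_schroedinger_solution_transform:
  fixes u :: "'a::euclidean_space \<Rightarrow> real \<Rightarrow> complex"
  assumes "frac_schroedinger_solution s u0 u" and t: "0 \<le> t"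
  obtains h where "L2_fourier u0 h" "L2_fourier (\<lambda>x. u x t) (\<lambda>\<xi>. propagator s t \<xi> * h \<xi>)"
proof -
  have "unitary_group (frac_laplacian s) t u0 (\<lambda>x. u x t)"
    using assms unfolding frac_schroedinger_solution_def by blast
  then obtain a where a: "frac_laplacian s = fourier_multiplier (\<lambda>\<xi>. of_real (a \<xi> :: real))"
    and m: "fourier_multiplier (\<lambda>\<xi>. exp (- \<i> * of_real (t * a \<xi>))) u0 (\<lambda>x. u x t)"
    unfolding unitary_group_def by blast
  have ae: "AE \<xi> in lebesgue. a \<xi> = norm \<xi> powr s"
    by (rule fourier_multiplier_symbol_unique[OF a[unfolded frac_laplacian_def]]) measurable
  obtain h where h: "L2_fourier u0 h" "L2_fourier (\<lambda>x. u x t) (\<lambda>\<xi>. exp (- \<i> * of_real (t * a \<xi>)) * h \<xi>)"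
    using m unfolding fourier_multiplier_def by blast
  have "L2_fourier (\<lambda>x. u x t) (\<lambda>\<xi>. propagator s t \<xi> * h \<xi>)"
    by (rule L2_fourier_cong_AE[OF h(2)]) (simp, use ae in \<open>eventually_elim, simp add: propagator_def\<close>)
  with h(1) show thesis by (rule that)
qed

lemma propagator_diff: "propagator s (t2 - t1) \<xi> * (propagator s t1 \<xi> * z) = propagator s t2 \<xi> * z"
  unfolding propagator_def mult.assoc[symmetric] exp_add[symmetric] by (simp add: algebra_simps)

text \<open>The symbols found at the two times refer to transforms of \<open>u0\<close> that agree only almost everywhere, and
  their quotient is the propagator over the time between them.\<close>

lemma frac_schroedinger_two_times:
  fixes u :: "'a::euclidean_space \<Rightarrow> real \<Rightarrow> complex"
  assumes u: "frac_schroedinger_solution s u0 u" and t: "0 \<le> t1" "0 \<le> t2"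
  obtains h where "L2_fourier (\<lambda>x. u x t1) h"
    "L2_fourier (\<lambda>x. u x t2) (\<lambda>\<xi>. propagator s (t2 - t1) \<xi> * h \<xi>)"
    "L2_norm (\<lambda>x. u x t1) = L2_norm u0" "L2_norm (\<lambda>x. u x t2) = L2_norm u0"
proof -
  have norm: "L2_norm g = L2_norm u0" if "L2_fourier u0 h" "L2_fourier g (\<lambda>\<xi>. propagator s t \<xi> * h \<xi>)" for t g h
    using L2_fourier_isometry[OF that(2)] L2_fourier_isometry[OF that(1)]
      L2_mult_unimodular(2)[OF L2_fourier_D(2)[OF that(1)] propagator_measurable norm_propagator] by simp
  obtain h1 where h1: "L2_fourier u0 h1" "L2_fourier (\<lambda>x. u x t1) (\<lambda>\<xi>. propagator s t1 \<xi> * h1 \<xi>)"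
    by (rule frac_schroedinger_solution_transform[OF u t(1)])
  obtain h2 where h2: "L2_fourier u0 h2" "L2_fourier (\<lambda>x. u x t2) (\<lambda>\<xi>. propagator s t2 \<xi> * h2 \<xi>)"
    by (rule frac_schroedinger_solution_transform[OF u t(2)])
  have "L2_fourier (\<lambda>x. u x t2) (\<lambda>\<xi>. propagator s (t2 - t1) \<xi> * (propagator s t1 \<xi> * h1 \<xi>))"
    unfolding propagator_diff
    by (rule L2_fourier_cong_AE[OF h2(2)])
       (simp, use L2_fourier_unique[OF h2(1) h1(1)] in \<open>eventually_elim, simp\<close>)
  from that[OF h1(2) this norm[OF h1] norm[OF h2]] show thesis .
qed

section \<open>Observation at two times\<close>

lemma L2_norm_indicator_square:
  fixes f :: "'a::euclidean_space \<Rightarrow> complex"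
  shows "(L2_norm (\<lambda>x. indicator S x * f x))\<^sup>2 = (LINT x:S|lebesgue. (cmod (f x))\<^sup>2)"
proof -
  have "(cmod (indicator S x * f x))\<^sup>2 = indicator S x *\<^sub>R (cmod (f x))\<^sup>2" for x
    by (simp add: indicator_def)
  then show ?thesis by (simp only: L2_norm_square set_lebesgue_integral_def)
qed

theorem theorem3p2:
  fixes s :: real
  assumes "s \<ge> 1"
  shows "\<exists>\<sigma>>0. \<exists>T0>0. \<exists>C>0. \<forall>r>0. \<forall>t1 t2 :: real.
           0 \<le> t1 \<longrightarrow> t1 < t2 \<longrightarrow> t2 - t1 > r powr s * T0 \<longrightarrow>
           (\<forall>u0 \<in> L2. \<forall>u :: real ^ 'n \<Rightarrow> real \<Rightarrow> complex.
              frac_schroedinger_solution s u0 u \<longrightarrow>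
              (L2_norm u0)\<^sup>2 \<le> C *
                ((LINT x:{x. norm x \<ge> r}|lebesgue. (cmod (u x t1))\<^sup>2) +
                 (LINT x:{x. norm x \<ge> \<sigma> * (t2 - t1) / r powr (s - 1)}|lebesgue.
                    (cmod (u x t2))\<^sup>2)))"
proof (rule localised_state_escapes[OF assms, where 'a = "real ^ 'n"])
  fix \<sigma> T0 :: real
  assume pos: "0 < \<sigma>" "0 < T0"
    and escape: "\<And>r \<tau> (f :: real ^ 'n \<Rightarrow> complex) h v. 0 < r \<Longrightarrow> r powr s * T0 < \<tau> \<Longrightarrow>
      L2_fourier f h \<Longrightarrow> (\<And>x. r \<le> norm x \<Longrightarrow> f x = 0) \<Longrightarrow>
      L2_fourier v (\<lambda>\<xi>. propagator s \<tau> \<xi> * h \<xi>) \<Longrightarrow>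
      L2_norm (\<lambda>x. indicator (ball 0 (\<sigma> * \<tau> / r powr (s - 1))) x * v x) \<le> 1/2 * L2_norm f"
  have main: "(L2_norm u0)\<^sup>2 \<le> 8 *
      ((LINT x:{x. norm x \<ge> r}|lebesgue. (cmod (u x t1))\<^sup>2) +
       (LINT x:{x. norm x \<ge> \<sigma> * (t2 - t1) / r powr (s - 1)}|lebesgue. (cmod (u x t2))\<^sup>2))"
    if r: "0 < r" and t: "0 \<le> t1" "t1 < t2" and rt: "t2 - t1 > r powr s * T0"
      and u: "frac_schroedinger_solution s u0 u"
    for r t1 t2 u0 and u :: "real ^ 'n \<Rightarrow> real \<Rightarrow> complex"
  proof -
    define \<tau> \<rho> where "\<tau> = t2 - t1" and "\<rho> = \<sigma> * \<tau> / r powr (s - 1)"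
    define f g where "f = (\<lambda>x. u x t1)" and "g = (\<lambda>x. u x t2)"
    have t2: "0 \<le> t2" using t by linarith
    obtain h where fh: "L2_fourier f h" and gh: "L2_fourier g (\<lambda>\<xi>. propagator s \<tau> \<xi> * h \<xi>)"
      and nf: "L2_norm f = L2_norm u0" and ng: "L2_norm g = L2_norm u0"
      unfolding f_def g_def \<tau>_def by (rule frac_schroedinger_two_times[OF u t(1) t2])
    note fL = L2_fourier_D(1)[OF fh] and hL = L2_fourier_D(2)[OF fh] and gL = L2_fourier_D(1)[OF gh]
    let ?in = "\<lambda>R k x. indicator (ball 0 R) x * k x :: complex"
    let ?out = "\<lambda>R k x. indicator {x. R \<le> norm x} x * k x :: complex"
    have inL: "?in R k \<in> L2" "L2_norm (?in R k) \<le> L2_norm k" if "k \<in> L2" for R and k :: "real ^ 'n \<Rightarrow> complex"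
      by (rule L2_indicator_mult[OF that], simp)+
    have split: "k x - ?in R k x = ?out R k x" for R x and k :: "real ^ 'n \<Rightarrow> complex"
      by (cases "norm x < R") simp_all
    \<comment> \<open>\<open>v\<close> evolves from the part of \<open>f\<close> in the ball of radius \<open>r\<close>; by unitarity \<open>g - v\<close> is as large as the rest of \<open>f\<close>.\<close>
    obtain hi where hi: "L2_fourier (?in r f) hi" by (rule L2_fourier_exists[OF inL(1)[OF fL]])
    note hiL = L2_fourier_D(2)[OF hi]
    obtain v where v: "L2_fourier v (\<lambda>\<xi>. propagator s \<tau> \<xi> * hi \<xi>)"
      by (rule L2_fourier_surj[OF L2_mult_unimodular(1)[OF hiL propagator_measurable norm_propagator]])
    note vL = L2_fourier_D(1)[OF v]
    have in_v: "L2_norm (?in \<rho> v) \<le> 1/2 * L2_norm (?in r f)"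
      unfolding \<rho>_def by (rule escape[OF r _ hi _ v]) (use rt in \<open>simp_all add: \<tau>_def\<close>)
    have gv: "L2_norm (\<lambda>x. g x - v x) = L2_norm (?out r f)"
    proof -
      have "L2_norm (\<lambda>x. g x - v x) = L2_norm (\<lambda>\<xi>. propagator s \<tau> \<xi> * (h \<xi> - hi \<xi>))"
        using L2_fourier_isometry[OF L2_fourier_diff[OF gh v]] unfolding right_diff_distrib by (rule sym)
      also have "\<dots> = L2_norm (\<lambda>\<xi>. h \<xi> - hi \<xi>)"
        by (rule L2_mult_unimodular(2)[OF L2_diff(1)[OF hL hiL] propagator_measurable norm_propagator])
      also have "\<dots> = L2_norm (\<lambda>x. f x - ?in r f x)" by (rule L2_fourier_isometry[OF L2_fourier_diff[OF fh hi]])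
      finally show ?thesis unfolding split .
    qed
    have in_g: "L2_norm (?in \<rho> g) \<le> L2_norm (?in \<rho> v) + L2_norm (?out r f)"
    proof -
      have "L2_norm (?in \<rho> g) \<le> L2_norm (?in \<rho> v) + L2_norm (\<lambda>x. ?in \<rho> g x - ?in \<rho> v x)"
        by (rule L2_norm_le_diff[OF inL(1)[OF gL] inL(1)[OF vL]])
      also have "(\<lambda>x. ?in \<rho> g x - ?in \<rho> v x) = ?in \<rho> (\<lambda>x. g x - v x)" by (simp only: right_diff_distrib)
      finally show ?thesis using inL(2)[OF L2_diff(1)[OF gL vL], of \<rho>] gv by linarith
    qed
    have "L2_norm g \<le> L2_norm (?in \<rho> g) + L2_norm (?out \<rho> g)"
      using L2_norm_le_diff[OF gL inL(1)[OF gL], of \<rho>] unfolding split .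
    moreover have "U \<le> 2 * (d + b)"
      if "G \<le> a + b" "a \<le> c + d" "c \<le> 1/2 * e" "e \<le> F" "F = U" "G = U" for a b c d e F G U :: real
    proof -
      have "2 * c \<le> e" using mult_left_mono[OF that(3), of 2] by simp
      then show ?thesis using that by argo
    qed
    ultimately have "L2_norm u0 \<le> 2 * (L2_norm (?out r f) + L2_norm (?out \<rho> g))"
      using in_g in_v inL(2)[OF fL, of r] nf ng by blast
    then have "(L2_norm u0)\<^sup>2 \<le> (2 * (L2_norm (?out r f) + L2_norm (?out \<rho> g)))\<^sup>2"
      by (rule power_mono) (rule L2_norm_nonneg)
    also have "\<dots> \<le> 8 * ((L2_norm (?out r f))\<^sup>2 + (L2_norm (?out \<rho> g))\<^sup>2)"
    proof -
      have "(2 * (a + b))\<^sup>2 \<le> 8 * (a\<^sup>2 + b\<^sup>2)" for a b :: real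
        using sum_squares_bound[of a b] by (simp add: power2_sum power_mult_distrib)
      then show ?thesis .
    qed
    finally show ?thesis
      unfolding L2_norm_indicator_square f_def g_def \<rho>_def \<tau>_def .
  qed
  show ?thesis
    by (rule exI[of _ \<sigma>], rule conjI[OF pos(1)], rule exI[of _ T0], rule conjI[OF pos(2)],
        rule exI[of _ 8], intro conjI allI ballI impI, simp, rule main)
qed

end
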